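(* The functor $\mathcal{F}^m:\mathbf{Pcoh}_!\to\mathbf{Cstab_m}$ ($X\mapsto\mathcal{F}^mX$, $f\mapsto\hat f$) is a cartesian closed, full and faithful functor: it is full and faithful, for every finite family $(X_i)_{i\in I}$ of PCSs the canonical map $x\mapsto((x_{(i,a)})_a)_i$ is an isomorphism in $\mathbf{Cstab_m}$ from $\mathcal{F}^m(\prod_iX_i)$ to $\prod_i^{\mathbf{Cstab_m}}\mathcal{F}^mX_i$, and for all PCSs $X,Y$ the map $f\mapsto\hat f$ is an isomorphism in $\mathbf{Cstab_m}$ from $\mathcal{F}^m(X\Rightarrow Y)$ to $\mathcal{F}^mX\Rightarrow\mathcal{F}^mY$.
   Context: PCS $X=(|X|,\mathcal{P}(X))$: $|X|$ countable, $\mathcal{P}(X)\subseteq\mathbb{R}_{\ge0}^{|X|}$, $\mathcal{P}(X)^{\perp\perp}=\mathcal{P}(X)$ with $S^\perp=\{u:\sum_au_av_a\le1\ \forall v\in S\}$, each $a$ having $\lambda>0$ with $\lambda e_a\in\mathcal{P}(X)$ and a bound on $u_a$ over $\mathcal{P}(X)$. $\mathbf{Pcoh}_!$: objects PCSs; $\mathbf{Pcoh}_!(X,Y)$: $f\in\mathbb{R}_{\ge0}^{\mathcal{M}_{fin}(|X|)\times|Y|}$ with $\hat f(x):=f\cdot x^!\in\mathcal{P}(Y)$ for $x\in\mathcal{P}(X)$, $(f\cdot x^!)_b=\sum_\mu f_{\mu,b}\prod_ax_a^{\mu(a)}$; composition corresponds to composing the $\hat f$. $\prod_iX_i$: web $\bigcup_i\{i\}\times|X_i|$,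 cliques $x$ with $(x_{(i,a)})_a\in\mathcal{P}(X_i)$ for all $i$. $X\Rightarrow Y$: web $\mathcal{M}_{fin}(|X|)\times|Y|$, cliques $\mathbf{Pcoh}_!(X,Y)$. Cone $\mathcal{F}X=\{\alpha x:\alpha\ge0,x\in\mathcal{P}(X)\}$, pointwise operations, norm $\inf\{1/r:r>0,rx\in\mathcal{P}(X)\}$, unit ball $\mathcal{P}(X)$. Measurable cone: sequentially complete cone $C$ with families $\mathcal{M}_n(C)$ of functions from $\mathbb{R}^n$ to linear Scott-continuous maps $C\to\mathbb{R}_{\ge0}$, containing $0$, closed under precomposition with Borel measurable maps, with $\vec u\mapsto l(\vec u)(x)$ measurable. Measurable path of arity $n$: $\gamma:\mathbb{R}^n\to C$ with bounded image and $(\vec r,\vec s)\mapsto l(\vec r)(\gamma(\vec s))$ Borel measurable for all $l\in\mathcal{M}_k(C)$; unitary if image in unit ball. $\mathbf{Cstab_m}$: objects measurable cones; morphisms $C\to D$ are stable functions (pre-stable: $\sum_{I\subseteq\{1..n\},\,n-|I|\text{ odd}}f(x+\sum_{i\in I}u_i)\le\sum_{I,\,n-|I|\text{ even}}f(x+\sum_{i\in I}u_i)$ whenever $x+\sum u_i$ in the unit ball; preserving lubs of nondecreasing sequences; bounded) from unit ball to unit ball, sending unitary measurable paths to measurable paths. Finite products: tuples, componentwise operations, max norm, tests $\bigoplus_il_i$ with $(\bigoplus_il_i)(\vec r)((x_i))=\sum_il_i(\vec r)(x_i)$, $l_i\in\mathcal{M}_n(C_i)$. Exponential $C\Rightarrow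 D$: stable functions sending unitary measurable paths to measurable paths, pointwise operations, norm $\sup_{x\in\mathcal{B}C}\|f(x)\|$, tests $\gamma\triangleright m$ ($\gamma$ measurable path of arity $n$ of $C$, $m\in\mathcal{M}_n(D)$) with $(\gamma\triangleright m)(\vec r)(f)=m(\vec r)(f(\gamma(\vec r)))$. $\mathcal{F}^mX$ is $\mathcal{F}X$ with tests $\mathcal{M}_n=\{0\}\cup\{\epsilon_a:a\in|X|\}$, $\epsilon_a(\vec r)(x)=x_a$. *)

theory Defs
  imports "HOL-Analysis.Analysis" "HOL-Algebra.FiniteProduct" "HOL-Library.Multiset"
begin

section \<open>Probabilistic coherence spaces\<close>

text \<open>Vectors of nonnegative reals indexed by a web \<open>A\<close> are represented by functions on the whole
  type that vanish outside \<open>A\<close>.\<close>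

definition nnvecs :: "'a set \<Rightarrow> ('a \<Rightarrow> real) set" where
  "nnvecs A = {u. (\<forall>a\<in>A. 0 \<le> u a) \<and> (\<forall>a. a \<notin> A \<longrightarrow> u a = 0)}"

definition pdual :: "'a set \<Rightarrow> ('a \<Rightarrow> real) set \<Rightarrow> ('a \<Rightarrow> real) set" where
  "pdual A S = {u \<in> nnvecs A. \<forall>v\<in>S. (\<lambda>a. u a * v a) summable_on A \<and> (\<Sum>\<^sub>\<infinity>a\<in>A. u a * v a) \<le> 1}"

record 'a pcs =
  web :: "'a set"
  cliques :: "('a \<Rightarrow> real) set"

definition is_pcs :: "'a pcs \<Rightarrow> bool" where
  "is_pcs X \<longleftrightarrow>
     countable (web X) \<and>
     cliques X \<subseteq> nnvecs (web X) \<and>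
     pdual (web X) (pdual (web X) (cliques X)) = cliques X \<and>
     (\<forall>a\<in>web X. (\<exists>c>0. (\<lambda>b. if b = a then c else 0) \<in> cliques X) \<and>
                (\<exists>B. \<forall>u\<in>cliques X. u a \<le> B))"

definition mfin :: "'a set \<Rightarrow> 'a multiset set" where
  "mfin A = {\<mu>. set_mset \<mu> \<subseteq> A}"

definition mpow :: "('a \<Rightarrow> real) \<Rightarrow> 'a multiset \<Rightarrow> real" where
  "mpow x \<mu> = (\<Prod>a\<in>set_mset \<mu>. x a ^ count \<mu> a)"

definition hat :: "'a pcs \<Rightarrow> ('a multiset \<times> 'b \<Rightarrow> real) \<Rightarrow> ('a \<Rightarrow> real) \<Rightarrow> ('b \<Rightarrow> real)" where
  "hat X f x = (\<lambda>b. \<Sum>\<^sub>\<infinity>\<mu>\<in>mfin (web X). f (\<mu>, b) * mpow x \<mu>)"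

text \<open>Since a divergent \<open>infsum\<close> is \<open>0\<close>, finiteness of the series is a separate requirement.\<close>

definition pcoh_hom :: "'a pcs \<Rightarrow> 'b pcs \<Rightarrow> ('a multiset \<times> 'b \<Rightarrow> real) set" where
  "pcoh_hom X Y = {f \<in> nnvecs (mfin (web X) \<times> web Y). \<forall>x\<in>cliques X.
      (\<forall>b\<in>web Y. (\<lambda>\<mu>. f (\<mu>, b) * mpow x \<mu>) summable_on mfin (web X)) \<and>
      hat X f x \<in> cliques Y}"

definition pcoh_id :: "'a pcs \<Rightarrow> ('a multiset \<times> 'a \<Rightarrow> real)" where
  "pcoh_id X = (\<lambda>(\<mu>, a). if a \<in> web X \<and> \<mu> = {#a#} then 1 else 0)"

text \<open>\<open>promotion f \<mu> \<nu>\<close> is the coefficient of \<open>x\<^sup>\<mu>\<close> in the formal product, over the occurrences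
  \<open>b\<close> in \<open>\<nu>\<close>, of the power series \<open>\<Sum>m. f (m, b) x\<^sup>m\<close>. It does not depend on the enumeration
  chosen for \<open>\<nu>\<close>, and it is a finite sum.\<close>

definition promotion :: "('a multiset \<times> 'b \<Rightarrow> real) \<Rightarrow> 'a multiset \<Rightarrow> 'b multiset \<Rightarrow> real" where
  "promotion f \<mu> \<nu> =
     (let bs = (SOME bs. mset bs = \<nu>)
      in \<Sum>ms | length ms = length bs \<and> sum_list ms = \<mu>. \<Prod>i<length bs. f (ms ! i, bs ! i))"

definition pcoh_comp ::
  "'b pcs \<Rightarrow> ('b multiset \<times> 'c \<Rightarrow> real) \<Rightarrow> ('a multiset \<times> 'b \<Rightarrow> real) \<Rightarrow> ('a multiset \<times> 'c \<Rightarrow> real)" where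
  "pcoh_comp Y g f = (\<lambda>(\<mu>, c). \<Sum>\<^sub>\<infinity>\<nu>\<in>mfin (web Y). g (\<nu>, c) * promotion f \<mu> \<nu>)"

definition pcs_prod :: "'i set \<Rightarrow> ('i \<Rightarrow> 'a pcs) \<Rightarrow> ('i \<times> 'a) pcs" where
  "pcs_prod I X = \<lparr>web = (SIGMA i:I. web (X i)),
     cliques = {x \<in> nnvecs (SIGMA i:I. web (X i)). \<forall>i\<in>I. (\<lambda>a. x (i, a)) \<in> cliques (X i)}\<rparr>"

definition pcs_exp :: "'a pcs \<Rightarrow> 'b pcs \<Rightarrow> ('a multiset \<times> 'b) pcs" where
  "pcs_exp X Y = \<lparr>web = mfin (web X) \<times> web Y, cliques = pcoh_hom X Y\<rparr>"

section \<open>Measurable cones\<close>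

abbreviation Rn :: "nat \<Rightarrow> (nat \<Rightarrow> real) measure" where
  "Rn n \<equiv> Pi\<^sub>M {..<n} (\<lambda>_. borel)"

record 'c mcone =
  elems :: "'c set"
  czero :: 'c
  cadd :: "'c \<Rightarrow> 'c \<Rightarrow> 'c"
  cscale :: "real \<Rightarrow> 'c \<Rightarrow> 'c"
  cnorm :: "'c \<Rightarrow> real"
  tests :: "nat \<Rightarrow> ((nat \<Rightarrow> real) \<Rightarrow> 'c \<Rightarrow> real) set"

definition cone_monoid :: "'c mcone \<Rightarrow> 'c monoid" where
  "cone_monoid C = \<lparr>carrier = elems C, monoid.mult = cadd C, one = czero C\<rparr>"

definition csum :: "'c mcone \<Rightarrow> ('i \<Rightarrow> 'c) \<Rightarrow> 'i set \<Rightarrow> 'c" where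
  "csum C f A = finprod (cone_monoid C) f A"

definition is_cone :: "'c mcone \<Rightarrow> bool" where
  "is_cone C \<longleftrightarrow>
     comm_monoid (cone_monoid C) \<and>
     (\<forall>\<alpha>\<ge>0. \<forall>x\<in>elems C. cscale C \<alpha> x \<in> elems C) \<and>
     (\<forall>\<alpha>\<ge>0. \<forall>x\<in>elems C. \<forall>y\<in>elems C.
        cscale C \<alpha> (cadd C x y) = cadd C (cscale C \<alpha> x) (cscale C \<alpha> y)) \<and>
     (\<forall>\<alpha>\<ge>0. \<forall>\<beta>\<ge>0. \<forall>x\<in>elems C. cscale C (\<alpha> + \<beta>) x = cadd C (cscale C \<alpha> x) (cscale C \<beta> x)) \<and>
     (\<forall>\<alpha>\<ge>0. \<forall>\<beta>\<ge>0. \<forall>x\<in>elems C. cscale C (\<alpha> * \<beta>) x = cscale C \<alpha> (cscale C \<beta> x)) \<and>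
     (\<forall>x\<in>elems C. cscale C 1 x = x) \<and>
     (\<forall>x\<in>elems C. cscale C 0 x = czero C) \<and>
     (\<forall>\<alpha>\<ge>0. cscale C \<alpha> (czero C) = czero C) \<and>
     (\<forall>x\<in>elems C. \<forall>y\<in>elems C. \<forall>z\<in>elems C. cadd C x y = cadd C x z \<longrightarrow> y = z) \<and>
     (\<forall>x\<in>elems C. 0 \<le> cnorm C x) \<and>
     (\<forall>\<alpha>\<ge>0. \<forall>x\<in>elems C. cnorm C (cscale C \<alpha> x) = \<alpha> * cnorm C x) \<and>
     (\<forall>x\<in>elems C. cnorm C x = 0 \<longrightarrow> x = czero C) \<and>
     (\<forall>x\<in>elems C. \<forall>y\<in>elems C. cnorm C (cadd C x y) \<le> cnorm C x + cnorm C y) \<and>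
     (\<forall>x\<in>elems C. \<forall>y\<in>elems C. cnorm C x \<le> cnorm C (cadd C x y))"

definition unit_ball :: "'c mcone \<Rightarrow> 'c set" where
  "unit_ball C = {x \<in> elems C. cnorm C x \<le> 1}"

definition cle :: "'c mcone \<Rightarrow> 'c \<Rightarrow> 'c \<Rightarrow> bool" where
  "cle C x y \<longleftrightarrow> (\<exists>z\<in>elems C. y = cadd C x z)"

definition nondecreasing :: "'c mcone \<Rightarrow> (nat \<Rightarrow> 'c) \<Rightarrow> bool" where
  "nondecreasing C x \<longleftrightarrow> (\<forall>n. x n \<in> elems C) \<and> (\<forall>n. cle C (x n) (x (Suc n)))"

definition is_seq_lub :: "'c mcone \<Rightarrow> (nat \<Rightarrow> 'c) \<Rightarrow> 'c \<Rightarrow> bool" where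
  "is_seq_lub C x s \<longleftrightarrow> s \<in> elems C \<and> (\<forall>n. cle C (x n) s) \<and>
     (\<forall>t\<in>elems C. (\<forall>n. cle C (x n) t) \<longrightarrow> cle C s t)"

definition seq_complete :: "'c mcone \<Rightarrow> bool" where
  "seq_complete C \<longleftrightarrow> (\<forall>x. nondecreasing C x \<and> range x \<subseteq> unit_ball C \<longrightarrow>
     (\<exists>s\<in>unit_ball C. is_seq_lub C x s))"

definition linear_scott :: "'c mcone \<Rightarrow> ('c \<Rightarrow> real) \<Rightarrow> bool" where
  "linear_scott C l \<longleftrightarrow>
     (\<forall>x\<in>elems C. 0 \<le> l x) \<and>
     (\<forall>x\<in>elems C. \<forall>y\<in>elems C. l (cadd C x y) = l x + l y) \<and>
     (\<forall>\<alpha>\<ge>0. \<forall>x\<in>elems C. l (cscale C \<alpha> x) = \<alpha> * l x) \<and>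
     (\<forall>x s. nondecreasing C x \<and> is_seq_lub C x s \<longrightarrow>
        bdd_above (range (\<lambda>n. l (x n))) \<and> l s = (SUP n. l (x n)))"

text \<open>Members of \<open>tests C n\<close> stand for their restrictions to \<open>\<real>\<^sup>n\<close> and \<open>elems C\<close>; their values
  elsewhere carry no meaning, so membership conditions are up to agreement there.\<close>

definition measurable_cone :: "'c mcone \<Rightarrow> bool" where
  "measurable_cone C \<longleftrightarrow>
     is_cone C \<and> seq_complete C \<and>
     (\<forall>n. \<forall>l\<in>tests C n. \<forall>r\<in>space (Rn n). linear_scott C (l r)) \<and>
     (\<forall>n. \<exists>l\<in>tests C n. \<forall>r\<in>space (Rn n). \<forall>x\<in>elems C. l r x = 0) \<and>
     (\<forall>m n. \<forall>l\<in>tests C n. \<forall>h\<in>measurable (Rn m) (Rn n).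
        \<exists>l'\<in>tests C m. \<forall>r\<in>space (Rn m). \<forall>x\<in>elems C. l' r x = l (h r) x) \<and>
     (\<forall>n. \<forall>l\<in>tests C n. \<forall>x\<in>elems C. (\<lambda>r. l r x) \<in> borel_measurable (Rn n))"

definition meas_path :: "'c mcone \<Rightarrow> nat \<Rightarrow> ((nat \<Rightarrow> real) \<Rightarrow> 'c) \<Rightarrow> bool" where
  "meas_path C n \<gamma> \<longleftrightarrow>
     (\<forall>s\<in>space (Rn n). \<gamma> s \<in> elems C) \<and>
     (\<exists>B. \<forall>s\<in>space (Rn n). cnorm C (\<gamma> s) \<le> B) \<and>
     (\<forall>k. \<forall>l\<in>tests C k. (\<lambda>(r, s). l r (\<gamma> s)) \<in> borel_measurable (Rn k \<Otimes>\<^sub>M Rn n))"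

definition unitary_path :: "'c mcone \<Rightarrow> nat \<Rightarrow> ((nat \<Rightarrow> real) \<Rightarrow> 'c) \<Rightarrow> bool" where
  "unitary_path C n \<gamma> \<longleftrightarrow> meas_path C n \<gamma> \<and> (\<forall>s\<in>space (Rn n). \<gamma> s \<in> unit_ball C)"

section \<open>Stable functions and the category of measurable cones\<close>

definition pre_stable :: "'c mcone \<Rightarrow> 'd mcone \<Rightarrow> ('c \<Rightarrow> 'd) \<Rightarrow> bool" where
  "pre_stable C D f \<longleftrightarrow>
     (\<forall>(n::nat) x u. x \<in> elems C \<and> (\<forall>i\<in>{1..n}. u i \<in> elems C) \<and>
        cadd C x (csum C u {1..n}) \<in> unit_ball C \<longrightarrow>
        cle D
          (csum D (\<lambda>J. f (cadd C x (csum C u J))) {J. J \<subseteq> {1..n} \<and> odd (n - card J)})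
          (csum D (\<lambda>J. f (cadd C x (csum C u J))) {J. J \<subseteq> {1..n} \<and> even (n - card J)}))"

definition stable :: "'c mcone \<Rightarrow> 'd mcone \<Rightarrow> ('c \<Rightarrow> 'd) \<Rightarrow> bool" where
  "stable C D f \<longleftrightarrow>
     f \<in> unit_ball C \<rightarrow>\<^sub>E elems D \<and>
     pre_stable C D f \<and>
     (\<forall>x s. nondecreasing C x \<and> range x \<subseteq> unit_ball C \<and> is_seq_lub C x s \<longrightarrow>
        is_seq_lub D (\<lambda>n. f (x n)) (f s)) \<and>
     (\<exists>B. \<forall>x\<in>unit_ball C. cnorm D (f x) \<le> B)"

definition meas_stable :: "'c mcone \<Rightarrow> 'd mcone \<Rightarrow> ('c \<Rightarrow> 'd) set" where
  "meas_stable C D = {f. stable C D f \<and>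
     (\<forall>n \<gamma>. unitary_path C n \<gamma> \<longrightarrow> meas_path D n (\<lambda>r. f (\<gamma> r)))}"

definition cstab_hom :: "'c mcone \<Rightarrow> 'd mcone \<Rightarrow> ('c \<Rightarrow> 'd) set" where
  "cstab_hom C D = {f \<in> meas_stable C D. \<forall>x\<in>unit_ball C. f x \<in> unit_ball D}"

definition cstab_id :: "'c mcone \<Rightarrow> 'c \<Rightarrow> 'c" where
  "cstab_id C = (\<lambda>x\<in>unit_ball C. x)"

definition cstab_comp :: "'c mcone \<Rightarrow> ('d \<Rightarrow> 'e) \<Rightarrow> ('c \<Rightarrow> 'd) \<Rightarrow> 'c \<Rightarrow> 'e" where
  "cstab_comp C g f = compose (unit_ball C) g f"

definition cstab_iso :: "'c mcone \<Rightarrow> 'd mcone \<Rightarrow> ('c \<Rightarrow> 'd) \<Rightarrow> bool" where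
  "cstab_iso C D f \<longleftrightarrow> measurable_cone C \<and> measurable_cone D \<and> f \<in> cstab_hom C D \<and>
     (\<exists>g\<in>cstab_hom D C. cstab_comp C g f = cstab_id C \<and> cstab_comp D f g = cstab_id D)"

text \<open>The \<open>0\<close> inserted under \<open>Max\<close> only matters for the empty product.\<close>

definition cone_prod :: "'i set \<Rightarrow> ('i \<Rightarrow> 'c mcone) \<Rightarrow> ('i \<Rightarrow> 'c) mcone" where
  "cone_prod I C = \<lparr>
     elems = (\<Pi>\<^sub>E i\<in>I. elems (C i)),
     czero = (\<lambda>i\<in>I. czero (C i)),
     cadd = (\<lambda>x y. \<lambda>i\<in>I. cadd (C i) (x i) (y i)),
     cscale = (\<lambda>\<alpha> x. \<lambda>i\<in>I. cscale (C i) \<alpha> (x i)),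
     cnorm = (\<lambda>x. Max (insert 0 ((\<lambda>i. cnorm (C i) (x i)) ` I))),
     tests = (\<lambda>n. {\<lambda>r x. \<Sum>i\<in>I. l i r (x i) | l. \<forall>i\<in>I. l i \<in> tests (C i) n})\<rparr>"

text \<open>The paths used in the tests are unitary because the elements of the exponential are only
  defined on the unit ball.\<close>

definition cone_exp :: "'c mcone \<Rightarrow> 'd mcone \<Rightarrow> ('c \<Rightarrow> 'd) mcone" where
  "cone_exp C D = \<lparr>
     elems = meas_stable C D,
     czero = (\<lambda>x\<in>unit_ball C. czero D),
     cadd = (\<lambda>f g. \<lambda>x\<in>unit_ball C. cadd D (f x) (g x)),
     cscale = (\<lambda>\<alpha> f. \<lambda>x\<in>unit_ball C. cscale D \<alpha> (f x)),
     cnorm = (\<lambda>f. SUP x\<in>unit_ball C. cnorm D (f x)),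
     tests = (\<lambda>n. {\<lambda>r f. m r (f (\<gamma> r)) | \<gamma> m. unitary_path C n \<gamma> \<and> m \<in> tests D n})\<rparr>"

section \<open>The functor\<close>

definition Fm :: "'a pcs \<Rightarrow> ('a \<Rightarrow> real) mcone" where
  "Fm X = \<lparr>
     elems = {\<lambda>a. \<alpha> * x a | \<alpha> x. 0 \<le> \<alpha> \<and> x \<in> cliques X},
     czero = (\<lambda>a. 0),
     cadd = (\<lambda>x y a. x a + y a),
     cscale = (\<lambda>\<alpha> x a. \<alpha> * x a),
     cnorm = (\<lambda>x. Inf {1 / r | r. 0 < r \<and> (\<lambda>a. r * x a) \<in> cliques X}),
     tests = (\<lambda>n. {\<lambda>r x. 0} \<union> {\<lambda>r x. x a | a. a \<in> web X})\<rparr>"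

definition Fm_map :: "'a pcs \<Rightarrow> ('a multiset \<times> 'b \<Rightarrow> real) \<Rightarrow> ('a \<Rightarrow> real) \<Rightarrow> ('b \<Rightarrow> real)" where
  "Fm_map X f = (\<lambda>x\<in>unit_ball (Fm X). hat X f x)"

definition prod_map ::
  "'i set \<Rightarrow> ('i \<Rightarrow> 'a pcs) \<Rightarrow> ('i \<times> 'a \<Rightarrow> real) \<Rightarrow> ('i \<Rightarrow> 'a \<Rightarrow> real)" where
  "prod_map I X = (\<lambda>x\<in>unit_ball (Fm (pcs_prod I X)). \<lambda>i\<in>I. \<lambda>a. x (i, a))"

definition exp_map ::
  "'a pcs \<Rightarrow> 'b pcs \<Rightarrow> ('a multiset \<times> 'b \<Rightarrow> real) \<Rightarrow> ('a \<Rightarrow> real) \<Rightarrow> ('b \<Rightarrow> real)" where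
  "exp_map X Y = (\<lambda>f\<in>unit_ball (Fm (pcs_exp X Y)). Fm_map X f)"

end

theory Submission
  imports Defs
begin

text \<open>
  A matrix \<open>f\<close> is a morphism \<open>X \<rightarrow> Y\<close> iff its pairing with \<open>x\<^sup>! \<otimes> v\<close> is at most \<open>1\<close> for all cliques
  \<open>x\<close> of \<open>X\<close> and \<open>v\<close> of the dual of \<open>Y\<close>, so the morphisms form a dual set and \<open>X \<Rightarrow> Y\<close> is a PCS.
  Power series with nonnegative coefficients have nonnegative iterated differences, because
  monomials do, and commute with monotone limits; hence \<open>hat X f\<close> is stable.

  Conversely, let \<open>\<phi>\<close> be stable and \<open>x\<close> a clique of finite support. Newton's formula on the grid of
  mesh \<open>2\<^sup>-\<^sup>k\<close> in the box below \<open>x\<close> writes each coordinate of \<open>\<phi>\<close> as a polynomial whose coefficients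
  are iterated differences, hence nonnegative, and add up to the value at \<open>x\<close>. Along a subsequence
  the coefficients converge, and dominated convergence identifies \<open>\<phi>\<close> with the limiting power series.
  The coefficients do not depend on the box, since a power series determines its coefficients;
  continuity extends the formula to all cliques.

  The two comparison maps are linear isometric bijections from a cone \<open>Fm Z\<close>, along which the cone
  structure and stability are transported. What remains is measurability; for the inverse of
  \<open>f \<mapsto> hat X f\<close> it holds because coefficients are pointwise limits of expressions in the values.
\<close>

text \<open>Stability offers no derivatives: only inequalities between finite sums of values inside
  the unit ball, and convergence along nondecreasing sequences. Three choices answer this. Grids are
  dyadic, so that points obtained by rounding down increase. Coefficients at different meshes are
  not comparable, so a limit is extracted by compactness of a countable power of an interval. The
  majorant \<open>B * mpow t \<mu>\<close> is summable only if every coordinate of \<open>t\<close>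
  is below 1, so the faces of the cube are reached afterwards, by monotone convergence. The
  real-valued sums of the definitions are 0 when they diverge, so a bound on such a sum says nothing
  without a separate claim of summability. Nonnegative families are therefore mostly summed in the
  extended reals by \<open>esum\<close>, where divergence has the value infinity, one inequality
  expresses both claims and countable sums may be exchanged.\<close>

abbreviation esum :: "'a set \<Rightarrow> ('a \<Rightarrow> real) \<Rightarrow> ennreal" where
  "esum A f \<equiv> (\<integral>\<^sup>+a. ennreal (f a) \<partial>count_space A)"

lemma esum_cong: "(\<And>a. a \<in> A \<Longrightarrow> f a = g a) \<Longrightarrow> esum A f = esum A g"
  by (auto intro!: nn_integral_cong)

lemma esum_mono: "(\<And>a. a \<in> A \<Longrightarrow> f a \<le> g a) \<Longrightarrow> esum A f \<le> esum A g"
  by (auto intro!: nn_integral_mono ennreal_leI)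

lemma summable_on_iff_esum:
  assumes "\<And>a. a \<in> A \<Longrightarrow> 0 \<le> f a"
  shows "f summable_on A \<longleftrightarrow> esum A f < \<infinity>"
proof -
  have "f summable_on A \<longleftrightarrow> integrable (count_space A) f"
    using summable_on_iff_abs_summable_on_real[of f A] abs_summable_equivalent[of f A]
    by (simp add: abs_summable_on_def)
  also have "\<dots> \<longleftrightarrow> esum A (\<lambda>a. norm (f a)) < \<infinity>"
    by (simp add: integrable_iff_bounded)
  also have "esum A (\<lambda>a. norm (f a)) = esum A f"
    using assms by (intro esum_cong) simp
  finally show ?thesis .
qed

lemma esum_eq_infsum:
  assumes "\<And>a. a \<in> A \<Longrightarrow> 0 \<le> f a" "f summable_on A"
  shows "esum A f = ennreal (infsum f A)"
proof -
  have abs: "Infinite_Set_Sum.abs_summable_on f A"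
    using assms(2) summable_on_iff_abs_summable_on_real[of f A] abs_summable_equivalent[of f A] by simp
  have "esum A f = ennreal (integral\<^sup>L (count_space A) f)"
    using abs assms(1) by (intro nn_integral_eq_integral) (auto simp: abs_summable_on_def AE_count_space)
  also have "integral\<^sup>L (count_space A) f = infsum f A"
    using infsetsum_infsum[OF abs] by (simp add: infsetsum_def)
  finally show ?thesis .
qed

text \<open>Both requirements in \<open>pdual\<close>, summability and the bound, become one
  inequality, because a divergent sum has the value infinity on the left.\<close>

lemma esum_le_iff:
  assumes "\<And>a. a \<in> A \<Longrightarrow> 0 \<le> f a" "0 \<le> c"
  shows "esum A f \<le> ennreal c \<longleftrightarrow> f summable_on A \<and> infsum f A \<le> c"
proof (cases "f summable_on A")
  case True
  then show ?thesis using esum_eq_infsum[OF assms(1) True] assms(2) by simp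
next
  case False
  then have "esum A f = \<infinity>" using summable_on_iff_esum[of A f] assms(1) top.not_eq_extremum by (metis infinity_ennreal_def)
  then show ?thesis using False by (simp add: top_unique)
qed

lemma esum_eq_iff:
  assumes "\<And>a. a \<in> A \<Longrightarrow> 0 \<le> f a" "0 \<le> c"
  shows "esum A f = ennreal c \<longleftrightarrow> f summable_on A \<and> infsum f A = c"
proof (cases "f summable_on A")
  case True
  moreover have "0 \<le> infsum f A" using assms(1) by (simp add: infsum_nonneg)
  ultimately show ?thesis using esum_eq_infsum[OF assms(1) True] assms(2) by simp
next
  case False
  then have "esum A f = \<infinity>" using summable_on_iff_esum[of A f] assms(1) top.not_eq_extremum by (metis infinity_ennreal_def)
  then show ?thesis using False by simp
qed

lemma esum_add:
  assumes "\<And>a. a \<in> A \<Longrightarrow> 0 \<le> f a" "\<And>a. a \<in> A \<Longrightarrow> 0 \<le> g a"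
  shows "esum A (\<lambda>a. f a + g a) = esum A f + esum A g"
  by (subst nn_integral_add[symmetric]) (auto intro!: nn_integral_cong simp: assms)

lemma esum_cmult:
  assumes "\<And>a. a \<in> A \<Longrightarrow> 0 \<le> f a" "0 \<le> c"
  shows "esum A (\<lambda>a. c * f a) = ennreal c * esum A f"
  by (subst nn_integral_cmult[symmetric]) (auto intro!: nn_integral_cong simp: assms ennreal_mult)

lemma esum_ge:
  assumes "a \<in> A"
  shows "ennreal (f a) \<le> esum A f"
proof -
  have "ennreal (f a) = esum {a} f" by (simp add: nn_integral_count_space_finite)
  also have "\<dots> \<le> (\<integral>\<^sup>+b. ennreal (f b) * indicator {a} b \<partial>count_space A)"
    using assms by (subst nn_integral_count_space'[of "{a}"]) (auto simp: nn_integral_count_space_finite)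
  also have "\<dots> \<le> esum A f" by (intro nn_integral_mono) (auto split: split_indicator)
  finally show ?thesis .
qed

text \<open>Monotone convergence, in the form in which increasing limits of cliques and of power
  series are taken.\<close>

lemma esum_monotone_tendsto:
  assumes nn: "\<And>n a. a \<in> A \<Longrightarrow> 0 \<le> f n a"
    and inc: "\<And>n a. a \<in> A \<Longrightarrow> f n a \<le> f (Suc n) a"
    and lim: "\<And>a. a \<in> A \<Longrightarrow> (\<lambda>n. f n a) \<longlonglongrightarrow> g a"
  shows "(\<lambda>n. esum A (f n)) \<longlonglongrightarrow> esum A g" and "esum A g = (SUP n. esum A (f n))"
proof -
  have "esum A g = (\<integral>\<^sup>+a. (SUP n. ennreal (f n a)) \<partial>count_space A)"
  proof (intro nn_integral_cong)
    fix a assume "a \<in> space (count_space A)"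
    then have a: "a \<in> A" by simp
    have "(\<lambda>n. ennreal (f n a)) \<longlonglongrightarrow> ennreal (g a)" using lim[OF a] by (intro tendsto_ennrealI)
    moreover have "(\<lambda>n. ennreal (f n a)) \<longlonglongrightarrow> (SUP n. ennreal (f n a))"
      using inc[OF a] by (intro LIMSEQ_SUP incseq_SucI ennreal_leI) auto
    ultimately show "ennreal (g a) = (SUP n. ennreal (f n a))" by (rule LIMSEQ_unique)
  qed
  also have "\<dots> = (SUP n. esum A (f n))"
    by (rule nn_integral_monotone_convergence_SUP_AE) (auto simp: AE_count_space intro!: ennreal_leI inc)
  finally show *: "esum A g = (SUP n. esum A (f n))" .
  show "(\<lambda>n. esum A (f n)) \<longlonglongrightarrow> esum A g"
    unfolding * by (intro LIMSEQ_SUP incseq_SucI esum_mono inc)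
qed

text \<open>Tonelli's theorem for counting measures, reduced to whole types by indicator
  functions.\<close>

lemma nn_integral_count_space_Times:
  "(\<integral>\<^sup>+p. f p \<partial>count_space (A \<times> B)) = (\<integral>\<^sup>+a. \<integral>\<^sup>+b. f (a, b) \<partial>count_space B \<partial>count_space A)"
proof -
  have "(\<integral>\<^sup>+a. \<integral>\<^sup>+b. f (a, b) \<partial>count_space B \<partial>count_space A)
      = (\<integral>\<^sup>+a. \<integral>\<^sup>+b. f (a, b) * indicator B b * indicator A a \<partial>count_space UNIV \<partial>count_space UNIV)"
    by (subst (1 2) nn_integral_count_space_indicator) (auto simp: nn_integral_multc)
  also have "\<dots> = (\<integral>\<^sup>+a. \<integral>\<^sup>+b. (\<lambda>p. f p * indicator (A \<times> B) p) (a, b) \<partial>count_space UNIV \<partial>count_space UNIV)"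
    by (intro nn_integral_cong) (auto split: split_indicator)
  also have "\<dots> = (\<integral>\<^sup>+p. f p * indicator (A \<times> B) p \<partial>count_space UNIV)"
    by (rule nn_integral_fst_count_space)
  also have "\<dots> = (\<integral>\<^sup>+p. f p \<partial>count_space (A \<times> B))"
    by (subst (2) nn_integral_count_space_indicator) auto
  finally show ?thesis by simp
qed

section \<open>Monomials indexed by finite multisets\<close>

lemma mpow_eq_prod_mset: "mpow x \<mu> = (\<Prod>a\<in>#\<mu>. x a)"
  by (simp add: mpow_def image_prod_mset_multiplicity)

lemma mpow_simps [simp]:
  "mpow x {#} = 1" "mpow x (add_mset a \<mu>) = x a * mpow x \<mu>" "mpow x (\<mu> + \<nu>) = mpow x \<mu> * mpow x \<nu>"
  by (simp_all add: mpow_eq_prod_mset)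

lemma mpow_nonneg: "(\<And>a. a \<in># \<mu> \<Longrightarrow> 0 \<le> x a) \<Longrightarrow> 0 \<le> mpow x \<mu>"
  by (simp add: mpow_def prod_nonneg)

lemma mpow_mono: "(\<And>a. a \<in># \<mu> \<Longrightarrow> 0 \<le> x a \<and> x a \<le> y a) \<Longrightarrow> mpow x \<mu> \<le> mpow y \<mu>"
  by (auto simp add: mpow_def intro!: prod_mono power_mono)

lemma mpow_mult: "mpow (\<lambda>a. x a * y a) \<mu> = mpow x \<mu> * mpow y \<mu>"
  by (simp add: mpow_def power_mult_distrib prod.distrib)

lemma mpow_cong: "(\<And>a. a \<in># \<mu> \<Longrightarrow> x a = y a) \<Longrightarrow> mpow x \<mu> = mpow y \<mu>"
  by (simp add: mpow_def)

lemma tendsto_mpow: "(\<And>a. a \<in># \<mu> \<Longrightarrow> (\<lambda>n. x n a) \<longlonglongrightarrow> y a) \<Longrightarrow> (\<lambda>n. mpow (x n) \<mu>) \<longlonglongrightarrow> mpow y \<mu>"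
  unfolding mpow_def by (intro tendsto_prod tendsto_power) auto

lemma countable_mfin:
  assumes "countable A"
  shows "countable (mfin A)"
proof -
  have "mfin A \<subseteq> mset ` lists A"
  proof
    fix \<mu> assume "\<mu> \<in> mfin A"
    moreover obtain xs where "mset xs = \<mu>" using ex_mset by blast
    ultimately show "\<mu> \<in> mset ` lists A" by (intro image_eqI[of _ _ xs]) (auto simp: mfin_def)
  qed
  then show ?thesis using assms by (meson countable_image countable_lists countable_subset)
qed

section \<open>Duality and cliques\<close>

lemma pdual_iff:
  assumes "S \<subseteq> nnvecs A"
  shows "u \<in> pdual A S \<longleftrightarrow> u \<in> nnvecs A \<and> (\<forall>v\<in>S. esum A (\<lambda>a. u a * v a) \<le> 1)"
proof -
  have "esum A (\<lambda>a. u a * v a) \<le> 1 \<longleftrightarrow> (\<lambda>a. u a * v a) summable_on A \<and> (\<Sum>\<^sub>\<infinity>a\<in>A. u a * v a) \<le> 1"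
    if "u \<in> nnvecs A" "v \<in> S" for v
    using esum_le_iff[of A "\<lambda>a. u a * v a" 1] that assms by (fastforce simp: nnvecs_def)
  then show ?thesis by (auto simp: pdual_def)
qed

lemma pdual_subset: "pdual A S \<subseteq> nnvecs A"
  by (auto simp: pdual_def)

lemma subset_pdual_pdual:
  assumes "S \<subseteq> nnvecs A"
  shows "S \<subseteq> pdual A (pdual A S)"
proof
  fix x assume x: "x \<in> S"
  have "esum A (\<lambda>a. x a * v a) \<le> 1" if "v \<in> pdual A S" for v
    using that x unfolding pdual_iff[OF assms] by (subst mult.commute) blast
  then show "x \<in> pdual A (pdual A S)" using x assms by (auto simp: pdual_iff[OF pdual_subset])
qed

lemma pdual_antimono: "S \<subseteq> T \<Longrightarrow> pdual A T \<subseteq> pdual A S"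
  by (auto simp: pdual_def)

text \<open>The usual Galois connection argument. For the exponential and the product, the biduality
  axiom then only requires exhibiting the cliques as the dual of some set of tests.\<close>

lemma pdual_pdual_pdual:
  assumes "S \<subseteq> nnvecs A"
  shows "pdual A (pdual A (pdual A S)) = pdual A S"
  using pdual_antimono[OF subset_pdual_pdual[OF assms]] subset_pdual_pdual[OF pdual_subset] by blast

context
  fixes X :: "'a pcs"
  assumes X: "is_pcs X"
begin

lemma countable_web: "countable (web X)"
  using X by (simp add: is_pcs_def)

lemma clique_nnvecs: "x \<in> cliques X \<Longrightarrow> x \<in> nnvecs (web X)"
  using X by (auto simp: is_pcs_def)

lemma clique_nonneg: "x \<in> cliques X \<Longrightarrow> 0 \<le> x a"
  by (cases "a \<in> web X") (auto simp: nnvecs_def dest: clique_nnvecs)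

lemma clique_outside: "x \<in> cliques X \<Longrightarrow> a \<notin> web X \<Longrightarrow> x a = 0"
  by (auto simp: nnvecs_def dest: clique_nnvecs)

lemma clique_bound: "a \<in> web X \<Longrightarrow> \<exists>B. \<forall>u\<in>cliques X. u a \<le> B"
  using X by (simp add: is_pcs_def)

text \<open>Downward closure, convexity and closure under increasing limits are checked below one
  linear inequality at a time; this form provides the inequalities, with nonnegative coefficients
  \<open>v\<close>.\<close>

lemma clique_iff:
  "x \<in> cliques X \<longleftrightarrow> x \<in> nnvecs (web X) \<and>
     (\<forall>v\<in>pdual (web X) (cliques X). esum (web X) (\<lambda>a. x a * v a) \<le> 1)"
  using X pdual_iff[OF pdual_subset] by (metis is_pcs_def)

lemma clique_down:
  assumes "x \<in> cliques X" "y \<in> nnvecs (web X)" "\<And>a. a \<in> web X \<Longrightarrow> y a \<le> x a"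
  shows "y \<in> cliques X"
  unfolding clique_iff
proof (intro conjI ballI)
  fix v assume v: "v \<in> pdual (web X) (cliques X)"
  have "esum (web X) (\<lambda>a. y a * v a) \<le> esum (web X) (\<lambda>a. x a * v a)"
    using v assms pdual_subset[of "web X"]
    by (intro esum_mono mult_right_mono) (auto simp: nnvecs_def)
  also have "\<dots> \<le> 1" using assms(1) v clique_iff by blast
  finally show "esum (web X) (\<lambda>a. y a * v a) \<le> 1" .
qed fact

lemma clique_convex:
  assumes "x \<in> cliques X" "y \<in> cliques X" "0 \<le> s" "0 \<le> t" "s + t \<le> 1"
  shows "(\<lambda>a. s * x a + t * y a) \<in> cliques X"
  unfolding clique_iff
proof (intro conjI ballI)
  fix v assume v: "v \<in> pdual (web X) (cliques X)"
  then have v0: "0 \<le> v a" if "a \<in> web X" for a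
    using pdual_subset[of "web X" "cliques X"] that by (auto simp: nnvecs_def)
  have "esum (web X) (\<lambda>a. (s * x a + t * y a) * v a)
      = esum (web X) (\<lambda>a. s * (x a * v a) + t * (y a * v a))"
    by (intro esum_cong) (simp add: algebra_simps)
  also have "\<dots> = ennreal s * esum (web X) (\<lambda>a. x a * v a) + ennreal t * esum (web X) (\<lambda>a. y a * v a)"
    using assms(3,4) clique_nonneg[OF assms(1)] clique_nonneg[OF assms(2)] v0
    by (subst esum_add) (auto simp: esum_cmult)
  also have "\<dots> \<le> ennreal s * 1 + ennreal t * 1"
    using assms(1,2) v unfolding clique_iff by (intro add_mono mult_left_mono) auto
  also have "\<dots> = ennreal (s + t)" using assms by simp
  also have "\<dots> \<le> 1" using assms(5) by (simp add: ennreal_le_1)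
  finally show "esum (web X) (\<lambda>a. (s * x a + t * y a) * v a) \<le> 1" .
next
  show "(\<lambda>a. s * x a + t * y a) \<in> nnvecs (web X)"
    using assms(3,4) clique_nnvecs[OF assms(1)] clique_nnvecs[OF assms(2)] by (auto simp: nnvecs_def)
qed

lemma clique_tendsto:
  assumes x: "\<And>n. x n \<in> cliques X" and inc: "\<And>n a. x n a \<le> x (Suc n) a"
    and lim: "\<And>a. (\<lambda>n. x n a) \<longlonglongrightarrow> y a"
  shows "y \<in> cliques X"
  unfolding clique_iff
proof (intro conjI ballI)
  show "y \<in> nnvecs (web X)"
    unfolding nnvecs_def
  proof (intro CollectI conjI ballI allI impI)
    fix a show "0 \<le> y a" using lim[of a] clique_nonneg[OF x] by (intro LIMSEQ_le_const) auto
  next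
    fix a assume "a \<notin> web X"
    then have "(\<lambda>n. x n a) = (\<lambda>n. 0)" using clique_outside[OF x] by auto
    then show "y a = 0" using lim[of a] by (simp add: LIMSEQ_const_iff)
  qed
next
  fix v assume v: "v \<in> pdual (web X) (cliques X)"
  then have v0: "0 \<le> v a" if "a \<in> web X" for a
    using pdual_subset[of "web X" "cliques X"] that by (auto simp: nnvecs_def)
  have "esum (web X) (\<lambda>a. y a * v a) = (SUP n. esum (web X) (\<lambda>a. x n a * v a))"
    using clique_nonneg[OF x] v0 inc lim
    by (intro esum_monotone_tendsto(2)) (auto intro!: mult_right_mono tendsto_mult)
  also have "\<dots> \<le> 1" using x v unfolding clique_iff by (intro SUP_least) auto
  finally show "esum (web X) (\<lambda>a. y a * v a) \<le> 1" .
qed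

lemma clique_zero: "(\<lambda>a. 0) \<in> cliques X"
  unfolding clique_iff by (simp add: nnvecs_def)

lemma clique_scale:
  assumes "x \<in> cliques X" "0 \<le> s" "s \<le> 1"
  shows "(\<lambda>a. s * x a) \<in> cliques X"
  using clique_convex[OF assms(1) clique_zero, of s 0] assms by simp

section \<open>The cone of a PCS: norm, order, completeness and measurable paths\<close>

lemma Fm_elem_iff: "x \<in> elems (Fm X) \<longleftrightarrow> (\<exists>c>0. (\<lambda>a. x a / c) \<in> cliques X)"
proof
  assume "x \<in> elems (Fm X)"
  then obtain \<alpha> y where y: "0 \<le> \<alpha>" "y \<in> cliques X" "x = (\<lambda>a. \<alpha> * y a)" by (auto simp: Fm_def)
  \<comment> \<open>For \<open>\<alpha> = 0\<close> the vector is zero and \<open>c = 1\<close>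
    serves; the form with a positive divisor spares later proofs this case.\<close>
  then show "\<exists>c>0. (\<lambda>a. x a / c) \<in> cliques X"
    by (cases "\<alpha> = 0") (auto intro: exI[of _ 1] exI[of _ \<alpha>] simp: clique_zero)
next
  assume "\<exists>c>0. (\<lambda>a. x a / c) \<in> cliques X"
  then obtain c where c: "c > 0" "(\<lambda>a. x a / c) \<in> cliques X" by blast
  show "x \<in> elems (Fm X)"
    unfolding Fm_def using c by (auto intro!: exI[of _ c] exI[of _ "\<lambda>a. x a / c"])
qed

lemma clique_elem: "x \<in> cliques X \<Longrightarrow> x \<in> elems (Fm X)"
  unfolding Fm_elem_iff by (intro exI[of _ 1]) simp

lemma Fm_elem_nonneg: "x \<in> elems (Fm X) \<Longrightarrow> 0 \<le> x a"
  unfolding Fm_elem_iff by (auto simp: zero_le_divide_iff dest!: clique_nonneg[of _ a])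

lemma Fm_elem_outside: "x \<in> elems (Fm X) \<Longrightarrow> a \<notin> web X \<Longrightarrow> x a = 0"
  unfolding Fm_elem_iff by (auto dest!: clique_outside[of _ a])

lemma Fm_elem_nnvecs: "x \<in> elems (Fm X) \<Longrightarrow> x \<in> nnvecs (web X)"
  by (auto simp: nnvecs_def intro: Fm_elem_nonneg Fm_elem_outside)

lemma clique_div_mono:
  assumes "(\<lambda>a. x a / c) \<in> cliques X" "0 < c" "c \<le> d"
  shows "(\<lambda>a. x a / d) \<in> cliques X"
proof -
  have "(\<lambda>a. c / d * (x a / c)) \<in> cliques X" using assms by (intro clique_scale) auto
  then show ?thesis using assms by simp
qed

text \<open>The delicate point is that the condition holds at \<open>c\<close> itself and not just
  at all \<open>d > c\<close>; this is closure of the cliques under increasing limits. Later norm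
  computations are reduced to cliques by this equivalence.\<close>

lemma Fm_norm_le_iff:
  assumes x: "x \<in> elems (Fm X)" and c: "0 < c"
  shows "cnorm (Fm X) x \<le> c \<longleftrightarrow> (\<lambda>a. x a / c) \<in> cliques X"
proof -
  let ?S = "{1 / r | r. 0 < r \<and> (\<lambda>a. r * x a) \<in> cliques X}"
  have bdd: "bdd_below ?S" by (auto intro!: bdd_belowI[of _ 0])
  have ne: "?S \<noteq> {}"
  proof -
    obtain d where d: "d > 0" "(\<lambda>a. x a / d) \<in> cliques X" using x Fm_elem_iff by blast
    then have "1 / (1 / d) \<in> ?S" by (intro CollectI exI[of _ "1/d"]) simp
    then show ?thesis by blast
  qed
  have n: "cnorm (Fm X) x = Inf ?S" by (simp add: Fm_def)
  show ?thesis
  proof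
    assume "(\<lambda>a. x a / c) \<in> cliques X"
    then have "1 / (1 / c) \<in> ?S" using c by (intro CollectI exI[of _ "1/c"]) simp
    from cInf_lower[OF this bdd] show "cnorm (Fm X) x \<le> c" unfolding n by simp
  next
    assume le: "cnorm (Fm X) x \<le> c"
    have *: "(\<lambda>a. x a / d) \<in> cliques X" if "d > c" for d
    proof -
      have "Inf ?S < d" using le n that by simp
      then obtain r where r: "0 < r" "(\<lambda>a. r * x a) \<in> cliques X" "1 / r < d"
        using ne bdd by (auto simp: cInf_less_iff)
      then show ?thesis using clique_div_mono[of x "1/r" d] by (simp add: mult.commute)
    qed
    \<comment> \<open>For divisors decreasing to \<open>c\<close> the quotients form an increasing
      sequence of cliques with limit \<open>x / c\<close>.\<close>
    show "(\<lambda>a. x a / c) \<in> cliques X"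
    proof (rule clique_tendsto[of "\<lambda>n a. x a / (c + 1 / real (Suc n))"])
      show "(\<lambda>a. x a / (c + 1 / real (Suc n))) \<in> cliques X" for n by (rule *) simp
      show "x a / (c + 1 / real (Suc n)) \<le> x a / (c + 1 / real (Suc (Suc n)))" for n a
        using Fm_elem_nonneg[OF x, of a] c by (intro divide_left_mono add_left_mono mult_pos_pos add_pos_pos) (auto simp: field_simps)
      show "(\<lambda>n. x a / (c + 1 / real (Suc n))) \<longlonglongrightarrow> x a / c" for a
      proof -
        have "(\<lambda>n. x a / (c + 1 / real (Suc n))) \<longlonglongrightarrow> x a / (c + 0)"
          using c LIMSEQ_inverse_real_of_nat by (intro tendsto_intros) (auto simp: inverse_eq_divide)
        then show ?thesis by simp
      qed
    qed
  qed
qed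

lemma unit_ball_Fm: "unit_ball (Fm X) = cliques X"
proof (rule Set.set_eqI)
  show "x \<in> unit_ball (Fm X) \<longleftrightarrow> x \<in> cliques X" for x
    using Fm_norm_le_iff[of x 1] clique_elem[of x] by (auto simp: unit_ball_def)
qed

lemma Fm_norm_nonneg:
  assumes "x \<in> elems (Fm X)"
  shows "0 \<le> cnorm (Fm X) x"
proof -
  obtain d where d: "d > 0" "(\<lambda>a. x a / d) \<in> cliques X" using assms Fm_elem_iff by blast
  then have "1 / (1 / d) \<in> {1 / r | r. 0 < r \<and> (\<lambda>a. r * x a) \<in> cliques X}"
    by (intro CollectI exI[of _ "1/d"]) simp
  then show ?thesis unfolding Fm_def by (auto intro!: cInf_greatest simp del: div_by_1)
qed

lemma Fm_elem_down:
  assumes "x \<in> elems (Fm X)" "y \<in> nnvecs (web X)" "\<And>a. a \<in> web X \<Longrightarrow> y a \<le> x a"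
  shows "y \<in> elems (Fm X)" "cnorm (Fm X) y \<le> cnorm (Fm X) x"
proof -
  have *: "(\<lambda>a. y a / c) \<in> cliques X" if "(\<lambda>a. x a / c) \<in> cliques X" "c > 0" for c
    using that assms(2,3) by (intro clique_down[OF that(1)]) (auto simp: nnvecs_def divide_right_mono)
  show y: "y \<in> elems (Fm X)" using assms(1) * unfolding Fm_elem_iff by blast
  show "cnorm (Fm X) y \<le> cnorm (Fm X) x"
  proof (rule field_le_epsilon)
    fix e :: real assume "e > 0"
    moreover from this have "cnorm (Fm X) x + e > 0" using Fm_norm_nonneg[OF assms(1)] by simp
    ultimately show "cnorm (Fm X) y \<le> cnorm (Fm X) x + e"
      using * Fm_norm_le_iff[OF y] Fm_norm_le_iff[OF assms(1)] by (metis less_add_same_cancel1 less_imp_le)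
  qed
qed

lemma Fm_add:
  assumes x: "x \<in> elems (Fm X)" and y: "y \<in> elems (Fm X)"
  shows "(\<lambda>a. x a + y a) \<in> elems (Fm X)"
    and "cnorm (Fm X) (\<lambda>a. x a + y a) \<le> cnorm (Fm X) x + cnorm (Fm X) y"
proof -
  have *: "(\<lambda>a. (x a + y a) / (c + d)) \<in> cliques X"
    if "(\<lambda>a. x a / c) \<in> cliques X" "(\<lambda>a. y a / d) \<in> cliques X" "c > 0" "d > 0" for c d
  proof -
    have "(\<lambda>a. c / (c + d) * (x a / c) + d / (c + d) * (y a / d)) \<in> cliques X"
      using that by (intro clique_convex) (auto simp: field_simps)
    then show ?thesis using that by (simp add: add_divide_distrib)
  qed
  show xy: "(\<lambda>a. x a + y a) \<in> elems (Fm X)"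
  proof -
    obtain c d where "c > 0" "(\<lambda>a. x a / c) \<in> cliques X" "d > 0" "(\<lambda>a. y a / d) \<in> cliques X"
      using assms unfolding Fm_elem_iff by blast
    then show ?thesis unfolding Fm_elem_iff using * by (intro exI[of _ "c + d"]) auto
  qed
  show "cnorm (Fm X) (\<lambda>a. x a + y a) \<le> cnorm (Fm X) x + cnorm (Fm X) y"
  proof (rule field_le_epsilon)
    fix e :: real assume e: "e > 0"
    have p: "cnorm (Fm X) x + e/2 > 0" "cnorm (Fm X) y + e/2 > 0"
      using e Fm_norm_nonneg[OF x] Fm_norm_nonneg[OF y] by simp_all
    have "(\<lambda>a. (x a + y a) / ((cnorm (Fm X) x + e/2) + (cnorm (Fm X) y + e/2))) \<in> cliques X"
      using p e Fm_norm_le_iff[OF x p(1)] Fm_norm_le_iff[OF y p(2)] by (intro *) auto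
    moreover have "0 < (cnorm (Fm X) x + e/2) + (cnorm (Fm X) y + e/2)" using p by simp
    ultimately have "cnorm (Fm X) (\<lambda>a. x a + y a) \<le> (cnorm (Fm X) x + e/2) + (cnorm (Fm X) y + e/2)"
      using Fm_norm_le_iff[OF xy] by blast
    then show "cnorm (Fm X) (\<lambda>a. x a + y a) \<le> cnorm (Fm X) x + cnorm (Fm X) y + e" by simp
  qed
qed

lemma Fm_zero: "(\<lambda>a. 0) \<in> elems (Fm X)" "cnorm (Fm X) (\<lambda>a. 0) = 0"
proof -
  show *: "(\<lambda>a. 0) \<in> elems (Fm X)" using clique_zero clique_elem by blast
  have "cnorm (Fm X) (\<lambda>a. 0) \<le> 0 + e" if "e > 0" for e
    using Fm_norm_le_iff[OF * that] clique_zero that by simp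
  then show "cnorm (Fm X) (\<lambda>a. 0) = 0" using Fm_norm_nonneg[OF *] by (metis antisym field_le_epsilon)
qed

lemma Fm_scale:
  assumes x: "x \<in> elems (Fm X)" and "0 \<le> s"
  shows "(\<lambda>a. s * x a) \<in> elems (Fm X)" and "cnorm (Fm X) (\<lambda>a. s * x a) = s * cnorm (Fm X) x"
proof -
  have *: "(\<lambda>a. s * x a) \<in> elems (Fm X) \<and> cnorm (Fm X) (\<lambda>a. s * x a) = s * cnorm (Fm X) x" if s: "s > 0" for s
  proof -
    have eq: "(\<lambda>a. s * x a / (s * c)) = (\<lambda>a. x a / c)" for c using s by auto
    have sx: "(\<lambda>a. s * x a) \<in> elems (Fm X)"
    proof -
      obtain c where "c > 0" "(\<lambda>a. x a / c) \<in> cliques X" using x unfolding Fm_elem_iff by blast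
      then show ?thesis unfolding Fm_elem_iff using s by (intro exI[of _ "s * c"]) auto
    qed
    have iff: "cnorm (Fm X) (\<lambda>a. s * x a) \<le> s * c \<longleftrightarrow> cnorm (Fm X) x \<le> c" if "c > 0" for c
      using Fm_norm_le_iff[OF sx, of "s * c"] Fm_norm_le_iff[OF x, of c] s that by simp
    have "cnorm (Fm X) (\<lambda>a. s * x a) \<le> s * cnorm (Fm X) x + e" if "e > 0" for e
      using iff[of "cnorm (Fm X) x + e / s"] that s Fm_norm_nonneg[OF x]
      by (simp add: distrib_left add_nonneg_pos)
    moreover have "cnorm (Fm X) x \<le> cnorm (Fm X) (\<lambda>a. s * x a) / s + e" if "e > 0" for e
      using iff[of "cnorm (Fm X) (\<lambda>a. s * x a) / s + e"] that s Fm_norm_nonneg[OF sx]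
      by (simp add: distrib_left add_nonneg_pos)
    ultimately have "cnorm (Fm X) (\<lambda>a. s * x a) \<le> s * cnorm (Fm X) x"
      "cnorm (Fm X) x \<le> cnorm (Fm X) (\<lambda>a. s * x a) / s"
      by (meson field_le_epsilon)+
    then show ?thesis using sx s by (simp add: field_simps)
  qed
  show "(\<lambda>a. s * x a) \<in> elems (Fm X)" and "cnorm (Fm X) (\<lambda>a. s * x a) = s * cnorm (Fm X) x"
    using *[of s] assms(2) Fm_zero by (cases "s = 0"; simp)+
qed

text \<open>If the norm is 0, all positive multiples of \<open>x\<close> are cliques, and the axiom
  bounding each coordinate over the cliques forces that coordinate to vanish.\<close>

lemma Fm_norm_eq_0:
  assumes x: "x \<in> elems (Fm X)" and "cnorm (Fm X) x = 0"
  shows "x = (\<lambda>a. 0)"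
proof
  fix a
  show "x a = 0"
  proof (cases "a \<in> web X")
    case True
    then obtain B where B: "\<And>u. u \<in> cliques X \<Longrightarrow> u a \<le> B" using clique_bound by blast
    have le: "x a \<le> B * e" if "e > 0" for e
      using B[of "\<lambda>a. x a / e"] Fm_norm_le_iff[OF x that] that assms(2) by (simp add: field_simps)
    have "x a \<le> 0"
    proof (rule ccontr)
      assume "\<not> x a \<le> 0"
      then have p: "x a > 0" by simp
      then have "B > 0" using le[of 1] by simp
      then show False using le[of "x a / (2 * B)"] p by simp
    qed
    then show ?thesis using Fm_elem_nonneg[OF x, of a] by simp
  qed (use x Fm_elem_outside in blast)
qed

lemma Fm_simps:
  "czero (Fm X) = (\<lambda>a. 0)" "cadd (Fm X) x y = (\<lambda>a. x a + y a)" "cscale (Fm X) s x = (\<lambda>a. s * x a)"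
  "tests (Fm X) n = {\<lambda>r x. 0} \<union> {\<lambda>r x. x a | a. a \<in> web X}"
  by (simp_all add: Fm_def)

lemma comm_monoid_Fm: "comm_monoid (cone_monoid (Fm X))"
  by (rule comm_monoidI) (auto simp: cone_monoid_def Fm_simps Fm_add(1) Fm_zero(1) add_ac)

lemma is_cone_Fm: "is_cone (Fm X)"
  unfolding is_cone_def Fm_simps
proof (intro conjI allI ballI impI)
  fix x y z assume "(\<lambda>a. x a + y a) = (\<lambda>a. x a + (z a::real))"
  then show "y = z" by (auto simp: fun_eq_iff)
next
  fix x y assume "x \<in> elems (Fm X)" and y: "y \<in> elems (Fm X)"
  then show "cnorm (Fm X) x \<le> cnorm (Fm X) (\<lambda>a. x a + y a)"
    using Fm_elem_nonneg[OF y] by (intro Fm_elem_down(2)) (auto simp: Fm_add(1) Fm_elem_nnvecs)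
qed (use comm_monoid_Fm in \<open>auto simp: Fm_scale Fm_add Fm_norm_nonneg Fm_norm_eq_0 algebra_simps\<close>)

lemma csum_Fm:
  assumes "finite J" "\<And>j. j \<in> J \<Longrightarrow> u j \<in> elems (Fm X)"
  shows "csum (Fm X) u J = (\<lambda>a. \<Sum>j\<in>J. u j a)" "(\<lambda>a. \<Sum>j\<in>J. u j a) \<in> elems (Fm X)"
proof -
  interpret comm_monoid "cone_monoid (Fm X)" by (rule comm_monoid_Fm)
  have "csum (Fm X) u J = (\<lambda>a. \<Sum>j\<in>J. u j a) \<and> (\<lambda>a. \<Sum>j\<in>J. u j a) \<in> elems (Fm X)"
    using assms
  proof (induction J)
    case empty
    have "finprod (cone_monoid (Fm X)) u {} = \<one>\<^bsub>cone_monoid (Fm X)\<^esub>" by (rule finprod_empty)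
    then show ?case by (simp add: csum_def Fm_zero) (simp add: cone_monoid_def Fm_simps)
  next
    case (insert j J)
    have "finprod (cone_monoid (Fm X)) u (insert j J) =
        u j \<otimes>\<^bsub>cone_monoid (Fm X)\<^esub> finprod (cone_monoid (Fm X)) u J"
      using insert by (intro finprod_insert) (auto simp: cone_monoid_def)
    then show ?case using insert by (simp add: csum_def cone_monoid_def Fm_simps Fm_add(1))
  qed
  then show "csum (Fm X) u J = (\<lambda>a. \<Sum>j\<in>J. u j a)" "(\<lambda>a. \<Sum>j\<in>J. u j a) \<in> elems (Fm X)" by auto
qed

text \<open>For the converse, the difference \<open>y - x\<close> is dominated by \<open>y\<close>,
  so it lies in the cone by downward closure.\<close>

lemma cle_Fm_iff:
  assumes "x \<in> elems (Fm X)" "y \<in> elems (Fm X)"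
  shows "cle (Fm X) x y \<longleftrightarrow> (\<forall>a. x a \<le> y a)"
proof
  assume "cle (Fm X) x y"
  then show "\<forall>a. x a \<le> y a" by (auto simp: cle_def Fm_simps dest: Fm_elem_nonneg)
next
  assume le: "\<forall>a. x a \<le> y a"
  have "(\<lambda>a. y a - x a) \<in> elems (Fm X)"
    using le Fm_elem_nonneg[OF assms(1)] Fm_elem_outside[OF assms(1)] Fm_elem_outside[OF assms(2)]
    by (intro Fm_elem_down(1)[OF assms(2)]) (auto simp: nnvecs_def)
  then show "cle (Fm X) x y" unfolding cle_def by (rule bexI[rotated]) (simp add: Fm_simps)
qed

lemma nondecreasing_Fm_iff:
  "nondecreasing (Fm X) x \<longleftrightarrow> (\<forall>n. x n \<in> elems (Fm X)) \<and> (\<forall>n a. x n a \<le> x (Suc n) a)"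
  by (auto simp: nondecreasing_def cle_Fm_iff)

text \<open>A bound \<open>s\<close> in the cone dominates the pointwise supremum, which is then
  itself in the cone by downward closure; leastness makes the two coincide.\<close>

lemma is_seq_lub_Fm_iff:
  assumes "nondecreasing (Fm X) x"
  shows "is_seq_lub (Fm X) x s \<longleftrightarrow> s \<in> elems (Fm X) \<and> (\<forall>a. (\<lambda>n. x n a) \<longlonglongrightarrow> s a)"
proof -
  have el: "\<And>n. x n \<in> elems (Fm X)" and inc: "\<And>a. incseq (\<lambda>n. x n a)"
    using assms by (auto simp: nondecreasing_Fm_iff intro!: incseq_SucI)
  show ?thesis
  proof
    assume l: "is_seq_lub (Fm X) x s"
    then have s: "s \<in> elems (Fm X)" by (simp add: is_seq_lub_def)
    have le: "x n a \<le> s a" for n a using l s el by (auto simp: is_seq_lub_def cle_Fm_iff)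
    define t where "t a = (SUP n. x n a)" for a
    have bdd: "bdd_above (range (\<lambda>n. x n a))" for a using le by (auto intro: bdd_aboveI[of _ "s a"])
    have lim: "(\<lambda>n. x n a) \<longlonglongrightarrow> t a" for a
      unfolding t_def using inc bdd by (intro LIMSEQ_incseq_SUP)
    have xt: "x n a \<le> t a" for n a unfolding t_def using bdd by (intro cSUP_upper) auto
    have ts: "t a \<le> s a" for a unfolding t_def using le by (intro cSUP_least) auto
    have "t a = 0" if "a \<notin> web X" for a using that Fm_elem_outside[OF el] by (simp add: t_def)
    moreover have "0 \<le> t a" for a using xt[of 0 a] Fm_elem_nonneg[OF el, of 0 a] by linarith
    ultimately have t: "t \<in> elems (Fm X)" using ts s by (intro Fm_elem_down(1)[OF s]) (auto simp: nnvecs_def)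
    then have "cle (Fm X) s t" using l xt el by (auto simp: is_seq_lub_def cle_Fm_iff)
    then have "s a = t a" for a using ts s t by (simp add: cle_Fm_iff antisym)
    then show "s \<in> elems (Fm X) \<and> (\<forall>a. (\<lambda>n. x n a) \<longlonglongrightarrow> s a)" using s lim by auto
  next
    assume r: "s \<in> elems (Fm X) \<and> (\<forall>a. (\<lambda>n. x n a) \<longlonglongrightarrow> s a)"
    then have "x n a \<le> s a" for n a using inc[of a] by (auto intro: incseq_le)
    moreover have "s a \<le> t a" if "\<forall>n. x n a \<le> t a" for t a using r that by (auto intro: LIMSEQ_le_const2)
    ultimately show "is_seq_lub (Fm X) x s" using r el by (auto simp: is_seq_lub_def cle_Fm_iff)
  qed
qed

lemma seq_complete_Fm: "seq_complete (Fm X)"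
  unfolding seq_complete_def unit_ball_Fm
proof (intro allI impI, elim conjE)
  fix x assume nd: "nondecreasing (Fm X) x" and r: "range x \<subseteq> cliques X"
  have inc: "incseq (\<lambda>n. x n a)" for a
    using nd by (auto simp: nondecreasing_Fm_iff intro!: incseq_SucI)
  have bdd: "bdd_above (range (\<lambda>n. x n a))" for a
  proof (cases "a \<in> web X")
    case True
    then obtain B where "\<And>u. u \<in> cliques X \<Longrightarrow> u a \<le> B" using clique_bound by blast
    then show ?thesis using r by (intro bdd_aboveI[of _ B]) blast
  next
    case False
    then have "x n a = 0" for n using r by (intro clique_outside) auto
    then show ?thesis by simp
  qed
  define t where "t a = (SUP n. x n a)" for a
  have lim: "(\<lambda>n. x n a) \<longlonglongrightarrow> t a" for a
    unfolding t_def using inc bdd by (intro LIMSEQ_incseq_SUP)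
  have "t \<in> cliques X"
  proof (rule clique_tendsto[of x])
    show "x n \<in> cliques X" for n using r by blast
    show "x n a \<le> x (Suc n) a" for n a using inc by (rule incseq_SucD)
  qed (rule lim)
  then show "\<exists>s\<in>cliques X. is_seq_lub (Fm X) x s"
    using lim by (intro bexI[of _ t]) (simp_all add: is_seq_lub_Fm_iff[OF nd] clique_elem)
qed

lemma linear_scott_coordinate: "linear_scott (Fm X) (\<lambda>x. x a)"
  unfolding linear_scott_def Fm_simps
proof (intro conjI ballI allI impI; (elim conjE)?)
  fix x s assume nd: "nondecreasing (Fm X) x" and l: "is_seq_lub (Fm X) x s"
  have inc: "incseq (\<lambda>n. x n a)"
    using nd by (auto simp: nondecreasing_Fm_iff intro!: incseq_SucI)
  have lim: "(\<lambda>n. x n a) \<longlonglongrightarrow> s a" using l is_seq_lub_Fm_iff[OF nd] by blast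
  show b: "bdd_above (range (\<lambda>n. x n a))" using lim inc by (auto intro!: bdd_aboveI[of _ "s a"] incseq_le)
  show "s a = (SUP n. x n a)" using LIMSEQ_incseq_SUP[OF b inc] lim LIMSEQ_unique by blast
qed (auto simp: Fm_elem_nonneg)

lemma linear_scott_zero: "linear_scott (Fm X) (\<lambda>x. 0)"
  by (auto simp: linear_scott_def)

lemma measurable_cone_Fm: "measurable_cone (Fm X)"
  unfolding measurable_cone_def
  by (auto simp: Fm_simps is_cone_Fm seq_complete_Fm linear_scott_coordinate linear_scott_zero)

text \<open>The tests of \<open>Fm X\<close> ignore their real parameters, so joint measurability in
  \<open>(r, s)\<close> comes down to measurability of each coordinate of the path.\<close>

lemma meas_path_Fm_iff:
  "meas_path (Fm X) n \<gamma> \<longleftrightarrow> (\<forall>s\<in>space (Rn n). \<gamma> s \<in> elems (Fm X)) \<and>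
     (\<exists>B. \<forall>s\<in>space (Rn n). cnorm (Fm X) (\<gamma> s) \<le> B) \<and>
     (\<forall>a. (\<lambda>s. \<gamma> s a) \<in> borel_measurable (Rn n))" (is "?L \<longleftrightarrow> ?R")
proof
  assume L: ?L
  have "(\<lambda>s. \<gamma> s a) \<in> borel_measurable (Rn n)" for a
  proof (cases "a \<in> web X")
    case True
    then have "(\<lambda>r x. x a) \<in> tests (Fm X) 0" by (auto simp: Fm_simps)
    then have m: "(\<lambda>(r, s). (\<lambda>r x. x a) r (\<gamma> s)) \<in> borel_measurable (Rn 0 \<Otimes>\<^sub>M Rn n)"
      using L unfolding meas_path_def by fast
    \<comment> \<open>\<open>Rn 0\<close> has exactly one point, the function that is
      \<open>undefined\<close> everywhere; pairing with it leaves a statement about \<open>s\<close>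
      alone.\<close>
    have "(\<lambda>s. (\<lambda>_. undefined, s)) \<in> measurable (Rn n) (Rn 0 \<Otimes>\<^sub>M Rn n)"
      by (intro measurable_Pair measurable_ident_sets measurable_const) (auto simp: space_PiM)
    from measurable_compose[OF this m] show ?thesis by simp
  next
    case False
    then have "(\<lambda>s. \<gamma> s a) \<in> borel_measurable (Rn n) \<longleftrightarrow> (\<lambda>s. 0::real) \<in> borel_measurable (Rn n)"
      using L by (intro measurable_cong) (auto simp: meas_path_def Fm_elem_outside)
    then show ?thesis by simp
  qed
  then show ?R using L by (auto simp: meas_path_def)
next
  assume R: ?R
  then have "(\<lambda>p. \<gamma> (snd p) a) \<in> borel_measurable (Rn k \<Otimes>\<^sub>M Rn n)" for k a
    by (intro measurable_compose[OF measurable_snd]) auto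
  then show ?L using R by (auto simp: meas_path_def Fm_simps case_prod_beta)
qed

lemma unitary_path_Fm_iff:
  "unitary_path (Fm X) n \<gamma> \<longleftrightarrow> (\<forall>s\<in>space (Rn n). \<gamma> s \<in> cliques X) \<and>
     (\<forall>a. (\<lambda>s. \<gamma> s a) \<in> borel_measurable (Rn n))"
  by (auto simp: unitary_path_def meas_path_Fm_iff unit_ball_Fm[symmetric] unit_ball_def)

end

section \<open>Sums depending on a parameter, and strictly positive vectors\<close>

lemma borel_measurable_esum:
  assumes "countable A" "\<And>a. a \<in> A \<Longrightarrow> (\<lambda>s. f s a) \<in> borel_measurable M"
  shows "(\<lambda>s. esum A (f s)) \<in> borel_measurable M"
proof -
  \<comment> \<open>Countability makes the counting measure sigma-finite, as the measurability of a
    parametrised integral requires.\<close>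
  interpret sigma_finite_measure "count_space A"
    using assms(1) by (rule sigma_finite_measure_count_space_countable)
  have "(\<lambda>(a, s). ennreal (f s a)) \<in> borel_measurable (count_space A \<Otimes>\<^sub>M M)"
    using assms by (intro measurable_pair_measure_countable1) auto
  then have "(\<lambda>(s, a). ennreal (f s a)) \<in> borel_measurable (M \<Otimes>\<^sub>M count_space A)"
    by (subst measurable_pair_swap_iff) (simp add: case_prod_beta)
  then show ?thesis by (rule borel_measurable_nn_integral)
qed

lemma has_sum_iff_esum:
  assumes "\<And>a. a \<in> A \<Longrightarrow> 0 \<le> f a" "0 \<le> c"
  shows "(f has_sum c) A \<longleftrightarrow> esum A f = ennreal c"
  using esum_eq_iff[of A f c] assms has_sum_infsum infsumI summable_on_def by (metis has_sum_imp_summable)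

lemma nnvecs_nonneg: "u \<in> nnvecs A \<Longrightarrow> 0 \<le> u a"
  by (cases "a \<in> A") (auto simp: nnvecs_def)

lemma mpow_clique_nonneg: "is_pcs X \<Longrightarrow> x \<in> cliques X \<Longrightarrow> 0 \<le> mpow x \<mu>"
  by (simp add: mpow_nonneg clique_nonneg)

lemma mpow_outside:
  assumes "is_pcs X" "x \<in> cliques X" "\<mu> \<notin> mfin (web X)"
  shows "mpow x \<mu> = 0"
proof -
  obtain a where a: "a \<in># \<mu>" "a \<notin> web X" using assms(3) by (auto simp: mfin_def)
  then have "x a = 0" using clique_outside[OF assms(1,2)] by blast
  then show ?thesis unfolding mpow_def using a by (intro prod_zero) (auto intro!: bexI[of _ a])
qed

text \<open>Half a clique plus half a clique on one basis vector is again a clique. Such a point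
  makes all monomials in the variables of \<open>F\<close> positive, so that coefficients can be
  isolated by division.\<close>

lemma clique_positive:
  assumes X: "is_pcs X" and "finite F" "F \<subseteq> web X"
  shows "\<exists>x\<in>cliques X. (\<forall>a\<in>F. 0 < x a) \<and> (\<forall>a. a \<notin> F \<longrightarrow> x a = 0)"
  using assms(2,3)
proof (induction F)
  case empty
  show ?case using clique_zero[OF X] by (intro bexI[of _ "\<lambda>a. 0"]) auto
next
  case (insert c F)
  then obtain x where x: "x \<in> cliques X" "\<forall>a\<in>F. 0 < x a" "\<forall>a. a \<notin> F \<longrightarrow> x a = 0" by auto
  have "c \<in> web X" using insert by simp
  then obtain d where d: "d > 0" "(\<lambda>b. if b = c then d else 0) \<in> cliques X" using X by (auto simp: is_pcs_def)
  have "(\<lambda>a. 1/2 * x a + 1/2 * (if a = c then d else 0)) \<in> cliques X"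
    using clique_convex[OF X x(1) d(2), of "1/2" "1/2"] by simp
  then show ?case using x d clique_nonneg[OF X x(1)] insert.hyps(2) by (intro bexI) (auto simp: add_nonneg_pos)
qed

text \<open>A small multiple of the basis vector at \<open>b\<close> lies in the dual because the
  coordinate \<open>b\<close> is bounded on the cliques.\<close>

lemma dual_clique_positive:
  assumes X: "is_pcs X" and b: "b \<in> web X"
  shows "\<exists>v\<in>pdual (web X) (cliques X). 0 < v b"
proof -
  obtain B where B: "\<And>u. u \<in> cliques X \<Longrightarrow> u b \<le> B" using clique_bound[OF X b] by blast
  \<comment> \<open>The bound \<open>B\<close> need not be positive; the maximum makes the division
    by \<open>c\<close> safe.\<close>
  define c where "c = max B 1"
  have c: "c > 0" "\<And>u. u \<in> cliques X \<Longrightarrow> u b \<le> c" using B by (auto simp: c_def intro: max.coboundedI1)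
  define v where "v = (\<lambda>a. if a = b then 1 / c else 0)"
  have "esum (web X) (\<lambda>a. v a * u a) \<le> 1" if u: "u \<in> cliques X" for u
  proof -
    have "esum (web X) (\<lambda>a. v a * u a) = (\<Sum>a\<in>{b}. ennreal (v a * u a))"
      using b by (intro nn_integral_count_space') (auto simp: v_def)
    also have "\<dots> \<le> 1" using c(1) c(2)[OF u] by (simp add: v_def ennreal_le_1)
    finally show ?thesis .
  qed
  moreover have "v \<in> nnvecs (web X)" using b c by (auto simp: v_def nnvecs_def)
  moreover have "cliques X \<subseteq> nnvecs (web X)" using clique_nnvecs[OF X] by blast
  ultimately have "v \<in> pdual (web X) (cliques X)" by (simp add: pdual_iff)
  then show ?thesis using c by (intro bexI[of _ v]) (auto simp: v_def)
qed

lemma dual_nonneg: "v \<in> pdual A S \<Longrightarrow> 0 \<le> v a"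
  by (cases "a \<in> A") (auto simp: pdual_def nnvecs_def)

lemma dual_outside: "v \<in> pdual A S \<Longrightarrow> a \<notin> A \<Longrightarrow> v a = 0"
  by (auto simp: pdual_def nnvecs_def)

lemma esum_hat_pairing:
  assumes "\<And>p. 0 \<le> f p" "\<And>\<mu>. 0 \<le> w \<mu>" "\<And>b. 0 \<le> (v b :: real)" and countable: "countable M" "countable B"
  shows "esum (M \<times> B) (\<lambda>p. f p * (case p of (\<mu>, b) \<Rightarrow> w \<mu> * v b))
       = (\<integral>\<^sup>+b. ennreal (v b) * esum M (\<lambda>\<mu>. f (\<mu>, b) * w \<mu>) \<partial>count_space B)"
proof -
  have "esum (M \<times> B) (\<lambda>p. f p * (case p of (\<mu>, b) \<Rightarrow> w \<mu> * v b))
      = (\<integral>\<^sup>+\<mu>. \<integral>\<^sup>+b. ennreal (f (\<mu>, b) * (w \<mu> * v b)) \<partial>count_space B \<partial>count_space M)"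
    by (simp add: nn_integral_count_space_Times)
  also have "\<dots> = (\<integral>\<^sup>+b. \<integral>\<^sup>+\<mu>. ennreal (f (\<mu>, b) * (w \<mu> * v b)) \<partial>count_space M \<partial>count_space B)"
    using countable by (intro nn_integral_count_space_nn_integral) auto
  also have "\<dots> = (\<integral>\<^sup>+b. ennreal (v b) * esum M (\<lambda>\<mu>. f (\<mu>, b) * w \<mu>) \<partial>count_space B)"
    using assms(1-3)
    by (intro nn_integral_cong, subst nn_integral_cmult[symmetric])
      (auto intro!: nn_integral_cong simp: mult_ac simp flip: ennreal_mult)
  finally show ?thesis .
qed

section \<open>The exponential of two PCSs as a dual set\<close>

context
  fixes X :: "'a pcs" and Y :: "'b pcs"
  assumes X: "is_pcs X" and Y: "is_pcs Y"
begin

definition hom_tests :: "('a multiset \<times> 'b \<Rightarrow> real) set" where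
  "hom_tests = {\<lambda>(\<mu>, b). mpow x \<mu> * v b | x v. x \<in> cliques X \<and> v \<in> pdual (web Y) (cliques Y)}"

lemma hom_tests_nnvecs: "hom_tests \<subseteq> nnvecs (mfin (web X) \<times> web Y)"
  by (auto simp: hom_tests_def nnvecs_def mpow_clique_nonneg[OF X] mpow_outside[OF X]
      intro!: mult_nonneg_nonneg dest: dual_nonneg dual_outside)

lemma countable_exp_web: "countable (mfin (web X) \<times> web Y)"
  using countable_mfin[OF countable_web[OF X]] countable_web[OF Y] by blast

text \<open>Testing a matrix against \<open>x\<^sup>! \<otimes> v\<close> amounts to testing \<open>hat X f x\<close> against \<open>v\<close>, so
  \<open>pcoh_hom X Y\<close> is itself a dual set.\<close>

lemma pcoh_hom_eq_pdual: "pcoh_hom X Y = pdual (mfin (web X) \<times> web Y) hom_tests"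
proof (intro equalityI subsetI)
  fix f assume f: "f \<in> pcoh_hom X Y"
  then have fn: "f \<in> nnvecs (mfin (web X) \<times> web Y)" by (simp add: pcoh_hom_def)
  note f0 = nnvecs_nonneg[OF fn]
  show "f \<in> pdual (mfin (web X) \<times> web Y) hom_tests"
    unfolding pdual_iff[OF hom_tests_nnvecs]
  proof (intro conjI ballI)
    fix t assume "t \<in> hom_tests"
    then obtain x v where x: "x \<in> cliques X" and v: "v \<in> pdual (web Y) (cliques Y)"
      and t: "t = (\<lambda>(\<mu>, b). mpow x \<mu> * v b)" unfolding hom_tests_def by blast
    have "esum (mfin (web X) \<times> web Y) (\<lambda>p. f p * t p)
       = (\<integral>\<^sup>+b. ennreal (v b) * esum (mfin (web X)) (\<lambda>\<mu>. f (\<mu>, b) * mpow x \<mu>) \<partial>count_space (web Y))"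
      unfolding t using f0 mpow_clique_nonneg[OF X x] dual_nonneg[OF v] countable_mfin[OF countable_web[OF X]] countable_web[OF Y]
      by (intro esum_hat_pairing) auto
    also have "\<dots> = esum (web Y) (\<lambda>b. hat X f x b * v b)"
    proof (intro nn_integral_cong)
      fix b assume "b \<in> space (count_space (web Y))"
      then have "(\<lambda>\<mu>. f (\<mu>, b) * mpow x \<mu>) summable_on mfin (web X)"
        using f x by (auto simp: pcoh_hom_def)
      then have "esum (mfin (web X)) (\<lambda>\<mu>. f (\<mu>, b) * mpow x \<mu>) = ennreal (hat X f x b)"
        unfolding hat_def using f0 mpow_clique_nonneg[OF X x] by (intro esum_eq_infsum) auto
      then show "ennreal (v b) * esum (mfin (web X)) (\<lambda>\<mu>. f (\<mu>, b) * mpow x \<mu>) = ennreal (hat X f x b * v b)"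
        using dual_nonneg[OF v, of b] by (simp add: ennreal_mult' mult.commute)
    qed
    also have "\<dots> \<le> 1"
      using f x v unfolding pcoh_hom_def clique_iff[OF Y] by blast
    finally show "esum (mfin (web X) \<times> web Y) (\<lambda>p. f p * t p) \<le> 1" .
  qed (use f in \<open>simp add: pcoh_hom_def\<close>)
next
  fix f assume "f \<in> pdual (mfin (web X) \<times> web Y) hom_tests"
  then have fn: "f \<in> nnvecs (mfin (web X) \<times> web Y)"
    and ft: "\<And>t. t \<in> hom_tests \<Longrightarrow> esum (mfin (web X) \<times> web Y) (\<lambda>p. f p * t p) \<le> 1"
    unfolding pdual_iff[OF hom_tests_nnvecs] by auto
  note f0 = nnvecs_nonneg[OF fn]
  have pair: "(\<integral>\<^sup>+b. ennreal (v b) * esum (mfin (web X)) (\<lambda>\<mu>. f (\<mu>, b) * mpow x \<mu>) \<partial>count_space (web Y)) \<le> 1"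
    if x: "x \<in> cliques X" and v: "v \<in> pdual (web Y) (cliques Y)" for x v
  proof -
    have "(\<integral>\<^sup>+b. ennreal (v b) * esum (mfin (web X)) (\<lambda>\<mu>. f (\<mu>, b) * mpow x \<mu>) \<partial>count_space (web Y))
       = esum (mfin (web X) \<times> web Y) (\<lambda>p. f p * (case p of (\<mu>, b) \<Rightarrow> mpow x \<mu> * v b))"
      using f0 mpow_clique_nonneg[OF X x] dual_nonneg[OF v] countable_mfin[OF countable_web[OF X]] countable_web[OF Y]
      by (intro esum_hat_pairing[symmetric]) auto
    also have "\<dots> \<le> 1" using x v by (intro ft) (unfold hom_tests_def, blast)
    finally show ?thesis .
  qed
  show "f \<in> pcoh_hom X Y"
    unfolding pcoh_hom_def
  proof (intro CollectI conjI ballI)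
    fix x assume x: "x \<in> cliques X"
    have m0: "0 \<le> f (\<mu>, b) * mpow x \<mu>" for \<mu> b using f0 mpow_clique_nonneg[OF X x] by simp
    show sm: "(\<lambda>\<mu>. f (\<mu>, b) * mpow x \<mu>) summable_on mfin (web X)" if b: "b \<in> web Y" for b
    proof -
      obtain v where v: "v \<in> pdual (web Y) (cliques Y)" "0 < v b"
        using dual_clique_positive[OF Y b] by blast
      \<comment> \<open>The pairing dominates its single term at \<open>b\<close>, and
        \<open>v b > 0\<close>, so the series in the coordinate \<open>b\<close> is finite.\<close>
      have "ennreal (v b) * esum (mfin (web X)) (\<lambda>\<mu>. f (\<mu>, b) * mpow x \<mu>)
        = (\<integral>\<^sup>+c. ennreal (v c) * esum (mfin (web X)) (\<lambda>\<mu>. f (\<mu>, c) * mpow x \<mu>) * indicator {b} c \<partial>count_space (web Y))"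
        using b by (subst nn_integral_count_space'[of "{b}"]) auto
      also have "\<dots> \<le> (\<integral>\<^sup>+c. ennreal (v c) * esum (mfin (web X)) (\<lambda>\<mu>. f (\<mu>, c) * mpow x \<mu>) \<partial>count_space (web Y))"
        by (intro nn_integral_mono) (auto split: split_indicator)
      also have "\<dots> \<le> 1" by (rule pair[OF x v(1)])
      finally have "esum (mfin (web X)) (\<lambda>\<mu>. f (\<mu>, b) * mpow x \<mu>) \<noteq> \<infinity>"
        using v(2) by (auto simp: ennreal_mult_top top_unique)
      then show ?thesis using m0 by (subst summable_on_iff_esum) (auto simp: top.not_eq_extremum)
    qed
    have h0: "0 \<le> hat X f x b" for b unfolding hat_def using m0 by (intro infsum_nonneg) auto
    show "hat X f x \<in> cliques Y"
      unfolding clique_iff[OF Y]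
    proof (intro conjI ballI)
      have "hat X f x b = 0" if "b \<notin> web Y" for b
      proof -
        have "f (\<mu>, b) = 0" for \<mu> using fn that by (auto simp: nnvecs_def)
        then show ?thesis by (simp add: hat_def)
      qed
      then show "hat X f x \<in> nnvecs (web Y)" using h0 by (auto simp: nnvecs_def)
    next
      fix v assume v: "v \<in> pdual (web Y) (cliques Y)"
      have "esum (web Y) (\<lambda>b. hat X f x b * v b) =
        (\<integral>\<^sup>+b. ennreal (v b) * esum (mfin (web X)) (\<lambda>\<mu>. f (\<mu>, b) * mpow x \<mu>) \<partial>count_space (web Y))"
      proof (intro nn_integral_cong)
        fix b assume "b \<in> space (count_space (web Y))"
        then have "esum (mfin (web X)) (\<lambda>\<mu>. f (\<mu>, b) * mpow x \<mu>) = ennreal (hat X f x b)"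
          unfolding hat_def using m0 sm by (intro esum_eq_infsum) auto
        then show "ennreal (hat X f x b * v b) = ennreal (v b) * esum (mfin (web X)) (\<lambda>\<mu>. f (\<mu>, b) * mpow x \<mu>)"
          using dual_nonneg[OF v, of b] by (simp add: ennreal_mult' mult.commute)
      qed
      also have "\<dots> \<le> 1" by (rule pair[OF x v])
      finally show "esum (web Y) (\<lambda>b. hat X f x b * v b) \<le> 1" .
    qed
  qed (rule fn)
qed

text \<open>Biduality holds for any dual set. For the coordinate axioms, a scaled basis vector is
  bounded against every test, and a coordinate is bounded by means of one test that is positive
  there.\<close>

lemma is_pcs_exp: "is_pcs (pcs_exp X Y)"
  unfolding is_pcs_def
proof (intro conjI ballI)
  show "countable (web (pcs_exp X Y))" using countable_exp_web by (simp add: pcs_exp_def)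
  show "cliques (pcs_exp X Y) \<subseteq> nnvecs (web (pcs_exp X Y))"
    by (auto simp: pcs_exp_def pcoh_hom_def)
  show "pdual (web (pcs_exp X Y)) (pdual (web (pcs_exp X Y)) (cliques (pcs_exp X Y))) = cliques (pcs_exp X Y)"
    by (simp add: pcs_exp_def pcoh_hom_eq_pdual pdual_pdual_pdual[OF hom_tests_nnvecs])
next
  fix p assume "p \<in> web (pcs_exp X Y)"
  then obtain \<mu> b where p: "p = (\<mu>, b)" "\<mu> \<in> mfin (web X)" "b \<in> web Y" by (auto simp: pcs_exp_def)
  have \<mu>: "finite (set_mset \<mu>)" "set_mset \<mu> \<subseteq> web X" using p by (auto simp: mfin_def)
  obtain B where B: "\<And>a u. a \<in># \<mu> \<Longrightarrow> u \<in> cliques X \<Longrightarrow> u a \<le> B a"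
    using clique_bound[OF X] \<mu>(2) by (metis subsetD)
  \<comment> \<open>\<open>K\<close> bounds the monomial at \<open>\<mu>\<close> over all cliques of
    \<open>X\<close>; the 1 keeps it positive.\<close>
  define K where "K = max 1 (mpow B \<mu>)"
  have K: "mpow x \<mu> \<le> K" if "x \<in> cliques X" for x
  proof -
    have "mpow x \<mu> \<le> mpow B \<mu>" using that B by (intro mpow_mono) (auto simp: clique_nonneg[OF X])
    then show ?thesis by (simp add: K_def)
  qed
  obtain d where d: "d > 0" "(\<lambda>c. if c = b then d else 0) \<in> cliques Y" using Y p(3) by (auto simp: is_pcs_def)
  have vd: "d * v b \<le> 1" if v: "v \<in> pdual (web Y) (cliques Y)" for v
  proof -
    have "ennreal (d * v b) \<le> esum (web Y) (\<lambda>c. (if c = b then d else 0) * v c)"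
      using esum_ge[OF p(3), of "\<lambda>c. (if c = b then d else 0) * v c"] by simp
    also have "\<dots> \<le> 1" using d(2) v unfolding clique_iff[OF Y] by blast
    finally show ?thesis by (simp add: ennreal_le_1)
  qed
  \<comment> \<open>The pairing of the basis vector scaled by \<open>d / K\<close> with a test is
    the product of \<open>mpow x \<mu> / K\<close> and \<open>d * v b\<close>, both at most
    1.\<close>
  show "\<exists>c>0. (\<lambda>q. if q = p then c else 0) \<in> cliques (pcs_exp X Y)"
  proof (intro exI[of _ "d / K"] conjI)
    show dK: "d / K > 0" using d by (simp add: K_def)
    have "esum (mfin (web X) \<times> web Y) (\<lambda>q. (if q = p then d / K else 0) * t q) \<le> 1" if t: "t \<in> hom_tests" for t
    proof -
      obtain x v where x: "x \<in> cliques X" and v: "v \<in> pdual (web Y) (cliques Y)"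
        and t: "t = (\<lambda>(\<mu>, b). mpow x \<mu> * v b)" using t unfolding hom_tests_def by blast
      have "esum (mfin (web X) \<times> web Y) (\<lambda>q. (if q = p then d / K else 0) * t q)
         = (\<Sum>q\<in>{p}. ennreal ((if q = p then d / K else 0) * t q))"
        using p by (intro nn_integral_count_space') auto
      also have "\<dots> = ennreal ((mpow x \<mu> / K) * (d * v b))" by (simp add: t p mult_ac)
      also have "\<dots> \<le> ennreal (1 * 1)"
        using K[OF x] vd[OF v] d dual_nonneg[OF v, of b] by (intro ennreal_leI mult_mono) (auto simp: K_def)
      finally show ?thesis by simp
    qed
    then show "(\<lambda>q. if q = p then d / K else 0) \<in> cliques (pcs_exp X Y)"
      using p dK by (auto simp: pcs_exp_def pcoh_hom_eq_pdual pdual_iff[OF hom_tests_nnvecs] nnvecs_def)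
  qed
  obtain x where x: "x \<in> cliques X" "\<forall>a\<in>set_mset \<mu>. 0 < x a" using clique_positive[OF X \<mu>] by blast
  obtain v where v: "v \<in> pdual (web Y) (cliques Y)" "0 < v b" using dual_clique_positive[OF Y p(3)] by blast
  have pos: "mpow x \<mu> * v b > 0" using x(2) v(2) by (auto simp: mpow_def intro!: mult_pos_pos prod_pos)
  show "\<exists>B. \<forall>f\<in>cliques (pcs_exp X Y). f p \<le> B"
  proof (intro exI ballI)
    fix f assume "f \<in> cliques (pcs_exp X Y)"
    then have f: "f \<in> pdual (mfin (web X) \<times> web Y) hom_tests" by (simp add: pcs_exp_def pcoh_hom_eq_pdual)
    have t: "(\<lambda>(\<mu>, b). mpow x \<mu> * v b) \<in> hom_tests" using x v unfolding hom_tests_def by blast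
    have "ennreal (f p * (mpow x \<mu> * v b)) \<le> esum (mfin (web X) \<times> web Y) (\<lambda>q. f q * (\<lambda>(\<mu>, b). mpow x \<mu> * v b) q)"
      using esum_ge[of p "mfin (web X) \<times> web Y" "\<lambda>q. f q * (\<lambda>(\<mu>, b). mpow x \<mu> * v b) q"] p by simp
    also have "\<dots> \<le> 1" using f t unfolding pdual_iff[OF hom_tests_nnvecs] by blast
    finally show "f p \<le> 1 / (mpow x \<mu> * v b)" using pos by (simp add: ennreal_le_1 field_simps)
  qed
qed

end

section \<open>Finite differences\<close>

definition shift :: "('a \<Rightarrow> real) \<Rightarrow> (('a \<Rightarrow> real) \<Rightarrow> real) \<Rightarrow> ('a \<Rightarrow> real) \<Rightarrow> real" where
  "shift u g x = g (\<lambda>a. x a + u a)"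

definition diff :: "('a \<Rightarrow> real) \<Rightarrow> (('a \<Rightarrow> real) \<Rightarrow> real) \<Rightarrow> ('a \<Rightarrow> real) \<Rightarrow> real" where
  "diff u g x = shift u g x - g x"

fun iterdiff :: "('a \<Rightarrow> real) list \<Rightarrow> (('a \<Rightarrow> real) \<Rightarrow> real) \<Rightarrow> ('a \<Rightarrow> real) \<Rightarrow> real" where
  "iterdiff [] g = g"
| "iterdiff (u # us) g = iterdiff us (diff u g)"

lemma diff_commute: "diff u (diff v g) = diff v (diff u g)"
  by (simp add: diff_def shift_def fun_eq_iff add_ac)

lemma diff_shift: "diff u (shift v g) = shift v (diff u g)"
  by (simp add: diff_def shift_def fun_eq_iff add_ac)

lemma iterdiff_shift: "iterdiff us (shift v g) = shift v (iterdiff us g)"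
  by (induction us arbitrary: g) (simp_all add: diff_shift)

lemma iterdiff_diff: "iterdiff us (diff u g) = diff u (iterdiff us g)"
proof (induction us arbitrary: g)
  case (Cons v us)
  then show ?case by (simp add: diff_commute[of v u])
qed simp

lemma iterdiff_snoc: "iterdiff (us @ [u]) g = diff u (iterdiff us g)"
  by (induction us arbitrary: g) simp_all

lemma iterdiff_add: "iterdiff us (\<lambda>x. g x + h x) x = iterdiff us g x + iterdiff us h x"
proof (induction us arbitrary: g h)
  case (Cons u us)
  have "diff u (\<lambda>x. g x + h x) = (\<lambda>x. diff u g x + diff u h x)"
    by (simp add: diff_def shift_def fun_eq_iff)
  then show ?case by (simp add: Cons)
qed simp

lemma iterdiff_zero: "iterdiff us (\<lambda>x. 0) = (\<lambda>x. 0)"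
proof (induction us)
  case (Cons u us)
  have "diff u (\<lambda>x. 0) = (\<lambda>x. 0)" by (simp add: diff_def shift_def fun_eq_iff)
  then show ?case by (simp add: Cons)
qed simp

text \<open>Inclusion-exclusion: the last increment is split off, and the subsets of
  \<open>{1..Suc n}\<close> are sorted by whether they contain \<open>Suc n\<close>. This links
  iterated differences to the sums in \<open>pre_stable\<close>.\<close>

lemma iterdiff_eq_alternating_sum:
  "iterdiff (map u [1..<Suc n]) g x =
     (\<Sum>J\<in>Pow {1..n}. (-1) ^ (n - card J) * g (\<lambda>a. x a + (\<Sum>i\<in>J. u i a)))"
proof (induction n arbitrary: x)
  case (Suc n)
  let ?s = "\<lambda>x J. g (\<lambda>a. x a + (\<Sum>i\<in>J. u i a))"
  have "iterdiff (map u [1..<Suc (Suc n)]) g x = diff (u (Suc n)) (iterdiff (map u [1..<Suc n]) g) x"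
    using iterdiff_snoc[of "map u [1..<Suc n]"] by simp
  also have "\<dots> = (\<Sum>J\<in>Pow {1..n}. (-1) ^ (n - card J) * ?s (\<lambda>a. x a + u (Suc n) a) J)
     - (\<Sum>J\<in>Pow {1..n}. (-1) ^ (n - card J) * ?s x J)"
    unfolding diff_def shift_def Suc.IH by simp
  also have "(\<Sum>J\<in>Pow {1..n}. (-1) ^ (n - card J) * ?s (\<lambda>a. x a + u (Suc n) a) J)
     = (\<Sum>J\<in>insert (Suc n) ` Pow {1..n}. (-1) ^ (Suc n - card J) * ?s x J)"
  proof (subst sum.reindex)
    show "inj_on (insert (Suc n)) (Pow {1..n})"
      by (rule inj_onI) (metis Pow_iff Suc_n_not_le_n atLeastAtMost_iff insert_ident subsetD)
    show "(\<Sum>J\<in>Pow {1..n}. (-1) ^ (n - card J) * ?s (\<lambda>a. x a + u (Suc n) a) J) =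
      sum ((\<lambda>J. (-1) ^ (Suc n - card J) * ?s x J) \<circ> insert (Suc n)) (Pow {1..n})"
    proof (rule sum.cong)
      fix J assume J: "J \<in> Pow {1..n}"
      then have "Suc n \<notin> J" "finite J" by (auto intro: finite_subset)
      then show "(-1) ^ (n - card J) * ?s (\<lambda>a. x a + u (Suc n) a) J =
         ((\<lambda>J. (-1) ^ (Suc n - card J) * ?s x J) \<circ> insert (Suc n)) J"
        by (simp add: add_ac)
    qed simp
  qed
  also have "(\<Sum>J\<in>Pow {1..n}. (-1) ^ (n - card J) * ?s x J) = - (\<Sum>J\<in>Pow {1..n}. (-1) ^ (Suc n - card J) * ?s x J)"
    unfolding sum_negf[symmetric]
  proof (rule sum.cong)
    fix J assume "J \<in> Pow {1..n}"
    then have "card J \<le> n" using card_mono[of "{1..n}" J] by auto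
    then show "(-1) ^ (n - card J) * ?s x J = - ((-1) ^ (Suc n - card J) * ?s x J)" by (simp add: Suc_diff_le)
  qed simp
  also have "(\<Sum>J\<in>insert (Suc n) ` Pow {1..n}. (-1) ^ (Suc n - card J) * ?s x J) -
       - (\<Sum>J\<in>Pow {1..n}. (-1) ^ (Suc n - card J) * ?s x J)
     = (\<Sum>J\<in>Pow {1..Suc n}. (-1) ^ (Suc n - card J) * ?s x J)"
  proof -
    have "Pow {1..Suc n} = Pow {1..n} \<union> insert (Suc n) ` Pow {1..n}"
      by (simp add: atLeastAtMostSuc_conv Pow_insert)
    moreover have "Pow {1..n} \<inter> insert (Suc n) ` Pow {1..n} = {}" by auto
    ultimately show ?thesis by (simp add: sum.union_disjoint add.commute)
  qed
  finally show ?case .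
qed simp

lemma sum_Pow_even_odd:
  fixes h :: "nat set \<Rightarrow> real"
  shows "(\<Sum>J\<in>Pow {1..n}. (-1) ^ (n - card J) * h J) =
     (\<Sum>J | J \<subseteq> {1..n} \<and> even (n - card J). h J) - (\<Sum>J | J \<subseteq> {1..n} \<and> odd (n - card J). h J)"
proof -
  have "Pow {1..n} = {J. J \<subseteq> {1..n} \<and> even (n - card J)} \<union> {J. J \<subseteq> {1..n} \<and> odd (n - card J)}" by auto
  then have "(\<Sum>J\<in>Pow {1..n}. (-1) ^ (n - card J) * h J) =
     (\<Sum>J | J \<subseteq> {1..n} \<and> even (n - card J). (-1) ^ (n - card J) * h J) +
     (\<Sum>J | J \<subseteq> {1..n} \<and> odd (n - card J). (-1) ^ (n - card J) * h J)"
    by (simp only:) (rule sum.union_disjoint, auto)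
  also have "\<dots> = (\<Sum>J | J \<subseteq> {1..n} \<and> even (n - card J). h J) + (\<Sum>J | J \<subseteq> {1..n} \<and> odd (n - card J). - h J)"
    by (intro arg_cong2[where f = "(+)"] sum.cong) auto
  finally show ?thesis by (simp add: sum_negf)
qed

text \<open>The points range over the whole nonnegative orthant, which suits monomials. A stable
  function is given on a unit ball only; its differences are handled by
  \<open>stable_iterdiff_nonneg\<close>.\<close>

definition absolutely_monotone :: "(('a \<Rightarrow> real) \<Rightarrow> real) \<Rightarrow> bool" where
  "absolutely_monotone g \<longleftrightarrow>
     (\<forall>us x. (\<forall>u\<in>set us. \<forall>a. 0 \<le> u a) \<and> (\<forall>a. 0 \<le> x a) \<longrightarrow> 0 \<le> iterdiff us g x)"

lemma absolutely_monotone_diff: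
  assumes "absolutely_monotone g" "\<And>a. 0 \<le> u a"
  shows "absolutely_monotone (diff u g)"
  unfolding absolutely_monotone_def
proof (intro allI impI)
  fix us :: "('a \<Rightarrow> real) list" and x :: "'a \<Rightarrow> real"
  assume "(\<forall>u\<in>set us. \<forall>a. 0 \<le> u a) \<and> (\<forall>a. 0 \<le> x a)"
  then have "(\<forall>v\<in>set (u # us). \<forall>a. 0 \<le> v a) \<and> (\<forall>a. 0 \<le> x a)" using assms(2) by simp
  then have "0 \<le> iterdiff (u # us) g x" using assms(1) unfolding absolutely_monotone_def by blast
  then show "0 \<le> iterdiff us (diff u g) x" by simp
qed

lemma absolutely_monotone_shift:
  assumes "absolutely_monotone g" "\<And>a. 0 \<le> u a"
  shows "absolutely_monotone (shift u g)"
  using assms by (auto simp: absolutely_monotone_def iterdiff_shift shift_def)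

text \<open>Discrete Leibniz rule: the difference of \<open>g * h\<close> is
  \<open>diff u g * shift u h + g * diff u h\<close>. Both summands are again products of absolutely
  monotone functions, hence the induction over \<open>us\<close> with arbitrary factors.\<close>

lemma absolutely_monotone_mult:
  assumes "absolutely_monotone g" "absolutely_monotone h"
  shows "absolutely_monotone (\<lambda>x. g x * h x)"
proof -
  have "0 \<le> iterdiff us (\<lambda>x. g x * h x) x"
    if "\<forall>u\<in>set us. \<forall>a. 0 \<le> u a" "\<forall>a. 0 \<le> x a" "absolutely_monotone g" "absolutely_monotone h"
    for us :: "('a \<Rightarrow> real) list" and x g h
    using that
  proof (induction us arbitrary: g h)
    case Nil
    then have "0 \<le> iterdiff [] g x" "0 \<le> iterdiff [] h x" unfolding absolutely_monotone_def by (metis empty_iff list.set(1))+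
    then show ?case by simp
  next
    case (Cons u us)
    have u: "\<And>a. 0 \<le> u a" using Cons.prems by simp
    have "diff u (\<lambda>x. g x * h x) = (\<lambda>x. diff u g x * shift u h x + g x * diff u h x)"
      by (simp add: diff_def shift_def fun_eq_iff algebra_simps)
    then have "iterdiff (u # us) (\<lambda>x. g x * h x) x =
       iterdiff us (\<lambda>x. diff u g x * shift u h x) x + iterdiff us (\<lambda>x. g x * diff u h x) x"
      by (simp add: iterdiff_add)
    also have "\<dots> \<ge> 0"
      using Cons.prems u
      by (intro add_nonneg_nonneg Cons.IH absolutely_monotone_diff absolutely_monotone_shift) auto
    finally show ?case .
  qed
  then show ?thesis using assms unfolding absolutely_monotone_def[of "\<lambda>x. g x * h x"] by blast
qed

lemma absolutely_monotone_const: "0 \<le> c \<Longrightarrow> absolutely_monotone (\<lambda>x. c)"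
  unfolding absolutely_monotone_def
proof (intro allI impI)
  fix us :: "('a \<Rightarrow> real) list" and x assume "0 \<le> c"
  then show "0 \<le> iterdiff us (\<lambda>x. c) x"
    by (cases us) (simp_all add: diff_def[abs_def] shift_def iterdiff_zero)
qed

lemma absolutely_monotone_coordinate: "absolutely_monotone (\<lambda>x. x a)"
  unfolding absolutely_monotone_def
proof (intro allI impI, elim conjE)
  fix us :: "('a \<Rightarrow> real) list" and x :: "'a \<Rightarrow> real"
  assume us: "\<forall>u\<in>set us. \<forall>a. 0 \<le> u a" and x: "\<forall>a. 0 \<le> x a"
  show "0 \<le> iterdiff us (\<lambda>x. x a) x"
  proof (cases us)
    case (Cons u vs)
    have "diff u (\<lambda>x. x a) = (\<lambda>x. u a)" by (simp add: diff_def shift_def fun_eq_iff)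
    then show ?thesis
      using absolutely_monotone_const[of "u a"] us x Cons by (auto simp: absolutely_monotone_def)
  qed (use x in simp)
qed

lemma absolutely_monotone_mpow: "absolutely_monotone (\<lambda>x. mpow x \<mu>)"
  by (induction \<mu>)
    (simp_all add: absolutely_monotone_const absolutely_monotone_mult absolutely_monotone_coordinate)

lemma has_sum_sum_finite:
  fixes f :: "'i \<Rightarrow> 'a \<Rightarrow> real"
  assumes "finite I" "\<And>i. i \<in> I \<Longrightarrow> (f i has_sum s i) A"
  shows "((\<lambda>x. \<Sum>i\<in>I. f i x) has_sum (\<Sum>i\<in>I. s i)) A"
  using assms by (induction I) (auto intro!: has_sum_add)

text \<open>Downward closure: every argument occurring in the pre-stability inequality stays in the
  unit ball once the largest one does.\<close>

lemma partial_sum_clique: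
  assumes X: "is_pcs X" and x: "x \<in> elems (Fm X)" and u: "\<forall>i\<in>{1..n}. u i \<in> elems (Fm X)"
    and c: "(\<lambda>a. x a + (\<Sum>i\<in>{1..n}. u i a)) \<in> cliques X" and J: "J \<subseteq> {1..(n::nat)}"
  shows "(\<lambda>a. x a + (\<Sum>i\<in>J. u i a)) \<in> cliques X"
proof -
  have fin: "finite J" and uJ: "\<And>j. j \<in> J \<Longrightarrow> u j \<in> elems (Fm X)" using J u by (auto intro: finite_subset)
  have "(\<Sum>i\<in>J. u i a) \<le> (\<Sum>i\<in>{1..n}. u i a)" for a
    using J u Fm_elem_nonneg[OF X] by (intro sum_mono2) auto
  then show ?thesis
    by (intro clique_down[OF X c] Fm_elem_nnvecs[OF X] Fm_add[OF X x csum_Fm(2)[OF X fin uJ]]) auto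
qed

text \<open>The order of \<open>Fm Y\<close> is pointwise, so the cone inequality splits into one
  real inequality per coordinate; moving the odd sum to the other side produces an iterated
  difference.\<close>

lemma pre_stable_Fm_iff:
  assumes X: "is_pcs X" and Y: "is_pcs Y" and \<phi>: "\<And>x. x \<in> cliques X \<Longrightarrow> \<phi> x \<in> elems (Fm Y)"
  shows "pre_stable (Fm X) (Fm Y) \<phi> \<longleftrightarrow>
    (\<forall>n x u b. x \<in> elems (Fm X) \<and> (\<forall>i\<in>{1..n}. u i \<in> elems (Fm X)) \<and>
       (\<lambda>a. x a + (\<Sum>i\<in>{1..n}. u i a)) \<in> cliques X \<longrightarrow>
       0 \<le> iterdiff (map u [1..<Suc n]) (\<lambda>x. \<phi> x b) x)"
proof -
  have main: "cle (Fm Y)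
      (csum (Fm Y) (\<lambda>J. \<phi> (cadd (Fm X) x (csum (Fm X) u J))) {J. J \<subseteq> {1..n} \<and> odd (n - card J)})
      (csum (Fm Y) (\<lambda>J. \<phi> (cadd (Fm X) x (csum (Fm X) u J))) {J. J \<subseteq> {1..n} \<and> even (n - card J)})
     \<longleftrightarrow> (\<forall>b. 0 \<le> iterdiff (map u [1..<Suc n]) (\<lambda>x. \<phi> x b) x)"
    if x: "x \<in> elems (Fm X)" and u: "\<forall>i\<in>{1..n}. u i \<in> elems (Fm X)"
      and c: "(\<lambda>a. x a + (\<Sum>i\<in>{1..n}. u i a)) \<in> cliques X" for n x and u :: "nat \<Rightarrow> 'a \<Rightarrow> real"
  proof -
    note cl = partial_sum_clique[OF X x u c]
    have cs: "cadd (Fm X) x (csum (Fm X) u J) = (\<lambda>a. x a + (\<Sum>i\<in>J. u i a))" if J: "J \<subseteq> {1..n}" for J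
    proof -
      have uJ: "\<And>j. j \<in> J \<Longrightarrow> u j \<in> elems (Fm X)" and fin: "finite J" using u J by (auto intro: finite_subset)
      show ?thesis using csum_Fm(1)[OF X fin uJ] by (simp add: Fm_simps[OF X])
    qed
    have el: "\<phi> (cadd (Fm X) x (csum (Fm X) u J)) \<in> elems (Fm Y)" if "J \<subseteq> {1..n}" for J
      using \<phi>[OF cl[OF that]] cs[OF that] by simp
    let ?O = "{J. J \<subseteq> {1..n} \<and> odd (n - card J)}" and ?E = "{J. J \<subseteq> {1..n} \<and> even (n - card J)}"
    have fin: "finite ?O" "finite ?E" by (auto intro: finite_subset[of _ "Pow {1..n}"])
    have s: "csum (Fm Y) (\<lambda>J. \<phi> (cadd (Fm X) x (csum (Fm X) u J))) S
        = (\<lambda>b. \<Sum>J\<in>S. \<phi> (\<lambda>a. x a + (\<Sum>i\<in>J. u i a)) b)"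
      "(\<lambda>b. \<Sum>J\<in>S. \<phi> (\<lambda>a. x a + (\<Sum>i\<in>J. u i a)) b) \<in> elems (Fm Y)"
      if S: "S = ?O \<or> S = ?E" for S
    proof -
      have S': "finite S" "\<And>J. J \<in> S \<Longrightarrow> J \<subseteq> {1..n}" using S fin by auto
      have *: "(\<lambda>b. \<Sum>J\<in>S. \<phi> (cadd (Fm X) x (csum (Fm X) u J)) b) = (\<lambda>b. \<Sum>J\<in>S. \<phi> (\<lambda>a. x a + (\<Sum>i\<in>J. u i a)) b)"
        using cs S'(2) by (intro ext sum.cong) auto
      show "csum (Fm Y) (\<lambda>J. \<phi> (cadd (Fm X) x (csum (Fm X) u J))) S
        = (\<lambda>b. \<Sum>J\<in>S. \<phi> (\<lambda>a. x a + (\<Sum>i\<in>J. u i a)) b)"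
        using csum_Fm(1)[OF Y S'(1), of "\<lambda>J. \<phi> (cadd (Fm X) x (csum (Fm X) u J))"] el[OF S'(2)] * by simp
      show "(\<lambda>b. \<Sum>J\<in>S. \<phi> (\<lambda>a. x a + (\<Sum>i\<in>J. u i a)) b) \<in> elems (Fm Y)"
        using csum_Fm(2)[OF Y S'(1), of "\<lambda>J. \<phi> (cadd (Fm X) x (csum (Fm X) u J))"] el[OF S'(2)] * by simp
    qed
    have O: "?O = ?O \<or> ?O = ?E" and E: "?E = ?O \<or> ?E = ?E" by (rule disjI1 disjI2, rule refl)+
    show ?thesis
      unfolding s(1)[OF O] s(1)[OF E] cle_Fm_iff[OF Y s(2)[OF O] s(2)[OF E]]
        iterdiff_eq_alternating_sum sum_Pow_even_odd by (simp only: diff_ge_0_iff_ge)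
  qed
  have ca: "cadd (Fm X) x (csum (Fm X) u {1..n}) = (\<lambda>a. x a + (\<Sum>i\<in>{1..n}. u i a))"
    if "\<forall>i\<in>{1..n}. u i \<in> elems (Fm X)" for n x and u :: "nat \<Rightarrow> 'a \<Rightarrow> real"
    using csum_Fm(1)[OF X, of "{1..n}" u] that by (simp add: Fm_simps[OF X])
  have "pre_stable (Fm X) (Fm Y) \<phi> \<longleftrightarrow>
    (\<forall>n x u. x \<in> elems (Fm X) \<and> (\<forall>i\<in>{1..n}. u i \<in> elems (Fm X)) \<and>
       (\<lambda>a. x a + (\<Sum>i\<in>{1..n}. u i a)) \<in> cliques X \<longrightarrow>
       (\<forall>b. 0 \<le> iterdiff (map u [1..<Suc n]) (\<lambda>x. \<phi> x b) x))"
    unfolding pre_stable_def unit_ball_Fm[OF X]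
    by (intro iff_allI imp_cong conj_cong refl; (elim conjE)?; simp only: ca main)
  then show ?thesis by blast
qed

section \<open>Power series as stable functions\<close>

lemma hat_scale: "hat X (\<lambda>p. c * f p) x = (\<lambda>b. c * hat X f x b)"
  by (simp add: hat_def infsum_cmult_right' mult.assoc)

context
  fixes X :: "'a pcs" and Y :: "'b pcs"
  assumes X: "is_pcs X" and Y: "is_pcs Y"
begin

lemma exp_elem_iff: "f \<in> elems (Fm (pcs_exp X Y)) \<longleftrightarrow> (\<exists>c>0. (\<lambda>p. f p / c) \<in> pcoh_hom X Y)"
  by (simp add: Fm_elem_iff[OF is_pcs_exp[OF X Y]]) (simp add: pcs_exp_def)

lemma hom_exp_elem: "f \<in> pcoh_hom X Y \<Longrightarrow> f \<in> elems (Fm (pcs_exp X Y))"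
  using clique_elem[OF is_pcs_exp[OF X Y]] by (simp add: pcs_exp_def)

lemma exp_elem_nonneg: "f \<in> elems (Fm (pcs_exp X Y)) \<Longrightarrow> 0 \<le> f p"
  by (rule Fm_elem_nonneg[OF is_pcs_exp[OF X Y]])

lemma exp_elem_outside: "f \<in> elems (Fm (pcs_exp X Y)) \<Longrightarrow> \<mu> \<notin> mfin (web X) \<or> b \<notin> web Y \<Longrightarrow> f (\<mu>, b) = 0"
  using Fm_elem_outside[OF is_pcs_exp[OF X Y], of f "(\<mu>, b)"] by (simp add: pcs_exp_def)

lemma hat_div_clique:
  assumes "(\<lambda>p. f p / c) \<in> pcoh_hom X Y" "x \<in> cliques X"
  shows "(\<lambda>b. hat X f x b / c) \<in> cliques Y"
proof -
  have "hat X (\<lambda>p. 1 / c * f p) x \<in> cliques Y" using assms by (simp add: pcoh_hom_def)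
  then show ?thesis unfolding hat_scale by simp
qed

lemma hat_elem:
  assumes "f \<in> elems (Fm (pcs_exp X Y))" "x \<in> cliques X"
  shows "hat X f x \<in> elems (Fm Y)"
  using assms hat_div_clique unfolding exp_elem_iff Fm_elem_iff[OF Y] by blast

lemma hat_nonneg: "f \<in> elems (Fm (pcs_exp X Y)) \<Longrightarrow> x \<in> cliques X \<Longrightarrow> 0 \<le> hat X f x b"
  by (rule Fm_elem_nonneg[OF Y hat_elem])

lemma hat_term_nonneg: "f \<in> elems (Fm (pcs_exp X Y)) \<Longrightarrow> x \<in> cliques X \<Longrightarrow> 0 \<le> f (\<mu>, b) * mpow x \<mu>"
  by (simp add: exp_elem_nonneg mpow_clique_nonneg[OF X])

lemma hat_summable:
  assumes f: "f \<in> elems (Fm (pcs_exp X Y))" and x: "x \<in> cliques X"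
  shows "(\<lambda>\<mu>. f (\<mu>, b) * mpow x \<mu>) summable_on mfin (web X)"
proof (cases "b \<in> web Y")
  case True
  obtain c where c: "c > 0" "(\<lambda>p. f p / c) \<in> pcoh_hom X Y" using f exp_elem_iff by blast
  have "(\<lambda>\<mu>. f (\<mu>, b) / c * mpow x \<mu>) summable_on mfin (web X)"
    using c(2) x True by (simp add: pcoh_hom_def)
  then have "(\<lambda>\<mu>. c * (f (\<mu>, b) / c * mpow x \<mu>)) summable_on mfin (web X)"
    by (rule summable_on_cmult_right)
  then show ?thesis using c(1) by simp
next
  case False
  then show ?thesis by (simp add: exp_elem_outside[OF f])
qed

lemma esum_hat:
  assumes "f \<in> elems (Fm (pcs_exp X Y))" "x \<in> cliques X"
  shows "esum (mfin (web X)) (\<lambda>\<mu>. f (\<mu>, b) * mpow x \<mu>) = ennreal (hat X f x b)"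
  unfolding hat_def using assms by (intro esum_eq_infsum hat_summable hat_term_nonneg)

lemma hat_has_sum:
  assumes "f \<in> elems (Fm (pcs_exp X Y))" "x \<in> cliques X"
  shows "((\<lambda>\<mu>. f (\<mu>, b) * mpow x \<mu>) has_sum hat X f x b) (mfin (web X))"
  unfolding hat_def using assms by (intro has_sum_infsum hat_summable)

lemma hat_add:
  assumes "f \<in> elems (Fm (pcs_exp X Y))" "g \<in> elems (Fm (pcs_exp X Y))" "x \<in> cliques X"
  shows "hat X (\<lambda>p. f p + g p) x = (\<lambda>b. hat X f x b + hat X g x b)"
  using assms by (auto simp: hat_def distrib_right intro!: infsum_add hat_summable)

text \<open>Matrix and argument increase simultaneously. With a constant matrix this gives Scott
  continuity of \<open>hat X f\<close>; with a constant argument, Scott continuity in the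
  matrix.\<close>

lemma hat_tendsto:
  assumes f: "\<And>n. F n \<in> elems (Fm (pcs_exp X Y))" "f \<in> elems (Fm (pcs_exp X Y))"
    and finc: "\<And>n p. F n p \<le> F (Suc n) p" and flim: "\<And>p. (\<lambda>n. F n p) \<longlonglongrightarrow> f p"
    and x: "\<And>n. x n \<in> cliques X" "y \<in> cliques X"
    and xinc: "\<And>n a. x n a \<le> x (Suc n) a" and xlim: "\<And>a. (\<lambda>n. x n a) \<longlonglongrightarrow> y a"
  shows "(\<lambda>n. hat X (F n) (x n) b) \<longlonglongrightarrow> hat X f y b"
proof -
  have "(\<lambda>n. esum (mfin (web X)) (\<lambda>\<mu>. F n (\<mu>, b) * mpow (x n) \<mu>)) \<longlonglongrightarrow> esum (mfin (web X)) (\<lambda>\<mu>. f (\<mu>, b) * mpow y \<mu>)"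
  proof (rule esum_monotone_tendsto(1))
    show "0 \<le> F n (\<mu>, b) * mpow (x n) \<mu>" for n \<mu> by (rule hat_term_nonneg[OF f(1) x(1)])
    show "F n (\<mu>, b) * mpow (x n) \<mu> \<le> F (Suc n) (\<mu>, b) * mpow (x (Suc n)) \<mu>" for n \<mu>
      using xinc clique_nonneg[OF X x(1)] exp_elem_nonneg[OF f(1)] mpow_clique_nonneg[OF X x(1)]
      by (intro mult_mono finc mpow_mono) auto
    show "(\<lambda>n. F n (\<mu>, b) * mpow (x n) \<mu>) \<longlonglongrightarrow> f (\<mu>, b) * mpow y \<mu>" for \<mu>
      by (intro tendsto_mult flim tendsto_mpow xlim)
  qed
  then have "(\<lambda>n. ennreal (hat X (F n) (x n) b)) \<longlonglongrightarrow> ennreal (hat X f y b)"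
    by (simp add: esum_hat[OF f(1) x(1)] esum_hat[OF f(2) x(2)])
  then show ?thesis
    using hat_nonneg[OF f(1) x(1)] hat_nonneg[OF f(2) x(2)] by (intro tendsto_ennrealD) auto
qed

text \<open>Matrix and argument both depend on the parameter, because a test on the exponential cone
  evaluates a path of matrices along a path of arguments.\<close>

lemma borel_measurable_hat:
  assumes f: "\<And>s. s \<in> space M \<Longrightarrow> f s \<in> elems (Fm (pcs_exp X Y))"
    and x: "\<And>s. s \<in> space M \<Longrightarrow> x s \<in> cliques X"
    and fm: "\<And>p. (\<lambda>s. f s p) \<in> borel_measurable M" and xm: "\<And>a. (\<lambda>s. x s a) \<in> borel_measurable M"
  shows "(\<lambda>s. hat X (f s) (x s) b) \<in> borel_measurable M"
proof -
  have "(\<lambda>s. esum (mfin (web X)) (\<lambda>\<mu>. f s (\<mu>, b) * mpow (x s) \<mu>)) \<in> borel_measurable M"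
    unfolding mpow_def using fm xm countable_mfin[OF countable_web[OF X]]
    by (intro borel_measurable_esum borel_measurable_times borel_measurable_prod borel_measurable_power) auto
  then have "(\<lambda>s. enn2real (esum (mfin (web X)) (\<lambda>\<mu>. f s (\<mu>, b) * mpow (x s) \<mu>))) \<in> borel_measurable M"
    by simp
  moreover have "enn2real (esum (mfin (web X)) (\<lambda>\<mu>. f s (\<mu>, b) * mpow (x s) \<mu>)) = hat X (f s) (x s) b" if "s \<in> space M" for s
    using esum_hat[OF f[OF that] x[OF that]] hat_nonneg[OF f[OF that] x[OF that]] by simp
  ultimately show ?thesis by (subst measurable_cong) auto
qed

text \<open>The alternating sum over subsets is finite, so it may be taken under the series; each
  term is then an iterated difference of a monomial with nonnegative coefficient.\<close>

lemma iterdiff_hat_nonneg: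
  assumes f: "f \<in> elems (Fm (pcs_exp X Y))"
    and x: "x \<in> elems (Fm X)" and u: "\<forall>i\<in>{1..n}. u i \<in> elems (Fm X)"
    and c: "(\<lambda>a. x a + (\<Sum>i\<in>{1..n}. u i a)) \<in> cliques X"
  shows "0 \<le> iterdiff (map u [1..<Suc n]) (\<lambda>x. hat X f x b) x"
proof -
  note cl = partial_sum_clique[OF X x u c]
  have "((\<lambda>\<mu>. \<Sum>J\<in>Pow {1..n}. (-1) ^ (n - card J) * (f (\<mu>, b) * mpow (\<lambda>a. x a + (\<Sum>i\<in>J. u i a)) \<mu>))
      has_sum (\<Sum>J\<in>Pow {1..n}. (-1) ^ (n - card J) * hat X f (\<lambda>a. x a + (\<Sum>i\<in>J. u i a)) b)) (mfin (web X))"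
    using f cl by (intro has_sum_sum_finite has_sum_cmult_right hat_has_sum) auto
  moreover have "0 \<le> (\<Sum>J\<in>Pow {1..n}. (-1) ^ (n - card J) * (f (\<mu>, b) * mpow (\<lambda>a. x a + (\<Sum>i\<in>J. u i a)) \<mu>))" for \<mu>
  proof -
    have "0 \<le> iterdiff (map u [1..<Suc n]) (\<lambda>x. f (\<mu>, b) * mpow x \<mu>) x"
    proof -
      have "absolutely_monotone (\<lambda>x. f (\<mu>, b) * mpow x \<mu>)"
        using exp_elem_nonneg[OF f]
        by (intro absolutely_monotone_mult absolutely_monotone_const absolutely_monotone_mpow)
      moreover have "\<forall>v\<in>set (map u [1..<Suc n]). \<forall>a. 0 \<le> v a" using u Fm_elem_nonneg[OF X] by auto
      moreover have "\<forall>a. 0 \<le> x a" using Fm_elem_nonneg[OF X x] by simp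
      ultimately show ?thesis unfolding absolutely_monotone_def by blast
    qed
    then show ?thesis by (simp only: iterdiff_eq_alternating_sum)
  qed
  ultimately show ?thesis unfolding iterdiff_eq_alternating_sum by (rule has_sum_nonneg)
qed

lemma Fm_map_in_meas_stable:
  assumes f: "f \<in> elems (Fm (pcs_exp X Y))"
  shows "Fm_map X f \<in> meas_stable (Fm X) (Fm Y)"
proof -
  have ap: "Fm_map X f x = hat X f x" if "x \<in> cliques X" for x
    using that by (simp add: Fm_map_def unit_ball_Fm[OF X])
  have el: "Fm_map X f x \<in> elems (Fm Y)" if "x \<in> cliques X" for x
    using ap hat_elem[OF f] that by simp
  obtain c where c: "c > 0" "(\<lambda>p. f p / c) \<in> pcoh_hom X Y" using f exp_elem_iff by blast
  have bd: "cnorm (Fm Y) (Fm_map X f x) \<le> c" if "x \<in> cliques X" for x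
    using Fm_norm_le_iff[OF Y el[OF that] c(1)] hat_div_clique[OF c(2) that] ap[OF that] by simp
  have "stable (Fm X) (Fm Y) (Fm_map X f)"
    unfolding stable_def unit_ball_Fm[OF X]
  proof (intro conjI allI impI; (elim conjE)?)
    show "Fm_map X f \<in> cliques X \<rightarrow>\<^sub>E elems (Fm Y)"
      using el by (auto simp: Fm_map_def unit_ball_Fm[OF X])
    show "pre_stable (Fm X) (Fm Y) (Fm_map X f)"
    proof (rule pre_stable_Fm_iff[OF X Y el, THEN iffD2], assumption, intro allI impI, elim conjE)
      fix n x b and u :: "nat \<Rightarrow> 'a \<Rightarrow> real"
      assume x: "x \<in> elems (Fm X)" and u: "\<forall>i\<in>{1..n}. u i \<in> elems (Fm X)"
        and c: "(\<lambda>a. x a + (\<Sum>i\<in>{1..n}. u i a)) \<in> cliques X"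
      \<comment> \<open>\<open>Fm_map\<close> is \<open>undefined\<close> outside the unit ball, but
        the difference evaluates it only at partial sums, which are cliques.\<close>
      have "iterdiff (map u [1..<Suc n]) (\<lambda>x. Fm_map X f x b) x = iterdiff (map u [1..<Suc n]) (\<lambda>x. hat X f x b) x"
        unfolding iterdiff_eq_alternating_sum
      proof (rule sum.cong[OF refl])
        fix J assume "J \<in> Pow {1..n}"
        then have "(\<lambda>a. x a + (\<Sum>i\<in>J. u i a)) \<in> cliques X" by (intro partial_sum_clique[OF X x u c]) simp
        then show "(- 1) ^ (n - card J) * Fm_map X f (\<lambda>a. x a + (\<Sum>i\<in>J. u i a)) b =
          (- 1) ^ (n - card J) * hat X f (\<lambda>a. x a + (\<Sum>i\<in>J. u i a)) b" using ap by simp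
      qed
      then show "0 \<le> iterdiff (map u [1..<Suc n]) (\<lambda>x. Fm_map X f x b) x"
        using iterdiff_hat_nonneg[OF f x u c] by simp
    qed
    show "\<exists>B. \<forall>x\<in>cliques X. cnorm (Fm Y) (Fm_map X f x) \<le> B" using bd by blast
  next
    fix x s assume nd: "nondecreasing (Fm X) x" and r: "range x \<subseteq> cliques X" and l: "is_seq_lub (Fm X) x s"
    have xc: "x n \<in> cliques X" for n using r by blast
    have inc: "x n a \<le> x (Suc n) a" for n a using nd nondecreasing_Fm_iff[OF X] by blast
    have lim: "(\<lambda>n. x n a) \<longlonglongrightarrow> s a" for a using l is_seq_lub_Fm_iff[OF X nd] by blast
    have s: "s \<in> cliques X" by (rule clique_tendsto[OF X xc inc lim])
    have hl: "(\<lambda>n. hat X f (x n) b) \<longlonglongrightarrow> hat X f s b" for b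
      by (rule hat_tendsto[OF f f _ _ xc s inc lim]) auto
    have hinc: "hat X f (x n) b \<le> hat X f (x (Suc n)) b" for n b
      unfolding hat_def using exp_elem_nonneg[OF f] inc clique_nonneg[OF X xc]
      by (intro infsum_mono hat_summable[OF f xc] mult_left_mono mpow_mono) auto
    have "nondecreasing (Fm Y) (\<lambda>n. Fm_map X f (x n))"
      using el[OF xc] hinc by (simp add: nondecreasing_Fm_iff[OF Y] ap[OF xc])
    then show "is_seq_lub (Fm Y) (\<lambda>n. Fm_map X f (x n)) (Fm_map X f s)"
      using el[OF s] hl by (simp add: is_seq_lub_Fm_iff[OF Y] ap[OF xc] ap[OF s])
  qed
  moreover have "meas_path (Fm Y) n (\<lambda>r. Fm_map X f (\<gamma> r))" if "unitary_path (Fm X) n \<gamma>" for n \<gamma>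
  proof -
    have g: "\<And>s. s \<in> space (Rn n) \<Longrightarrow> \<gamma> s \<in> cliques X" "\<And>a. (\<lambda>s. \<gamma> s a) \<in> borel_measurable (Rn n)"
      using that unfolding unitary_path_Fm_iff[OF X] by auto
    have "(\<lambda>s. hat X f (\<gamma> s) b) \<in> borel_measurable (Rn n)" for b
      using f g by (intro borel_measurable_hat) auto
    then have "(\<lambda>s. Fm_map X f (\<gamma> s) b) \<in> borel_measurable (Rn n)" for b
      using ap[OF g(1)] by (subst measurable_cong) auto
    then show ?thesis
      unfolding meas_path_Fm_iff[OF Y] using el[OF g(1)] bd[OF g(1)] by blast
  qed
  ultimately show ?thesis unfolding meas_stable_def by blast
qed

lemma Fm_map_in_cstab_hom:
  assumes "f \<in> pcoh_hom X Y"
  shows "Fm_map X f \<in> cstab_hom (Fm X) (Fm Y)"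
  using assms Fm_map_in_meas_stable[OF hom_exp_elem[OF assms]]
  by (auto simp: cstab_hom_def unit_ball_Fm[OF X] unit_ball_Fm[OF Y] Fm_map_def pcoh_hom_def)

end

lemma hat_pcoh_id:
  assumes X: "is_pcs X" and x: "x \<in> cliques X"
  shows "((\<lambda>\<mu>. pcoh_id X (\<mu>, a) * mpow x \<mu>) has_sum x a) (mfin (web X))"
proof (cases "a \<in> web X")
  case True
  then show ?thesis
    by (intro has_sum_finite_neutralI[of "{{#a#}}"]) (auto simp: pcoh_id_def mfin_def)
next
  case False
  then show ?thesis using clique_outside[OF X x] by (simp add: pcoh_id_def)
qed

lemma pcoh_id_hom:
  assumes X: "is_pcs X"
  shows "pcoh_id X \<in> pcoh_hom X X" "Fm_map X (pcoh_id X) = cstab_id (Fm X)"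
proof -
  have h: "hat X (pcoh_id X) x = x" if "x \<in> cliques X" for x
    using hat_pcoh_id[OF X that] by (auto simp: hat_def infsumI)
  have "pcoh_id X \<in> nnvecs (mfin (web X) \<times> web X)"
    by (auto simp: nnvecs_def pcoh_id_def mfin_def)
  then show "pcoh_id X \<in> pcoh_hom X X"
    using h has_sum_imp_summable[OF hat_pcoh_id[OF X]] by (simp add: pcoh_hom_def)
  show "Fm_map X (pcoh_id X) = cstab_id (Fm X)"
    using h by (auto simp: Fm_map_def cstab_id_def unit_ball_Fm[OF X])
qed

section \<open>Extracting coefficients of power series\<close>

text \<open>Beyond degree \<open>j\<close> every power of \<open>t\<close> is at most
  \<open>t ^ Suc j\<close>, so the tail is at most that times the sum \<open>h\<close> of all
  coefficients. Hence \<open>c j\<close> is the limit of the quotients as \<open>t\<close> tends to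
  0.\<close>

lemma power_series_remainder:
  fixes c :: "nat \<Rightarrow> real"
  assumes c: "\<And>j. 0 \<le> c j" and t: "0 < t" "t \<le> 1"
    and g: "((\<lambda>j. c j * t ^ j) has_sum g) UNIV" and h: "(c has_sum h) UNIV"
  shows "\<bar>(g - (\<Sum>i<j. c i * t ^ i)) / t ^ j - c j\<bar> \<le> t * h"
proof -
  let ?R = "g - (\<Sum>i<Suc j. c i * t ^ i)"
  have R: "(\<lambda>i. c (i + Suc j) * t ^ (i + Suc j)) sums ?R"
    using sums_split_initial_segment[OF has_sum_imp_sums[OF g], of "Suc j"] by simp
  have H: "(\<lambda>i. c (i + Suc j)) sums (h - (\<Sum>i<Suc j. c i))"
    using sums_split_initial_segment[OF has_sum_imp_sums[OF h], of "Suc j"] by simp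
  have R0: "0 \<le> ?R" using sums_le[OF _ sums_zero R] c t by simp
  have "?R \<le> t ^ Suc j * (h - (\<Sum>i<Suc j. c i))"
  proof (rule sums_le[OF _ R sums_mult[OF H]])
    fix i
    have "t ^ (i + Suc j) \<le> t ^ Suc j" using t by (intro power_decreasing) auto
    then show "c (i + Suc j) * t ^ (i + Suc j) \<le> t ^ Suc j * c (i + Suc j)"
      using c by (subst mult.commute) (rule mult_right_mono)
  qed
  also have "\<dots> \<le> t ^ Suc j * h"
    using t sum_nonneg[of "{..<Suc j}" c] c by (intro mult_left_mono) (simp_all del: sum.lessThan_Suc)
  finally have R1: "?R \<le> t ^ Suc j * h" .
  have eq: "(g - (\<Sum>i<j. c i * t ^ i)) / t ^ j - c j = ?R / t ^ j"
    using t by (simp add: field_simps)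
  have "?R / t ^ j \<le> t * h" using R1 t by (simp add: field_simps)
  then show ?thesis unfolding eq using R0 t by simp
qed

text \<open>Induction on the degree: once the lower coefficients are measurable, \<open>c j\<close>
  is a pointwise limit of measurable quotients. The value at \<open>t = 1\<close> supplies the sum
  of all coefficients in the error bound.\<close>

lemma coefficient_measurable_1:
  fixes c :: "nat \<Rightarrow> 's \<Rightarrow> real"
  assumes c: "\<And>j s. s \<in> space M \<Longrightarrow> 0 \<le> c j s"
    and sums: "\<And>t s. 0 \<le> t \<Longrightarrow> t \<le> 1 \<Longrightarrow> s \<in> space M \<Longrightarrow> ((\<lambda>j. c j s * t ^ j) has_sum G t s) UNIV"
    and meas: "\<And>t. 0 \<le> t \<Longrightarrow> t \<le> 1 \<Longrightarrow> G t \<in> borel_measurable M"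
  shows "c j \<in> borel_measurable M"
proof (induction j rule: less_induct)
  case (less j)
  define t :: "nat \<Rightarrow> real" where "t n = 1 / real (Suc n)" for n
  have t: "0 < t n" "t n \<le> 1" for n by (auto simp: t_def)
  show ?case
  proof (rule borel_measurable_LIMSEQ_real)
    show "(\<lambda>s. (G (t n) s - (\<Sum>i<j. c i s * t n ^ i)) / t n ^ j) \<in> borel_measurable M" for n
      using less meas[of "t n"] t[of n]
      by (intro borel_measurable_divide borel_measurable_diff borel_measurable_sum borel_measurable_times) auto
    fix s assume s: "s \<in> space M"
    have b: "norm ((G (t n) s - (\<Sum>i<j. c i s * t n ^ i)) / t n ^ j - c j s) \<le> t n * G 1 s" for n
      unfolding real_norm_def using sums[of "t n" s] sums[of 1 s] t[of n] s c by (intro power_series_remainder) auto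
    have "(\<lambda>n. t n * G 1 s) \<longlonglongrightarrow> 0 * G 1 s"
      unfolding t_def using LIMSEQ_inverse_real_of_nat
      by (intro tendsto_mult tendsto_const) (simp add: inverse_eq_divide)
    then have lim: "(\<lambda>n. t n * G 1 s) \<longlonglongrightarrow> 0" by simp
    have "(\<lambda>n. (G (t n) s - (\<Sum>i<j. c i s * t n ^ i)) / t n ^ j - c j s) \<longlonglongrightarrow> 0"
      by (rule Lim_null_comparison[OF always_eventually[OF allI[OF b]] lim])
    then show "(\<lambda>n. (G (t n) s - (\<Sum>i<j. c i s * t n ^ i)) / t n ^ j) \<longlonglongrightarrow> c j s"
      by (simp add: LIM_zero_iff)
  qed
qed

lemma mpow_replicate: "mpow t (replicate_mset j a) = t a ^ j"
  by (induction j) auto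

text \<open>Splitting off the multiplicity of \<open>a\<close> lets a power series over
  \<open>insert a F\<close> be read as a series in one variable whose coefficients are series over
  \<open>F\<close>.\<close>

lemma bij_betw_mfin_insert:
  assumes "a \<notin> F"
  shows "bij_betw (\<lambda>(j, \<nu>). \<nu> + replicate_mset j a) (UNIV \<times> mfin F) (mfin (insert a F))"
proof (rule bij_betw_byWitness[where f' = "\<lambda>\<mu>. (count \<mu> a, filter_mset (\<lambda>b. b \<noteq> a) \<mu>)"])
  have "filter_mset (\<lambda>b. b \<noteq> a) \<nu> = \<nu>" "count \<nu> a = 0" if "\<nu> \<in> mfin F" for \<nu>
    using that assms by (auto simp: mfin_def filter_mset_eq_conv count_eq_zero_iff)
  then show "\<forall>p\<in>UNIV \<times> mfin F. (\<lambda>\<mu>. (count \<mu> a, filter_mset (\<lambda>b. b \<noteq> a) \<mu>)) ((\<lambda>(j, \<nu>). \<nu> + replicate_mset j a) p) = p"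
    by auto
  show "\<forall>\<mu>\<in>mfin (insert a F). (\<lambda>(j, \<nu>). \<nu> + replicate_mset j a) (count \<mu> a, filter_mset (\<lambda>b. b \<noteq> a) \<mu>) = \<mu>"
    by (auto simp: multiset_eq_iff)
qed (auto simp: mfin_def split: if_splits)

text \<open>One lemma serves two purposes: it gives measurability of the coefficient maps, and over the
  trivial \<open>\<sigma>\<close>-algebra on \<open>bool\<close> it says that coefficients are determined by the values.\<close>

lemma coefficient_measurable:
  fixes c :: "'a multiset \<Rightarrow> 's \<Rightarrow> real"
  assumes "finite F"
    and "\<And>\<mu> s. \<mu> \<in> mfin F \<Longrightarrow> s \<in> space M \<Longrightarrow> 0 \<le> c \<mu> s"
    and "\<And>t s. (\<And>a. 0 \<le> t a \<and> t a \<le> 1) \<Longrightarrow> s \<in> space M \<Longrightarrow> ((\<lambda>\<mu>. c \<mu> s * mpow t \<mu>) has_sum G t s) (mfin F)"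
    and "\<And>t. (\<And>a. 0 \<le> t a \<and> t a \<le> (1::real)) \<Longrightarrow> G t \<in> borel_measurable M"
    and "\<mu> \<in> mfin F"
  shows "c \<mu> \<in> borel_measurable M"
  using assms
proof (induction F arbitrary: c G \<mu>)
  case empty
  have "mfin {} = {{#}::'a multiset}" by (auto simp: mfin_def)
  then have "c \<mu> s = G (\<lambda>_. 0) s" if "s \<in> space M" for s
    using empty.prems(2)[of "\<lambda>_. 0" s] empty.prems(4) that by (simp add: has_sum_finite_iff)
  moreover have "G (\<lambda>_. 0) \<in> borel_measurable M" by (rule empty.prems(3)) auto
  ultimately show ?case by (subst measurable_cong) auto
next
  case (insert a F)
  note cn = insert.prems(1) and cs = insert.prems(2) and cm = insert.prems(3)
  \<comment> \<open>\<open>H j t\<close> is the coefficient of \<open>\<tau> ^ j\<close> when the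
    variable \<open>a\<close> alone varies. The one-variable lemma makes it measurable, and the
    induction hypothesis then takes it as the value of a series over \<open>F\<close>.\<close>
  define H where "H j t s = (\<Sum>\<^sub>\<infinity>\<nu>\<in>mfin F. c (\<nu> + replicate_mset j a) s * mpow t \<nu>)" for j t s
  have bij: "bij_betw (\<lambda>(j, \<nu>). \<nu> + replicate_mset j a) (UNIV \<times> mfin F) (mfin (insert a F))"
    by (rule bij_betw_mfin_insert[OF insert.hyps(2)])
  have split: "mpow (t(a := \<tau>)) (\<nu> + replicate_mset j a) = mpow t \<nu> * \<tau> ^ j" if "\<nu> \<in> mfin F" for t \<tau> \<nu> j
  proof -
    have "mpow (t(a := \<tau>)) \<nu> = mpow t \<nu>" using that insert.hyps(2) by (intro mpow_cong) (auto simp: mfin_def)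
    then show ?thesis by (simp add: mpow_replicate)
  qed
  have hs: "((\<lambda>(j, \<nu>). c (\<nu> + replicate_mset j a) s * (mpow t \<nu> * \<tau> ^ j)) has_sum G (t(a := \<tau>)) s) (UNIV \<times> mfin F)"
    if t: "\<And>a. 0 \<le> t a \<and> t a \<le> 1" "0 \<le> \<tau>" "\<tau> \<le> 1" and s: "s \<in> space M" for t \<tau> s
  proof -
    have "((\<lambda>\<mu>. c \<mu> s * mpow (t(a := \<tau>)) \<mu>) has_sum G (t(a := \<tau>)) s) (mfin (insert a F))"
      using t s by (intro cs) auto
    then have "((\<lambda>p. (\<lambda>\<mu>. c \<mu> s * mpow (t(a := \<tau>)) \<mu>) ((\<lambda>(j, \<nu>). \<nu> + replicate_mset j a) p)) has_sum G (t(a := \<tau>)) s) (UNIV \<times> mfin F)"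
      by (subst has_sum_reindex_bij_betw[OF bij])
    then show ?thesis by (rule has_sum_cong[THEN iffD1, rotated]) (auto simp: split simp del: mpow_simps)
  qed
  have Hs: "((\<lambda>\<nu>. c (\<nu> + replicate_mset j a) s * mpow t \<nu>) has_sum H j t s) (mfin F)"
    if t: "\<And>a. 0 \<le> t a \<and> t a \<le> 1" and s: "s \<in> space M" for j t s
  proof -
    \<comment> \<open>At \<open>\<tau> = 1\<close> the double series converges, hence so does each
      slice with \<open>j\<close> fixed.\<close>
    have "(\<lambda>(j, \<nu>). c (\<nu> + replicate_mset j a) s * (mpow t \<nu> * 1 ^ j)) summable_on (UNIV \<times> mfin F)"
      using hs[of t 1 s] t s has_sum_imp_summable by auto
    then have "(\<lambda>(j, \<nu>). c (\<nu> + replicate_mset j a) s * (mpow t \<nu> * 1 ^ j)) summable_on (Pair j ` mfin F)"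
      by (rule summable_on_subset_banach) auto
    then have "(\<lambda>\<nu>. c (\<nu> + replicate_mset j a) s * mpow t \<nu>) summable_on mfin F"
      by (subst (asm) summable_on_reindex) (auto simp: o_def inj_on_def)
    then show ?thesis unfolding H_def by (rule has_sum_infsum)
  qed
  have mfi: "\<nu> + replicate_mset j a \<in> mfin (insert a F)" if "\<nu> \<in> mfin F" for \<nu> j
    using that by (auto simp: mfin_def split: if_splits)
  have Hn: "0 \<le> H j t s" if t: "\<And>a. 0 \<le> t a \<and> t a \<le> 1" and s: "s \<in> space M" for j t s
    unfolding H_def using t s by (intro infsum_nonneg mult_nonneg_nonneg mpow_nonneg cn[OF mfi]) auto
  have Hm: "H j t \<in> borel_measurable M" if t: "\<And>a. 0 \<le> t a \<and> t a \<le> 1" for j t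
  proof (rule coefficient_measurable_1[where G = "\<lambda>\<tau>. G (t(a := \<tau>))"])
    fix \<tau> :: real assume \<tau>: "0 \<le> \<tau>" "\<tau> \<le> 1"
    show "G (t(a := \<tau>)) \<in> borel_measurable M" using t \<tau> by (intro cm) auto
    fix s assume s: "s \<in> space M"
    show "((\<lambda>j. H j t s * \<tau> ^ j) has_sum G (t(a := \<tau>)) s) UNIV"
    proof (rule has_sum_SigmaD[OF hs[OF t \<tau> s]])
      fix j
      show "((\<lambda>\<nu>. (\<lambda>(j, \<nu>). c (\<nu> + replicate_mset j a) s * (mpow t \<nu> * \<tau> ^ j)) (j, \<nu>)) has_sum H j t s * \<tau> ^ j) (mfin F)"
        using has_sum_cmult_left[OF Hs[OF t s, of j], where c = "\<tau> ^ j"] by (simp add: mult.assoc)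
    qed
  qed (rule Hn[OF t])
  have "\<mu> \<in> (\<lambda>(j, \<nu>). \<nu> + replicate_mset j a) ` (UNIV \<times> mfin F)"
    using insert.prems(4) bij_betw_imp_surj_on[OF bij] by simp
  then obtain j \<nu> where \<mu>: "\<mu> = \<nu> + replicate_mset j a" "\<nu> \<in> mfin F" by auto
  have "(\<lambda>\<nu>. c (\<nu> + replicate_mset j a)) \<nu> \<in> borel_measurable M"
  proof (rule insert.IH[of "\<lambda>\<nu>. c (\<nu> + replicate_mset j a)" "H j"])
    show "\<nu> \<in> mfin F" by fact
    show "0 \<le> c (\<nu> + replicate_mset j a) s" if "\<nu> \<in> mfin F" "s \<in> space M" for \<nu> s
      by (rule cn[OF mfi[OF that(1)] that(2)])
  qed (auto intro!: Hs Hm)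
  then show ?case by (simp add: \<mu>(1))
qed

lemma coefficient_unique:
  fixes c d :: "'a multiset \<Rightarrow> real"
  assumes "finite F" "\<And>\<mu>. \<mu> \<in> mfin F \<Longrightarrow> 0 \<le> c \<mu>" "\<And>\<mu>. \<mu> \<in> mfin F \<Longrightarrow> 0 \<le> d \<mu>"
    and "\<And>t. (\<And>a. 0 \<le> t a \<and> t a \<le> 1) \<Longrightarrow> ((\<lambda>\<mu>. c \<mu> * mpow t \<mu>) has_sum G t) (mfin F)"
    and "\<And>t. (\<And>a. 0 \<le> t a \<and> t a \<le> 1) \<Longrightarrow> ((\<lambda>\<mu>. d \<mu> * mpow t \<mu>) has_sum G t) (mfin F)"
    and "\<mu> \<in> mfin F"
  shows "c \<mu> = d \<mu>"
proof -
  let ?M = "sigma (UNIV :: bool set) {}"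
  have "(\<lambda>s. if s then c \<mu> else d \<mu>) \<in> borel_measurable ?M"
  proof (rule coefficient_measurable[where F = F and G = "\<lambda>t s. G t" and c = "\<lambda>\<mu> s. if s then c \<mu> else d \<mu>"])
    show "((\<lambda>\<mu>. (if s then c \<mu> else d \<mu>) * mpow t \<mu>) has_sum G t) (mfin F)"
      if "\<And>a. 0 \<le> t a \<and> t a \<le> 1" for t s
      using assms(4)[OF that] assms(5)[OF that] by (cases s) simp_all
  qed (use assms in auto)
  \<comment> \<open>In the trivial sigma-algebra a measurable set is empty or everything, so the
    preimage of a value that is taken at \<open>True\<close> also contains
    \<open>False\<close>.\<close>
  then have "(\<lambda>s. if s then c \<mu> else d \<mu>) -` {c \<mu>} \<inter> space ?M \<in> sets ?M"
    by (rule measurable_sets) simp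
  then have "(\<lambda>s. if s then c \<mu> else d \<mu>) -` {c \<mu>} \<in> {{}, UNIV}"
    by (simp add: sigma_sets_empty_eq)
  moreover have "True \<in> (\<lambda>s. if s then c \<mu> else d \<mu>) -` {c \<mu>}" by simp
  ultimately have "False \<in> (\<lambda>s. if s then c \<mu> else d \<mu>) -` {c \<mu>}" by blast
  then show ?thesis by simp
qed

text \<open>Coordinatewise scaling maps the unit cube onto the box below \<open>x\<close>, so that
  functions on cliques can be studied on a cube.\<close>

lemma clique_box:
  assumes "is_pcs X" "x \<in> cliques X" "\<And>a. 0 \<le> t a \<and> t a \<le> 1"
  shows "(\<lambda>a. t a * x a) \<in> cliques X"
  using assms(3) clique_nonneg[OF assms(1,2)] clique_outside[OF assms(1,2)]
  by (intro clique_down[OF assms(1,2)]) (auto simp: nnvecs_def mult_left_le_one_le)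

context
  fixes X :: "'a pcs" and Y :: "'b pcs"
  assumes X: "is_pcs X" and Y: "is_pcs Y"
begin

text \<open>In cube coordinates the coefficient at \<open>\<mu>\<close> is multiplied by
  \<open>mpow x \<mu>\<close>, which kills every monomial with a variable outside \<open>F\<close>;
  only variables of \<open>F\<close> are left.\<close>

lemma hat_box_has_sum:
  assumes f: "f \<in> elems (Fm (pcs_exp X Y))" and x: "x \<in> cliques X" and F: "F \<subseteq> web X" "\<And>a. a \<notin> F \<Longrightarrow> x a = 0"
    and t: "\<And>a. 0 \<le> t a \<and> t a \<le> 1"
  shows "((\<lambda>\<mu>. f (\<mu>, b) * mpow x \<mu> * mpow t \<mu>) has_sum hat X f (\<lambda>a. t a * x a) b) (mfin F)"
proof -
  have "((\<lambda>\<mu>. f (\<mu>, b) * mpow (\<lambda>a. t a * x a) \<mu>) has_sum hat X f (\<lambda>a. t a * x a) b) (mfin (web X))"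
    by (rule hat_has_sum[OF X Y f clique_box[OF X x t]])
  moreover have m: "mpow x \<mu> = 0" if \<mu>: "\<mu> \<notin> mfin F" for \<mu>
  proof -
    obtain a where a: "a \<in># \<mu>" "a \<notin> F" using \<mu> by (auto simp: mfin_def)
    then show ?thesis unfolding mpow_def using F(2)[OF a(2)] by (intro prod_zero) (auto intro!: bexI[of _ a])
  qed
  moreover have "((\<lambda>\<mu>. f (\<mu>, b) * mpow x \<mu> * mpow t \<mu>) has_sum h) (mfin F) \<longleftrightarrow>
      ((\<lambda>\<mu>. f (\<mu>, b) * mpow (\<lambda>a. t a * x a) \<mu>) has_sum h) (mfin (web X))" for h
  proof (rule has_sum_cong_neutral)
    show "\<And>\<mu>. \<mu> \<in> mfin F - mfin (web X) \<Longrightarrow> f (\<mu>, b) * mpow x \<mu> * mpow t \<mu> = 0"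
      using F(1) by (auto simp: mfin_def)
  qed (auto simp: mpow_mult m)
  ultimately show ?thesis by simp
qed

text \<open>For each \<open>\<mu>\<close> a box with positive sides along \<open>\<mu>\<close> is
  chosen. The values on it determine \<open>f (\<mu>, b) * mpow x \<mu>\<close>, and the monomial is
  positive.\<close>

lemma hat_inject:
  assumes f: "f \<in> elems (Fm (pcs_exp X Y))" and g: "g \<in> elems (Fm (pcs_exp X Y))"
    and eq: "\<And>x. x \<in> cliques X \<Longrightarrow> hat X f x = hat X g x"
  shows "f = g"
proof (rule ext, clarify)
  fix \<mu> b
  show "f (\<mu>, b) = g (\<mu>, b)"
  proof (cases "\<mu> \<in> mfin (web X)")
    case True
    then have F: "finite (set_mset \<mu>)" "set_mset \<mu> \<subseteq> web X" by (auto simp: mfin_def)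
    obtain x where x: "x \<in> cliques X" "\<forall>a\<in>set_mset \<mu>. 0 < x a" "\<And>a. a \<notin># \<mu> \<Longrightarrow> x a = 0"
      using clique_positive[OF X F] by blast
    have "f (\<mu>, b) * mpow x \<mu> = g (\<mu>, b) * mpow x \<mu>"
    proof (rule coefficient_unique[OF F(1)])
      fix t :: "'a \<Rightarrow> real" assume t: "\<And>a. 0 \<le> t a \<and> t a \<le> 1"
      show "((\<lambda>\<mu>. f (\<mu>, b) * mpow x \<mu> * mpow t \<mu>) has_sum hat X f (\<lambda>a. t a * x a) b) (mfin (set_mset \<mu>))"
        by (rule hat_box_has_sum[OF f x(1) F(2) x(3) t])
      show "((\<lambda>\<mu>. g (\<mu>, b) * mpow x \<mu> * mpow t \<mu>) has_sum hat X f (\<lambda>a. t a * x a) b) (mfin (set_mset \<mu>))"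
        unfolding eq[OF clique_box[OF X x(1) t]] by (rule hat_box_has_sum[OF g x(1) F(2) x(3) t])
    qed (auto simp: hat_term_nonneg[OF X Y] f g x mfin_def)
    moreover have "mpow x \<mu> > 0" using x(2) by (auto simp: mpow_def intro!: prod_pos)
    ultimately show ?thesis by simp
  qed (simp add: exp_elem_outside[OF X Y] f g)
qed

text \<open>As for injectivity, the coefficient times a positive monomial is read off on a box. This
  is what makes the inverse of \<open>f \<mapsto> hat X f\<close> preserve measurable paths.\<close>

lemma coefficient_borel_measurable:
  assumes f: "\<And>s. s \<in> space M \<Longrightarrow> f s \<in> elems (Fm (pcs_exp X Y))"
    and m: "\<And>x. x \<in> cliques X \<Longrightarrow> (\<lambda>s. hat X (f s) x b) \<in> borel_measurable M"
  shows "(\<lambda>s. f s (\<mu>, b)) \<in> borel_measurable M"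
proof (cases "\<mu> \<in> mfin (web X)")
  case True
  then have F: "finite (set_mset \<mu>)" "set_mset \<mu> \<subseteq> web X" by (auto simp: mfin_def)
  obtain x where x: "x \<in> cliques X" "\<forall>a\<in>set_mset \<mu>. 0 < x a" "\<And>a. a \<notin># \<mu> \<Longrightarrow> x a = 0"
    using clique_positive[OF X F] by blast
  have "(\<lambda>s. f s (\<mu>, b) * mpow x \<mu>) \<in> borel_measurable M"
  proof (rule coefficient_measurable[OF F(1), where c = "\<lambda>\<mu> s. f s (\<mu>, b) * mpow x \<mu>"
        and G = "\<lambda>t s. hat X (f s) (\<lambda>a. t a * x a) b"])
    fix t :: "'a \<Rightarrow> real" assume t: "\<And>a. 0 \<le> t a \<and> t a \<le> 1"
    show "(\<lambda>s. hat X (f s) (\<lambda>a. t a * x a) b) \<in> borel_measurable M"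
      by (rule m[OF clique_box[OF X x(1) t]])
    fix s assume s: "s \<in> space M"
    show "((\<lambda>\<mu>. f s (\<mu>, b) * mpow x \<mu> * mpow t \<mu>) has_sum hat X (f s) (\<lambda>a. t a * x a) b) (mfin (set_mset \<mu>))"
      by (rule hat_box_has_sum[OF f[OF s] x(1) F(2) x(3) t])
  qed (auto simp: hat_term_nonneg[OF X Y] f x mfin_def)
  then have "(\<lambda>s. f s (\<mu>, b) * mpow x \<mu> / mpow x \<mu>) \<in> borel_measurable M"
    by (intro borel_measurable_divide) auto
  moreover have "mpow x \<mu> > 0" using x(2) by (auto simp: mpow_def intro!: prod_pos)
  ultimately show ?thesis by simp
next
  case False
  then have "f s (\<mu>, b) = 0" if "s \<in> space M" for s using exp_elem_outside[OF X Y f[OF that]] by simp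
  then show ?thesis by (subst measurable_cong[where g = "\<lambda>_. 0"]) auto
qed

end

section \<open>Absolutely monotone functions on the cube\<close>

text \<open>\<open>h a\<close> is the increment attached to the direction \<open>a\<close>.
  Difference operators commute, so the fold over an unordered multiset of directions is well
  defined.\<close>

definition mdiff :: "('a \<Rightarrow> 'a \<Rightarrow> real) \<Rightarrow> 'a multiset \<Rightarrow> (('a \<Rightarrow> real) \<Rightarrow> real) \<Rightarrow> ('a \<Rightarrow> real) \<Rightarrow> real" where
  "mdiff h \<mu> g = fold_mset (\<lambda>a. diff (h a)) g \<mu>"

lemma comp_fun_commute_diff: "comp_fun_commute (\<lambda>a. diff (h a))"
  by unfold_locales (simp add: fun_eq_iff diff_commute)

lemma mdiff_empty [simp]: "mdiff h {#} g = g"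
  by (simp add: mdiff_def)

lemma mdiff_add_mset [simp]: "mdiff h (add_mset a \<mu>) g = diff (h a) (mdiff h \<mu> g)"
  by (simp add: mdiff_def comp_fun_commute.fold_mset_add_mset[OF comp_fun_commute_diff])

lemma mdiff_shift: "mdiff h \<mu> (shift v g) = shift v (mdiff h \<mu> g)"
  by (induction \<mu>) (simp_all add: diff_shift)

lemma mdiff_mset: "mdiff h (mset as) g = iterdiff (map h as) g"
  by (induction as arbitrary: g) (simp_all add: iterdiff_diff)

text \<open>The multi-index binomial coefficient, zero as soon as \<open>\<mu>\<close> exceeds
  \<open>\<kappa>\<close> in a direction of \<open>F\<close>.\<close>

definition mchoose :: "'a set \<Rightarrow> 'a multiset \<Rightarrow> 'a multiset \<Rightarrow> real" where
  "mchoose F \<kappa> \<mu> = (\<Prod>a\<in>F. real (count \<kappa> a choose count \<mu> a))"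

lemma finite_submultisets: "finite {\<mu>. \<mu> \<subseteq># \<kappa>}"
proof -
  obtain xs where xs: "mset xs = \<kappa>" using ex_mset by blast
  have "{\<mu>. \<mu> \<subseteq># \<kappa>} \<subseteq> mset ` {ys. set ys \<subseteq> set xs \<and> length ys \<le> length xs}"
  proof
    fix \<mu> assume "\<mu> \<in> {\<mu>. \<mu> \<subseteq># \<kappa>}"
    moreover obtain ys where "mset ys = \<mu>" using ex_mset by blast
    ultimately show "\<mu> \<in> mset ` {ys. set ys \<subseteq> set xs \<and> length ys \<le> length xs}"
      using xs set_mset_mono[of \<mu> \<kappa>] size_mset_mono[of \<mu> \<kappa>] by (intro image_eqI[of _ _ ys]) auto
  qed
  then show ?thesis by (rule finite_subset) (simp add: finite_lists_length_le)
qed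

lemma mchoose_eq_0:
  assumes "finite F" "\<mu> \<in> mfin F" "\<not> \<mu> \<subseteq># \<kappa>"
  shows "mchoose F \<kappa> \<mu> = 0"
proof -
  obtain a where a: "count \<kappa> a < count \<mu> a" using assms(3) by (auto simp: subseteq_mset_def not_le)
  then have "a \<in># \<mu>" by (metis count_eq_zero_iff not_less_zero)
  then have "a \<in> F" using assms(2) by (auto simp: mfin_def)
  then show ?thesis unfolding mchoose_def using assms(1) a by (intro prod_zero) (auto intro!: bexI[of _ a])
qed

text \<open>Pascal's rule in the direction \<open>a\<close>; the other factors of the product do not
  change.\<close>

lemma mchoose_add_mset:
  assumes F: "finite F" "a \<in> F"
  shows "mchoose F (add_mset a \<kappa>) \<mu> = mchoose F \<kappa> \<mu> + (if a \<in># \<mu> then mchoose F \<kappa> (\<mu> - {#a#}) else 0)"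
proof -
  let ?r = "\<Prod>b\<in>F - {a}. real (count \<kappa> b choose count \<mu> b)"
  have r: "(\<Prod>b\<in>F - {a}. real (count (add_mset a \<kappa>) b choose count \<mu> b)) = ?r"
    "(\<Prod>b\<in>F - {a}. real (count \<kappa> b choose count (\<mu> - {#a#}) b)) = ?r"
    by (auto intro!: prod.cong split: if_splits)
  have "real (Suc (count \<kappa> a) choose count \<mu> a) =
    real (count \<kappa> a choose count \<mu> a) + (if a \<in># \<mu> then real (count \<kappa> a choose (count \<mu> a - 1)) else 0)"
  proof (cases "count \<mu> a")
    case 0
    then have "a \<notin># \<mu>" by (simp add: not_in_iff)
    then show ?thesis using 0 by simp
  next
    case (Suc j)
    then have "a \<in># \<mu>" by (metis count_eq_zero_iff nat.distinct(1))
    then show ?thesis using Suc by simp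
  qed
  then show ?thesis
    unfolding mchoose_def prod.remove[OF F] r by (simp add: distrib_right)
qed

text \<open>Newton's forward difference formula in several variables. A shift is the identity plus a
  difference, and each step added to \<open>\<kappa>\<close> recombines the binomials by Pascal's
  rule.\<close>

lemma newton_expansion:
  assumes F: "finite F" and \<kappa>: "\<kappa> \<in> mfin F"
  shows "g (\<lambda>b. x b + (\<Sum>a\<in>#\<kappa>. h a b)) = (\<Sum>\<mu> | \<mu> \<subseteq># \<kappa>. mchoose F \<kappa> \<mu> * mdiff h \<mu> g x)"
  using \<kappa>
proof (induction \<kappa> arbitrary: g)
  case empty
  have "{\<mu>. \<mu> \<subseteq># {#}} = {{#}}" by auto
  then show ?case by (simp add: mchoose_def)
next
  case (add a \<kappa>)
  have aF: "a \<in> F" and \<kappa>: "\<kappa> \<in> mfin F" using add.prems by (auto simp: mfin_def)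
  let ?M = "\<lambda>\<mu>. mdiff h \<mu> g x"
  have sub: "\<mu> \<in> mfin F" if "\<mu> \<subseteq># add_mset a \<kappa>" for \<mu>
    using set_mset_mono[OF that] add.prems by (auto simp: mfin_def)
  have "g (\<lambda>b. x b + (\<Sum>a\<in>#add_mset a \<kappa>. h a b)) = shift (h a) g (\<lambda>b. x b + (\<Sum>a\<in>#\<kappa>. h a b))"
    by (simp add: shift_def add_ac)
  also have "\<dots> = (\<Sum>\<mu> | \<mu> \<subseteq># \<kappa>. mchoose F \<kappa> \<mu> * shift (h a) (mdiff h \<mu> g) x)"
    using add.IH[OF \<kappa>, of "shift (h a) g"] by (simp only: mdiff_shift)
  also have "\<dots> = (\<Sum>\<mu> | \<mu> \<subseteq># \<kappa>. mchoose F \<kappa> \<mu> * ?M \<mu>) + (\<Sum>\<mu> | \<mu> \<subseteq># \<kappa>. mchoose F \<kappa> \<mu> * ?M (add_mset a \<mu>))"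
    unfolding sum.distrib[symmetric] by (intro sum.cong) (auto simp: diff_def algebra_simps)
  \<comment> \<open>The added indices have a vanishing binomial coefficient; both sums are being
    brought to the same index set.\<close>
  also have "(\<Sum>\<mu> | \<mu> \<subseteq># \<kappa>. mchoose F \<kappa> \<mu> * ?M \<mu>) = (\<Sum>\<mu> | \<mu> \<subseteq># add_mset a \<kappa>. mchoose F \<kappa> \<mu> * ?M \<mu>)"
    by (rule sum.mono_neutral_left)
      (auto simp: finite_submultisets intro: subset_mset.order_trans[of _ \<kappa>] mchoose_eq_0[OF F sub])
  also have "(\<Sum>\<mu> | \<mu> \<subseteq># \<kappa>. mchoose F \<kappa> \<mu> * ?M (add_mset a \<mu>)) =
      (\<Sum>\<mu> | \<mu> \<subseteq># add_mset a \<kappa> \<and> a \<in># \<mu>. mchoose F \<kappa> (\<mu> - {#a#}) * ?M \<mu>)"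
    by (rule sum.reindex_bij_witness[where i = "\<lambda>\<mu>. \<mu> - {#a#}" and j = "add_mset a"])
      (auto simp: subset_eq_diff_conv)
  also have "\<dots> = (\<Sum>\<mu> | \<mu> \<subseteq># add_mset a \<kappa>. (if a \<in># \<mu> then mchoose F \<kappa> (\<mu> - {#a#}) else 0) * ?M \<mu>)"
    by (rule sum.mono_neutral_cong_left) (auto simp: finite_submultisets)
  also have "(\<Sum>\<mu> | \<mu> \<subseteq># add_mset a \<kappa>. mchoose F \<kappa> \<mu> * ?M \<mu>) + \<dots> =
      (\<Sum>\<mu> | \<mu> \<subseteq># add_mset a \<kappa>. mchoose F (add_mset a \<kappa>) \<mu> * ?M \<mu>)"
    unfolding sum.distrib[symmetric] mchoose_add_mset[OF F aF] by (intro sum.cong) (auto simp: algebra_simps)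
  finally show ?case .
qed

text \<open>Factor by factor, \<open>m - i \<le> (m / n) * (n - i)\<close>. The quotient of
  binomials is thus bounded by a power of \<open>m / n\<close>, which yields the majorant
  independent of the mesh.\<close>

lemma choose_le_power_mult:
  assumes "m \<le> n" "0 < n"
  shows "real (m choose j) \<le> (real m / real n) ^ j * real (n choose j)"
proof (cases "j \<le> m")
  case True
  have "(\<Prod>i = 0..<j. real m - real i) \<le> (\<Prod>i = 0..<j. real m / real n * (real n - real i))"
  proof (rule prod_mono)
    fix i assume "i \<in> {0..<j}"
    then have i: "i < m" using True by simp
    have "real m * real i \<le> real n * real i" using assms by (intro mult_right_mono) auto
    then show "0 \<le> real m - real i \<and> real m - real i \<le> real m / real n * (real n - real i)"
      using i assms by (simp add: field_simps)
  qed
  also have "\<dots> = (real m / real n) ^ j * (\<Prod>i = 0..<j. real n - real i)"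
    by (simp add: prod.distrib del: times_divide_eq_left)
  finally have "(\<Prod>i = 0..<j. real m - real i) / fact j \<le> (real m / real n) ^ j * (\<Prod>i = 0..<j. real n - real i) / fact j"
    by (rule divide_right_mono) simp
  then show ?thesis by (simp add: binomial_gbinomial gbinomial_prod_rev)
qed (simp add: binomial_eq_0)

text \<open>The quotient is a product of \<open>j\<close> factors \<open>(m - i) / (n - i)\<close>,
  each tending to \<open>t\<close>.\<close>

lemma choose_ratio_tendsto:
  fixes m n :: "nat \<Rightarrow> nat"
  assumes n: "filterlim n at_top sequentially" and mn: "(\<lambda>k. real (m k) / real (n k)) \<longlonglongrightarrow> t"
  shows "(\<lambda>k. real (m k choose j) / real (n k choose j)) \<longlonglongrightarrow> t ^ j"
proof -
  have rn: "filterlim (\<lambda>k. real (n k)) at_top sequentially"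
    using n by (rule filterlim_compose[OF filterlim_real_sequentially])
  have inv: "(\<lambda>k. real i / real (n k)) \<longlonglongrightarrow> 0" for i
    by (rule tendsto_divide_0[OF tendsto_const]) (use rn filterlim_at_top_imp_at_infinity in blast)
  have "(\<lambda>k. \<Prod>i = 0..<j. (real (m k) / real (n k) - real i / real (n k)) / (1 - real i / real (n k))) \<longlonglongrightarrow> (\<Prod>i = 0..<j. (t - 0) / (1 - 0))"
    by (intro tendsto_prod tendsto_divide tendsto_diff mn inv tendsto_const) simp
  then have "(\<lambda>k. \<Prod>i = 0..<j. (real (m k) / real (n k) - real i / real (n k)) / (1 - real i / real (n k))) \<longlonglongrightarrow> t ^ j"
    by simp
  moreover have "\<forall>\<^sub>F k in sequentially. (\<Prod>i = 0..<j. (real (m k) / real (n k) - real i / real (n k)) / (1 - real i / real (n k)))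
      = real (m k choose j) / real (n k choose j)"
    \<comment> \<open>When \<open>0 < n k < j\<close> both sides are 0: a denominator vanishes, and
      division by 0 gives 0.\<close>
    using n[unfolded filterlim_at_top, rule_format, of "Suc 0"]
  proof eventually_elim
    case (elim k)
    have "(real (m k) / real (n k) - real i / real (n k)) / (1 - real i / real (n k)) = (real (m k) - real i) / (real (n k) - real i)" for i
    proof -
      have "(real (m k) / real (n k) - real i / real (n k)) / (1 - real i / real (n k))
         = ((real (m k) - real i) / real (n k)) / ((real (n k) - real i) / real (n k))"
        using elim by (simp add: diff_divide_distrib)
      then show ?thesis using elim by simp
    qed
    then show ?case by (simp add: binomial_gbinomial gbinomial_prod_rev prod_dividef)
  qed
  ultimately show ?thesis by (rule Lim_transform_eventually)
qed

text \<open>A countable power of a compact interval is sequentially compact, so one subsequence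
  serves all indices at once.\<close>

lemma countable_convergent_subsequence:
  fixes f :: "nat \<Rightarrow> 'a \<Rightarrow> real"
  assumes "countable S" "\<And>k a. a \<in> S \<Longrightarrow> f k a \<in> {0..B}"
  shows "\<exists>r l. strict_mono r \<and> (\<forall>a\<in>S. (\<lambda>k. f (r k) a) \<longlonglongrightarrow> l a)"
proof (cases "S = {}")
  case True
  then show ?thesis using strict_mono_id by blast
next
  case False
  let ?K = "PiE UNIV (\<lambda>_. {0..B}) :: (nat \<Rightarrow> real) set"
  have "compactin (product_topology (\<lambda>_. euclidean) UNIV) ?K"
    by (subst compactin_PiE) auto
  then have K: "seq_compact ?K"
    by (simp add: euclidean_product_topology compact_imp_seq_compact)
  have "(\<lambda>i. f k (from_nat_into S i)) \<in> ?K" for k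
    using assms(2)[OF from_nat_into[OF False]] by (simp add: PiE_UNIV_domain)
  then obtain l r where r: "strict_mono r" "((\<lambda>k i. f k (from_nat_into S i)) \<circ> r) \<longlonglongrightarrow> l"
    using seq_compactE[OF K] by metis
  have "(\<lambda>k. f (r k) (from_nat_into S i)) \<longlonglongrightarrow> l i" for i
    using continuous_on_tendsto_compose[OF continuous_on_product_coordinates[of i] r(2)] by (simp add: o_def)
  then have "(\<lambda>k. f (r k) a) \<longlonglongrightarrow> l (to_nat_on S a)" if "a \<in> S" for a
    using from_nat_into_to_nat_on[OF assms(1) that] by metis
  then show ?thesis using r(1) by (intro exI[of _ r] exI[of _ "\<lambda>a. l (to_nat_on S a)"]) simp
qed


lemma mpow_eq_prod_superset:
  assumes "finite F" "\<mu> \<in> mfin F"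
  shows "mpow t \<mu> = (\<Prod>a\<in>F. t a ^ count \<mu> a)"
  unfolding mpow_def using assms by (intro prod.mono_neutral_left) (auto simp: mfin_def not_in_iff)

text \<open>The sum is a product of geometric series, one for each element of \<open>F\<close>. It
  makes the majorant of the dominated convergence argument summable.\<close>

lemma esum_mpow_finite:
  assumes "finite F" "\<And>a. a \<in> F \<Longrightarrow> 0 \<le> t a \<and> t a < 1"
  shows "esum (mfin F) (mpow t) < \<infinity>"
  using assms
proof (induction F)
  case empty
  have "mfin {} = {{#}::'a multiset}" by (auto simp: mfin_def)
  then show ?case by (simp add: nn_integral_count_space_finite)
next
  case (insert a F)
  have ta: "0 \<le> t a" "t a < 1" using insert.prems by auto
  have geo: "esum UNIV (\<lambda>j. t a ^ j) < \<infinity>"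
    using ta summable_geometric[of "t a"]
    by (subst summable_on_iff_esum[symmetric]) (auto simp: summable_on_UNIV_nonneg_real_iff)
  have "esum (mfin (insert a F)) (mpow t) = (\<integral>\<^sup>+p. ennreal (mpow t ((\<lambda>(j, \<nu>). \<nu> + replicate_mset j a) p)) \<partial>count_space (UNIV \<times> mfin F))"
    by (rule nn_integral_bij_count_space[OF bij_betw_mfin_insert[OF insert.hyps(2)], symmetric])
  also have "\<dots> = (\<integral>\<^sup>+j. \<integral>\<^sup>+\<nu>. ennreal (t a ^ j) * ennreal (mpow t \<nu>) \<partial>count_space (mfin F) \<partial>count_space UNIV)"
  proof -
    have "ennreal (mpow t (\<nu> + replicate_mset j a)) = ennreal (t a ^ j) * ennreal (mpow t \<nu>)" for \<nu> j
      using ta by (simp add: mpow_replicate ennreal_mult'' mult.commute)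
    then show ?thesis unfolding nn_integral_count_space_Times by simp
  qed
  also have "\<dots> = esum UNIV (\<lambda>j. t a ^ j) * esum (mfin F) (mpow t)"
    by (simp add: nn_integral_cmult nn_integral_multc)
  also have "\<dots> < \<infinity>" using geo insert by (simp add: ennreal_mult_less_top)
  finally show ?case .
qed

lemma sum_mset_steps: "(\<Sum>a\<in>#\<kappa>. if b = a then (c::real) else 0) = real (count \<kappa> b) * c"
  by (induction \<kappa>) (auto simp: algebra_simps)

lemma floor_double: "2 * \<lfloor>x\<rfloor> \<le> \<lfloor>2 * (x::real)\<rfloor>"
  by linarith

text \<open>Halving the mesh refines the grid, so rounding down produces nondecreasing points; only
  along such sequences is a stable function known to converge.\<close>

lemma dyadic_floor_mono:
  fixes t :: real
  shows "\<lfloor>2 ^ k * t\<rfloor> / 2 ^ k \<le> \<lfloor>2 ^ Suc k * t\<rfloor> / 2 ^ Suc k"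
proof -
  have "2 * real_of_int \<lfloor>2 ^ k * t\<rfloor> \<le> real_of_int \<lfloor>2 ^ Suc k * t\<rfloor>"
    using floor_double[of "2 ^ k * t"] by (simp add: mult.assoc flip: of_int_le_iff)
  then show ?thesis by (simp add: field_simps)
qed

lemma dyadic_floor_tendsto: "(\<lambda>k. \<lfloor>2 ^ k * t\<rfloor> / 2 ^ k) \<longlonglongrightarrow> (t::real)"
proof (rule real_tendsto_sandwich[where f = "\<lambda>k. t - (1/2) ^ k" and h = "\<lambda>k. t"])
  show "\<forall>\<^sub>F k in sequentially. t - (1/2) ^ k \<le> \<lfloor>2 ^ k * t\<rfloor> / 2 ^ k"
  proof (rule always_eventually, rule allI)
    fix k
    have "2 ^ k * t - 1 \<le> \<lfloor>2 ^ k * t\<rfloor>" by linarith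
    then have "(2 ^ k * t - 1) / 2 ^ k \<le> \<lfloor>2 ^ k * t\<rfloor> / 2 ^ k" by (rule divide_right_mono) simp
    then show "t - (1/2) ^ k \<le> \<lfloor>2 ^ k * t\<rfloor> / 2 ^ k" by (simp add: diff_divide_distrib power_one_over)
  qed
  show "\<forall>\<^sub>F k in sequentially. \<lfloor>2 ^ k * t\<rfloor> / 2 ^ k \<le> t"
  proof (rule always_eventually, rule allI)
    fix k
    have "\<lfloor>2 ^ k * t\<rfloor> \<le> 2 ^ k * t" by linarith
    then have "\<lfloor>2 ^ k * t\<rfloor> / 2 ^ k \<le> 2 ^ k * t / 2 ^ k" by (rule divide_right_mono) simp
    then show "\<lfloor>2 ^ k * t\<rfloor> / 2 ^ k \<le> t" by simp
  qed
  show "(\<lambda>k. t - (1/2) ^ k) \<longlonglongrightarrow> t"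
    using tendsto_diff[OF tendsto_const[of t] LIMSEQ_realpow_zero[of "1/2::real"]] by simp
qed simp


text \<open>A several-variable form of Bernstein's theorem on absolutely monotone functions. The
  assumptions ask only for what stability offers: in \<open>am\<close> a step of size
  \<open>1 / n\<close> is used at most \<open>n\<close> times per direction, so that the points stay
  in the cube, and \<open>cont\<close> concerns nondecreasing sequences.\<close>

theorem absolutely_monotone_cube:
  fixes G :: "('a \<Rightarrow> real) \<Rightarrow> real"
  assumes F: "finite F"
    and am: "\<And>n as. 0 < n \<Longrightarrow> set as \<subseteq> F \<Longrightarrow> (\<And>a. count (mset as) a \<le> n) \<Longrightarrow>
        0 \<le> iterdiff (map (\<lambda>a b. if b = a then 1 / real n else 0) as) G (\<lambda>_. 0)"
    and cont: "\<And>y z. (\<And>k a. 0 \<le> y k a \<and> y k a \<le> 1 \<and> y k a \<le> y (Suc k) a) \<Longrightarrow>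
        (\<And>k a. a \<notin> F \<Longrightarrow> y k a = 0) \<Longrightarrow> (\<And>a. (\<lambda>k. y k a) \<longlonglongrightarrow> z a) \<Longrightarrow> (\<lambda>k. G (y k)) \<longlonglongrightarrow> G z"
  shows "\<exists>A. (\<forall>\<mu>\<in>mfin F. 0 \<le> A \<mu>) \<and>
     (\<forall>t. (\<forall>a. 0 \<le> t a \<and> t a \<le> 1) \<and> (\<forall>a. a \<notin> F \<longrightarrow> t a = 0) \<longrightarrow>
        ((\<lambda>\<mu>. A \<mu> * mpow t \<mu>) has_sum G t) (mfin F))"
proof -
  \<comment> \<open>The top corner of the grid: \<open>2 ^ k\<close> steps in each direction of
    \<open>F\<close>.\<close>
  define N where "N k = (\<Sum>a\<in>F. replicate_mset (2 ^ k) a)" for k :: nat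
  have N: "count (N k) a = (if a \<in> F then 2 ^ k else 0)" for k a
    using F by (simp add: N_def count_sum)
  have Nm: "\<mu> \<in> mfin F" if "\<mu> \<subseteq># N k" for \<mu> k
  proof -
    have "set_mset (N k) \<subseteq> F" using N[of k] by (metis not_in_iff subsetI)
    then show ?thesis using set_mset_mono[OF that] by (auto simp: mfin_def)
  qed
  define D where "D k \<mu> = mdiff (\<lambda>a b. if b = a then 1 / real (2 ^ k) else 0) \<mu> G (\<lambda>_. 0)" for k \<mu>
  have D0: "0 \<le> D k \<mu>" if \<mu>: "\<mu> \<subseteq># N k" for k \<mu>
  proof -
    obtain as where as: "mset as = \<mu>" using ex_mset by blast
    have "set as \<subseteq> F" using Nm[OF \<mu>] as by (auto simp: mfin_def)
    moreover have "count (mset as) a \<le> 2 ^ k" for a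
      using mset_subset_eq_count[OF \<mu>, of a] N[of k a] as by (auto split: if_splits)
    ultimately show ?thesis unfolding D_def as[symmetric] mdiff_mset by (intro am) auto
  qed
  \<comment> \<open>Enlarging the index set from the submultisets of \<open>\<kappa>\<close> to
    those of \<open>N k\<close> adds only zero binomials and makes it independent of the grid
    point.\<close>
  have grid: "G (\<lambda>b. real (count \<kappa> b) / 2 ^ k) = (\<Sum>\<mu> | \<mu> \<subseteq># N k. mchoose F \<kappa> \<mu> * D k \<mu>)" if \<kappa>: "\<kappa> \<subseteq># N k" for \<kappa> k
  proof -
    have "G (\<lambda>b. real (count \<kappa> b) / 2 ^ k) = (\<Sum>\<mu> | \<mu> \<subseteq># \<kappa>. mchoose F \<kappa> \<mu> * D k \<mu>)"
      using newton_expansion[OF F Nm[OF \<kappa>], of G "\<lambda>_. 0" "\<lambda>a b. if b = a then 1 / real (2 ^ k) else 0"]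
      by (simp add: sum_mset_steps D_def)
    also have "\<dots> = (\<Sum>\<mu> | \<mu> \<subseteq># N k. mchoose F \<kappa> \<mu> * D k \<mu>)"
      using \<kappa> by (intro sum.mono_neutral_left)
        (auto simp: finite_submultisets intro: subset_mset.order_trans[OF _ \<kappa>] mchoose_eq_0[OF F Nm])
    finally show ?thesis .
  qed
  have mch0: "0 \<le> mchoose F \<kappa> \<mu>" for \<kappa> \<mu> by (simp add: mchoose_def prod_nonneg)
  \<comment> \<open>\<open>B\<close> is the value at the corner with all coordinates in
    \<open>F\<close> equal to 1. By Newton's formula there, the normalised coefficients
    \<open>A k \<mu>\<close> add up to \<open>B\<close> at every mesh, hence lie in
    \<open>{0..B}\<close>.\<close>
  define B where "B = G (\<lambda>a. if a \<in> F then 1 else 0)"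
  define A where "A k \<mu> = (if \<mu> \<subseteq># N k then mchoose F (N k) \<mu> * D k \<mu> else 0)" for k \<mu>
  have Bsum: "(\<Sum>\<mu> | \<mu> \<subseteq># N k. mchoose F (N k) \<mu> * D k \<mu>) = B" for k
  proof -
    have "(\<lambda>b. real (count (N k) b) / 2 ^ k) = (\<lambda>a. if a \<in> F then 1 else 0)" by (simp add: N fun_eq_iff)
    then show ?thesis using grid[of "N k" k] by (simp add: B_def)
  qed
  have B0: "0 \<le> B" unfolding Bsum[of 0, symmetric] using D0 mch0 by (intro sum_nonneg) auto
  have A: "A k \<mu> \<in> {0..B}" for k \<mu>
  proof (cases "\<mu> \<subseteq># N k")
    case True
    then have "mchoose F (N k) \<mu> * D k \<mu> \<le> (\<Sum>\<mu> | \<mu> \<subseteq># N k. mchoose F (N k) \<mu> * D k \<mu>)"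
      using D0 mch0 by (intro member_le_sum) (auto simp: finite_submultisets)
    then show ?thesis using True D0 mch0 by (simp add: A_def Bsum)
  qed (simp add: A_def B0)
  obtain r l where r: "strict_mono r" and l: "\<And>\<mu>. \<mu> \<in> mfin F \<Longrightarrow> (\<lambda>k. A (r k) \<mu>) \<longlonglongrightarrow> l \<mu>"
    using countable_convergent_subsequence[of "mfin F" A B] A countable_mfin[OF countable_finite[OF F]] by blast
  have l0: "0 \<le> l \<mu>" if "\<mu> \<in> mfin F" for \<mu>
    using l[OF that] A by (intro LIMSEQ_le_const) auto
  \<comment> \<open>While all coordinates are below 1, the bound \<open>B * mpow t \<mu>\<close> is
    summable and dominated convergence applies.\<close>
  have strict: "esum (mfin F) (\<lambda>\<mu>. l \<mu> * mpow t \<mu>) = ennreal (G t) \<and> 0 \<le> G t"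
    if t: "\<And>a. 0 \<le> t a \<and> t a < 1" "\<And>a. a \<notin> F \<Longrightarrow> t a = 0" for t
  proof -
    define m where "m k a = nat \<lfloor>2 ^ k * t a\<rfloor>" for k a
    have rm: "real (m k a) = \<lfloor>2 ^ k * t a\<rfloor>" for k a using t by (simp add: m_def)
    have m2: "m k a \<le> 2 ^ k" for k a
    proof -
      have "2 ^ k * t a \<le> 2 ^ k" using t[of a] by (simp add: less_imp_le)
      then have "real (m k a) \<le> 2 ^ k" unfolding rm by linarith
      then show ?thesis by (metis of_nat_le_iff of_nat_numeral of_nat_power)
    qed
    define \<kappa> where "\<kappa> k = (\<Sum>a\<in>F. replicate_mset (m k a) a)" for k
    have \<kappa>: "count (\<kappa> k) a = m k a" for k a
      using F t(2)[of a] by (cases "a \<in> F") (auto simp: \<kappa>_def count_sum m_def)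
    have \<kappa>N: "\<kappa> k \<subseteq># N k" for k
      unfolding subseteq_mset_def \<kappa> N using m2 t(2) by (auto simp: m_def)
    define y where "y k a = real (m k a) / 2 ^ k" for k a
    have ylim: "(\<lambda>k. y k a) \<longlonglongrightarrow> t a" for a
      unfolding y_def rm by (rule dyadic_floor_tendsto)
    have yinc: "y k a \<le> y (Suc k) a" for k a unfolding y_def rm by (rule dyadic_floor_mono)
    have yt: "y k a \<le> t a" for k a
      using yinc ylim by (intro incseq_le[of "\<lambda>k. y k a"]) (auto intro: incseq_SucI)
    have y0: "0 \<le> y k a" for k a by (simp add: y_def)
    have Gy: "(\<lambda>k. G (y k)) \<longlonglongrightarrow> G t"
    proof (rule cont)
      show "0 \<le> y k a \<and> y k a \<le> 1 \<and> y k a \<le> y (Suc k) a" for k a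
        using y0 yinc yt[of k a] t(1)[of a] by simp
      show "y k a = 0" if "a \<notin> F" for k a using t(2)[OF that] by (simp add: y_def m_def)
    qed (rule ylim)
    \<comment> \<open>The term of Newton's formula at the grid point \<open>y k\<close>, written as
      the normalised coefficient times a quotient of binomials that tends to
      \<open>mpow t \<mu>\<close>.\<close>
    define b where "b k \<mu> = A k \<mu> * (mchoose F (\<kappa> k) \<mu> / mchoose F (N k) \<mu>)" for k \<mu>
    have bD: "b k \<mu> = mchoose F (\<kappa> k) \<mu> * D k \<mu>" if "\<mu> \<subseteq># N k" for k \<mu>
    proof -
      have "mchoose F (N k) \<mu> > 0"
        unfolding mchoose_def using mset_subset_eq_count[OF that] by (intro prod_pos) (simp add: zero_less_binomial)
      then show ?thesis using that by (simp add: b_def A_def)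
    qed
    have b0: "0 \<le> b k \<mu>" for k \<mu> using A mch0 by (simp add: b_def)
    have Gb: "esum (mfin F) (b k) = ennreal (G (y k)) \<and> 0 \<le> G (y k)" for k
    proof -
      have "esum (mfin F) (b k) = (\<Sum>\<mu> | \<mu> \<subseteq># N k. ennreal (b k \<mu>))"
        by (rule nn_integral_count_space') (auto simp: finite_submultisets Nm b_def A_def)
      also have "\<dots> = ennreal (\<Sum>\<mu> | \<mu> \<subseteq># N k. b k \<mu>)" by (simp add: b0)
      also have "(\<Sum>\<mu> | \<mu> \<subseteq># N k. b k \<mu>) = (\<Sum>\<mu> | \<mu> \<subseteq># N k. mchoose F (\<kappa> k) \<mu> * D k \<mu>)"
        by (intro sum.cong) (auto simp: bD)
      also have "\<dots> = G (y k)" using grid[OF \<kappa>N[of k]] by (simp add: \<kappa> y_def[abs_def])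
      finally have e: "esum (mfin F) (b k) = ennreal (G (y k))" .
      have "G (y k) = (\<Sum>\<mu> | \<mu> \<subseteq># N k. b k \<mu>)" using grid[OF \<kappa>N[of k]] by (simp add: \<kappa> y_def[abs_def] bD)
      then show ?thesis using e b0 by (simp add: sum_nonneg)
    qed
    have ble: "b k \<mu> \<le> B * mpow t \<mu>" if \<mu>: "\<mu> \<in> mfin F" for k \<mu>
    proof -
      have "mchoose F (\<kappa> k) \<mu> \<le> (\<Prod>a\<in>F. y k a ^ count \<mu> a * real (count (N k) a choose count \<mu> a))"
        unfolding mchoose_def
      proof (rule prod_mono)
        fix a assume "a \<in> F"
        then have "real (m k a choose count \<mu> a) \<le> (real (m k a) / real (2 ^ k)) ^ count \<mu> a * real (2 ^ k choose count \<mu> a)"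
          by (intro choose_le_power_mult m2) simp
        then show "0 \<le> real (count (\<kappa> k) a choose count \<mu> a) \<and>
            real (count (\<kappa> k) a choose count \<mu> a) \<le> y k a ^ count \<mu> a * real (count (N k) a choose count \<mu> a)"
          using \<open>a \<in> F\<close> by (simp add: \<kappa> N y_def)
      qed
      also have "\<dots> = mpow (y k) \<mu> * mchoose F (N k) \<mu>"
        by (simp add: mpow_eq_prod_superset[OF F \<mu>] mchoose_def prod.distrib)
      also have "\<dots> \<le> mpow t \<mu> * mchoose F (N k) \<mu>"
        using mch0 y0 yt by (intro mult_right_mono mpow_mono) auto
      \<comment> \<open>If \<open>\<mu>\<close> is not contained in \<open>N k\<close>, the
        denominator is 0 and so is the quotient.\<close>
      finally have "mchoose F (\<kappa> k) \<mu> / mchoose F (N k) \<mu> \<le> mpow t \<mu>"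
        using mch0[of "N k" \<mu>] mpow_nonneg[of \<mu> t] t(1)
        by (cases "mchoose F (N k) \<mu> = 0") (auto simp: field_simps)
      then show ?thesis
        unfolding b_def using A[of k \<mu>] B0 mch0 by (intro mult_mono) auto
    qed
    have pw: "filterlim (\<lambda>k. 2 ^ k :: nat) at_top sequentially"
      by (rule filterlim_at_top_mono[OF filterlim_ident]) (auto intro: always_eventually less_imp_le[OF less_exp])
    have blim: "(\<lambda>k. b (r k) \<mu>) \<longlonglongrightarrow> l \<mu> * mpow t \<mu>" if \<mu>: "\<mu> \<in> mfin F" for \<mu>
    proof -
      have "(\<lambda>k. \<Prod>a\<in>F. real (m k a choose count \<mu> a) / real (2 ^ k choose count \<mu> a)) \<longlonglongrightarrow> (\<Prod>a\<in>F. t a ^ count \<mu> a)"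
        using ylim unfolding y_def by (intro tendsto_prod choose_ratio_tendsto[OF pw]) simp
      moreover have "mchoose F (\<kappa> k) \<mu> / mchoose F (N k) \<mu> = (\<Prod>a\<in>F. real (m k a choose count \<mu> a) / real (2 ^ k choose count \<mu> a))" for k
        unfolding mchoose_def prod_dividef[symmetric] by (intro prod.cong) (auto simp: \<kappa> N)
      ultimately have "(\<lambda>k. mchoose F (\<kappa> k) \<mu> / mchoose F (N k) \<mu>) \<longlonglongrightarrow> mpow t \<mu>"
        by (simp add: mpow_eq_prod_superset[OF F \<mu>])
      from LIMSEQ_subseq_LIMSEQ[OF this r] show ?thesis
        unfolding b_def by (intro tendsto_mult l[OF \<mu>]) (simp add: o_def)
    qed
    have "(\<lambda>k. esum (mfin F) (b (r k))) \<longlonglongrightarrow> esum (mfin F) (\<lambda>\<mu>. l \<mu> * mpow t \<mu>)"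
    proof (rule nn_integral_dominated_convergence[where w = "\<lambda>\<mu>. ennreal (B * mpow t \<mu>)"])
      have "esum (mfin F) (\<lambda>\<mu>. B * mpow t \<mu>) = ennreal B * esum (mfin F) (mpow t)"
        using t(1) B0 by (intro esum_cmult mpow_nonneg) auto
      then show "esum (mfin F) (\<lambda>\<mu>. B * mpow t \<mu>) < \<infinity>"
        using esum_mpow_finite[OF F, of t] t(1) by (simp add: ennreal_mult_less_top)
    qed (auto simp: AE_count_space intro!: ennreal_leI ble tendsto_ennrealI blim)
    moreover have "(\<lambda>k. esum (mfin F) (b (r k))) \<longlonglongrightarrow> ennreal (G t)"
      using LIMSEQ_subseq_LIMSEQ[OF Gy r] Gb by (simp add: o_def tendsto_ennrealI)
    ultimately have "esum (mfin F) (\<lambda>\<mu>. l \<mu> * mpow t \<mu>) = ennreal (G t)" by (rule LIMSEQ_unique)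
    moreover have "0 \<le> G t" using Gy Gb by (intro LIMSEQ_le_const[OF Gy]) auto
    ultimately show ?thesis by simp
  qed
  have "((\<lambda>\<mu>. l \<mu> * mpow t \<mu>) has_sum G t) (mfin F)"
    if t: "\<forall>a. 0 \<le> t a \<and> t a \<le> 1" "\<forall>a. a \<notin> F \<longrightarrow> t a = 0" for t
  proof -
    \<comment> \<open>Points with a coordinate equal to 1 are approached from inside along
      \<open>q k * t\<close>; the terms increase with \<open>k\<close>, so monotone convergence
      replaces the majorant.\<close>
    define q :: "nat \<Rightarrow> real" where "q k = 1 - 1 / real (Suc k)" for k
    have q: "0 \<le> q k" "q k < 1" "q k \<le> q (Suc k)" for k by (auto simp: q_def field_simps)
    have qlim: "q \<longlonglongrightarrow> 1"
      using tendsto_diff[OF tendsto_const[of 1] LIMSEQ_inverse_real_of_nat] by (simp add: q_def[abs_def] inverse_eq_divide)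
    define y where "y k a = q k * t a" for k a
    have y: "0 \<le> y k a" "y k a < 1" "y k a \<le> y (Suc k) a" for k a
    proof -
      show "0 \<le> y k a" using q(1) t(1) by (simp add: y_def)
      have "q k * t a \<le> q k * 1" using q(1) t(1) by (intro mult_left_mono) auto
      then show "y k a < 1" using q(2)[of k] by (simp add: y_def)
      show "y k a \<le> y (Suc k) a" unfolding y_def using q(3) t(1) by (intro mult_right_mono) auto
    qed
    have yF: "y k a = 0" if "a \<notin> F" for k a using t(2) that by (simp add: y_def)
    have ylim: "(\<lambda>k. y k a) \<longlonglongrightarrow> t a" for a
      using tendsto_mult[OF qlim tendsto_const[of "t a"]] by (simp add: y_def)
    have st: "esum (mfin F) (\<lambda>\<mu>. l \<mu> * mpow (y k) \<mu>) = ennreal (G (y k)) \<and> 0 \<le> G (y k)" for k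
      using y yF by (intro strict) auto
    have Gy: "(\<lambda>k. G (y k)) \<longlonglongrightarrow> G t"
      using y yF ylim by (intro cont) (auto simp: less_imp_le)
    have G0: "0 \<le> G t" using st by (intro LIMSEQ_le_const[OF Gy]) auto
    have "(\<lambda>k. esum (mfin F) (\<lambda>\<mu>. l \<mu> * mpow (y k) \<mu>)) \<longlonglongrightarrow> esum (mfin F) (\<lambda>\<mu>. l \<mu> * mpow t \<mu>)"
    proof (rule esum_monotone_tendsto(1))
      fix \<mu> assume \<mu>: "\<mu> \<in> mfin F"
      show "0 \<le> l \<mu> * mpow (y k) \<mu>" for k using l0[OF \<mu>] y(1) by (intro mult_nonneg_nonneg mpow_nonneg) auto
      show "l \<mu> * mpow (y k) \<mu> \<le> l \<mu> * mpow (y (Suc k)) \<mu>" for k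
        using l0[OF \<mu>] y by (intro mult_left_mono mpow_mono) auto
      show "(\<lambda>k. l \<mu> * mpow (y k) \<mu>) \<longlonglongrightarrow> l \<mu> * mpow t \<mu>"
        by (intro tendsto_mult tendsto_const tendsto_mpow ylim)
    qed
    moreover have "(\<lambda>k. esum (mfin F) (\<lambda>\<mu>. l \<mu> * mpow (y k) \<mu>)) \<longlonglongrightarrow> ennreal (G t)"
      using st Gy by (simp add: tendsto_ennrealI)
    ultimately have "esum (mfin F) (\<lambda>\<mu>. l \<mu> * mpow t \<mu>) = ennreal (G t)" by (rule LIMSEQ_unique)
    then show ?thesis
      using l0 t(1) G0 by (subst has_sum_iff_esum) (auto intro!: mult_nonneg_nonneg mpow_nonneg)
  qed
  then show ?thesis using l0 by (intro exI[of _ l]) blast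
qed

section \<open>Stable functions are power series\<close>

text \<open>Differences in the cube coordinates \<open>t\<close> are differences at
  \<open>t * x\<close> with increments scaled by \<open>x\<close>; nonnegativity is carried over
  from stability in this way.\<close>

lemma iterdiff_rescale:
  "iterdiff us (\<lambda>t. g (\<lambda>a. t a * x a)) z = iterdiff (map (\<lambda>u a. u a * x a) us) g (\<lambda>a. z a * x a)"
proof (induction us arbitrary: g)
  case (Cons u us)
  have "diff u (\<lambda>t. g (\<lambda>a. t a * x a)) = (\<lambda>t. diff (\<lambda>a. u a * x a) g (\<lambda>a. t a * x a))"
    by (simp add: diff_def shift_def fun_eq_iff distrib_right)
  then show ?case using Cons[of "diff (\<lambda>a. u a * x a) g"] by simp
qed simp

lemma sum_list_steps:
  "(\<Sum>a\<leftarrow>as. (if c = a then d else 0) * e) = real (count (mset as) c) * (d * (e::real))"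
  by (induction as) (auto simp: algebra_simps)

context
  fixes X :: "'a pcs" and Y :: "'b pcs" and \<phi> :: "('a \<Rightarrow> real) \<Rightarrow> 'b \<Rightarrow> real"
  assumes X: "is_pcs X" and Y: "is_pcs Y" and \<phi>: "stable (Fm X) (Fm Y) \<phi>"
begin

lemma stable_elem: "x \<in> cliques X \<Longrightarrow> \<phi> x \<in> elems (Fm Y)"
  using \<phi> by (auto simp: stable_def unit_ball_Fm[OF X])

lemma stable_iterdiff_nonneg:
  assumes x: "x \<in> elems (Fm X)" and us: "\<And>u. u \<in> set us \<Longrightarrow> u \<in> elems (Fm X)"
    and c: "(\<lambda>a. x a + (\<Sum>u\<leftarrow>us. u a)) \<in> cliques X"
  shows "0 \<le> iterdiff us (\<lambda>x. \<phi> x b) x"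
proof -
  \<comment> \<open>\<open>pre_stable\<close> numbers its increments from 1, while list positions
    start at 0.\<close>
  define u where "u i = us ! (i - 1)" for i
  have us_eq: "map u [1..<Suc (length us)] = us"
    by (rule nth_equalityI) (auto simp: u_def nth_upt simp del: upt_Suc)
  have "(\<Sum>i\<in>{1..length us}. u i a) = (\<Sum>u\<leftarrow>us. u a)" for a
  proof -
    have "(\<Sum>u\<leftarrow>us. u a) = (\<Sum>i\<leftarrow>[1..<Suc (length us)]. u i a)"
      by (subst us_eq[symmetric]) (simp add: o_def del: upt_Suc)
    also have "\<dots> = (\<Sum>i\<in>{1..length us}. u i a)"
      by (subst interv_sum_list_conv_sum_set_nat) (simp add: atLeastLessThanSuc_atLeastAtMost del: upt_Suc)
    finally show ?thesis by simp
  qed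
  then have "(\<lambda>a. x a + (\<Sum>i\<in>{1..length us}. u i a)) \<in> cliques X" using c by simp
  moreover have "\<forall>i\<in>{1..length us}. u i \<in> elems (Fm X)" using us by (auto simp: u_def)
  moreover have ps: "pre_stable (Fm X) (Fm Y) \<phi>" using \<phi> by (simp add: stable_def)
  ultimately have "0 \<le> iterdiff (map u [1..<Suc (length us)]) (\<lambda>x. \<phi> x b) x"
    using x by (intro iffD1[OF pre_stable_Fm_iff[OF X Y] ps, rule_format] stable_elem) blast+
  then show ?thesis by (simp only: us_eq)
qed

text \<open>Pre-stability with the single increment \<open>y - x\<close>.\<close>

lemma stable_mono:
  assumes x: "x \<in> cliques X" and y: "y \<in> cliques X" and le: "\<And>a. x a \<le> y a"
  shows "\<phi> x b \<le> \<phi> y b"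
proof -
  define u where "u a = y a - x a" for a
  have u: "u \<in> elems (Fm X)"
    using le clique_nonneg[OF X x] clique_outside[OF X x] clique_outside[OF X y]
    by (intro Fm_elem_down(1)[OF X clique_elem[OF X y]]) (auto simp: nnvecs_def u_def)
  have "0 \<le> iterdiff [u] (\<lambda>x. \<phi> x b) x"
    using u y by (intro stable_iterdiff_nonneg clique_elem[OF X x]) (auto simp: u_def)
  then show ?thesis by (simp add: diff_def shift_def u_def)
qed

lemma stable_tendsto:
  assumes x: "\<And>k. x k \<in> cliques X" and inc: "\<And>k a. x k a \<le> x (Suc k) a"
    and lim: "\<And>a. (\<lambda>k. x k a) \<longlonglongrightarrow> s a"
  shows "(\<lambda>k. \<phi> (x k) b) \<longlonglongrightarrow> \<phi> s b"
proof -
  have nd: "nondecreasing (Fm X) x"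
    using clique_elem[OF X x] inc by (simp add: nondecreasing_Fm_iff[OF X])
  have s: "s \<in> cliques X" by (rule clique_tendsto[OF X x inc lim])
  have "is_seq_lub (Fm X) x s"
    using clique_elem[OF X s] lim by (simp add: is_seq_lub_Fm_iff[OF X nd])
  moreover have "range x \<subseteq> unit_ball (Fm X)" using x by (auto simp: unit_ball_Fm[OF X])
  ultimately have "is_seq_lub (Fm Y) (\<lambda>k. \<phi> (x k)) (\<phi> s)" using \<phi> nd unfolding stable_def by blast
  moreover have "nondecreasing (Fm Y) (\<lambda>k. \<phi> (x k))"
    using stable_elem[OF x] stable_mono[OF x x inc] by (simp add: nondecreasing_Fm_iff[OF Y])
  ultimately show ?thesis by (simp add: is_seq_lub_Fm_iff[OF Y])
qed

text \<open>The cube theorem applied to one output coordinate of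
  \<open>t \<mapsto> \<phi> (t * x)\<close>.\<close>

lemma stable_box:
  assumes x: "x \<in> cliques X" and F: "finite F" "\<And>a. a \<notin> F \<Longrightarrow> x a = 0"
  shows "\<exists>A. (\<forall>\<mu>\<in>mfin F. 0 \<le> A \<mu>) \<and> (\<forall>t. (\<forall>a. 0 \<le> t a \<and> t a \<le> 1) \<longrightarrow>
     ((\<lambda>\<mu>. A \<mu> * mpow t \<mu>) has_sum \<phi> (\<lambda>a. t a * x a) b) (mfin F))"
proof -
  have x0: "0 \<le> x a" for a by (rule clique_nonneg[OF X x])
  have "\<exists>A. (\<forall>\<mu>\<in>mfin F. 0 \<le> A \<mu>) \<and>
     (\<forall>t. (\<forall>a. 0 \<le> t a \<and> t a \<le> 1) \<and> (\<forall>a. a \<notin> F \<longrightarrow> t a = 0) \<longrightarrow>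
        ((\<lambda>\<mu>. A \<mu> * mpow t \<mu>) has_sum \<phi> (\<lambda>a. t a * x a) b) (mfin F))"
  proof (rule absolutely_monotone_cube[OF F(1), where G = "\<lambda>t. \<phi> (\<lambda>a. t a * x a) b"])
    fix n :: nat and as
    assume n: "0 < n" and as: "set as \<subseteq> F" and cnt: "\<And>a. count (mset as) a \<le> n"
    let ?us = "map (\<lambda>a c. (if c = a then 1 / real n else 0) * x c) as"
    have "0 \<le> iterdiff ?us (\<lambda>x. \<phi> x b) (\<lambda>a. 0)"
    proof (rule stable_iterdiff_nonneg[OF Fm_zero(1)[OF X]])
      fix u assume "u \<in> set ?us"
      then obtain a where u: "u = (\<lambda>c. (if c = a then 1 / real n else 0) * x c)" by auto
      have "(\<lambda>c. (if c = a then 1 / real n else 0) * x c) \<in> cliques X"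
        using n by (intro clique_box[OF X x]) auto
      then show "u \<in> elems (Fm X)" unfolding u by (rule clique_elem[OF X])
    next
      \<comment> \<open>All steps together lead to a point below \<open>x\<close>, since no
        direction is used more than \<open>n\<close> times.\<close>
      have "(\<lambda>c. real (count (mset as) c) / real n * x c) \<in> cliques X"
        using n cnt by (intro clique_box[OF X x]) auto
      moreover have "(\<Sum>u\<leftarrow>?us. u c) = real (count (mset as) c) / real n * x c" for c
        using sum_list_steps[where as = as and c = c and d = "1 / real n" and e = "x c"] by (simp add: o_def)
      ultimately show "(\<lambda>c. 0 + (\<Sum>u\<leftarrow>?us. u c)) \<in> cliques X" by simp
    qed
    then show "0 \<le> iterdiff (map (\<lambda>a b. if b = a then 1 / real n else 0) as) (\<lambda>t. \<phi> (\<lambda>a. t a * x a) b) (\<lambda>_. 0)"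
      by (simp add: iterdiff_rescale[where g = "\<lambda>x. \<phi> x b"] o_def)
  next
    fix y :: "nat \<Rightarrow> 'a \<Rightarrow> real" and z
    assume y: "\<And>k a. 0 \<le> y k a \<and> y k a \<le> 1 \<and> y k a \<le> y (Suc k) a"
      and lim: "\<And>a. (\<lambda>k. y k a) \<longlonglongrightarrow> z a"
    show "(\<lambda>k. \<phi> (\<lambda>a. y k a * x a) b) \<longlonglongrightarrow> \<phi> (\<lambda>a. z a * x a) b"
    proof (rule stable_tendsto)
      show "(\<lambda>a. y k a * x a) \<in> cliques X" for k using y by (intro clique_box[OF X x]) auto
      show "y k a * x a \<le> y (Suc k) a * x a" for k a using y x0 by (intro mult_right_mono) auto
      show "(\<lambda>k. y k a * x a) \<longlonglongrightarrow> z a * x a" for a by (intro tendsto_mult lim tendsto_const)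
    qed
  qed
  then obtain A where A0: "\<forall>\<mu>\<in>mfin F. 0 \<le> A \<mu>" and A: "\<And>t. (\<forall>a. 0 \<le> t a \<and> t a \<le> 1) \<Longrightarrow> (\<forall>a. a \<notin> F \<longrightarrow> t a = 0) \<Longrightarrow>
        ((\<lambda>\<mu>. A \<mu> * mpow t \<mu>) has_sum \<phi> (\<lambda>a. t a * x a) b) (mfin F)" by blast
  have "((\<lambda>\<mu>. A \<mu> * mpow t \<mu>) has_sum \<phi> (\<lambda>a. t a * x a) b) (mfin F)" if t: "\<forall>a. 0 \<le> t a \<and> t a \<le> 1" for t
  proof -
    \<comment> \<open>Cutting \<open>t\<close> to 0 outside \<open>F\<close> leaves
      \<open>t * x\<close> unchanged, as \<open>x\<close> vanishes there.\<close>
    let ?t = "\<lambda>a. if a \<in> F then t a else 0"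
    have "((\<lambda>\<mu>. A \<mu> * mpow ?t \<mu>) has_sum \<phi> (\<lambda>a. ?t a * x a) b) (mfin F)" using t by (intro A) auto
    moreover have "(\<lambda>a. ?t a * x a) = (\<lambda>a. t a * x a)" using F(2) by (auto simp: fun_eq_iff)
    moreover have "mpow ?t \<mu> = mpow t \<mu>" if "\<mu> \<in> mfin F" for \<mu>
      using that by (intro mpow_cong) (auto simp: mfin_def)
    ultimately show ?thesis using has_sum_cong[of "mfin F" "\<lambda>\<mu>. A \<mu> * mpow ?t \<mu>" "\<lambda>\<mu>. A \<mu> * mpow t \<mu>"] by simp
  qed
  then show ?thesis using A0 by blast
qed

text \<open>Shrinking two boxes to their common part identifies their coefficients.\<close>

lemma stable_box_unique:
  assumes x: "x \<in> cliques X" "finite F" "\<And>a. a \<notin> F \<Longrightarrow> x a = 0" "\<And>a. a \<in># \<mu> \<Longrightarrow> 0 < x a" "\<mu> \<in> mfin F"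
    and x': "x' \<in> cliques X" "finite F'" "\<And>a. a \<notin> F' \<Longrightarrow> x' a = 0" "\<And>a. a \<in># \<mu> \<Longrightarrow> 0 < x' a" "\<mu> \<in> mfin F'"
    and A: "\<And>\<nu>. \<nu> \<in> mfin F \<Longrightarrow> 0 \<le> A \<nu>"
      "\<And>t. (\<And>a. 0 \<le> t a \<and> t a \<le> 1) \<Longrightarrow> ((\<lambda>\<nu>. A \<nu> * mpow t \<nu>) has_sum \<phi> (\<lambda>a. t a * x a) b) (mfin F)"
    and A': "\<And>\<nu>. \<nu> \<in> mfin F' \<Longrightarrow> 0 \<le> A' \<nu>"
      "\<And>t. (\<And>a. 0 \<le> t a \<and> t a \<le> 1) \<Longrightarrow> ((\<lambda>\<nu>. A' \<nu> * mpow t \<nu>) has_sum \<phi> (\<lambda>a. t a * x' a) b) (mfin F')"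
  shows "A \<mu> / mpow x \<mu> = A' \<mu> / mpow x' \<mu>"
proof -
  \<comment> \<open>The common part of the two boxes, kept only in the directions of
    \<open>\<mu>\<close>.\<close>
  define y where "y a = (if a \<in># \<mu> then min (x a) (x' a) else 0)" for a
  \<comment> \<open>Passing from the box of \<open>x\<close> to that of \<open>y\<close> rescales
    the variables by \<open>s = y / x\<close>, hence multiplies the coefficient at
    \<open>\<nu>\<close> by \<open>mpow s \<nu>\<close>; this vanishes unless \<open>\<nu>\<close>
    uses only variables of \<open>\<mu>\<close>.\<close>
  have restr: "((\<lambda>\<nu>. A \<nu> * mpow s \<nu> * mpow t \<nu>) has_sum \<phi> (\<lambda>a. t a * y a) b) (mfin (set_mset \<mu>))
      \<and> mpow s \<mu> * mpow x \<mu> = mpow y \<mu> \<and> (\<forall>\<nu>\<in>mfin (set_mset \<mu>). 0 \<le> A \<nu> * mpow s \<nu>)"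
    if x: "x \<in> cliques X" "\<And>a. a \<in># \<mu> \<Longrightarrow> 0 < x a" "\<mu> \<in> mfin F" and yx: "\<And>a. a \<in># \<mu> \<Longrightarrow> 0 < y a \<and> y a \<le> x a"
      and A: "\<And>\<nu>. \<nu> \<in> mfin F \<Longrightarrow> 0 \<le> A \<nu>"
        "\<And>t. (\<And>a. 0 \<le> t a \<and> t a \<le> 1) \<Longrightarrow> ((\<lambda>\<nu>. A \<nu> * mpow t \<nu>) has_sum \<phi> (\<lambda>a. t a * x a) b) (mfin F)"
      and s: "s = (\<lambda>a. y a / x a)" and t: "\<And>a. 0 \<le> t a \<and> t a \<le> 1" for x F A s t
  proof (intro conjI ballI)
    have y0: "y a = 0" if "a \<notin># \<mu>" for a using that by (simp add: y_def)
    have s1: "0 \<le> s a \<and> s a \<le> 1" for a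
      using yx[of a] x(2)[of a] y0[of a] by (cases "a \<in># \<mu>") (auto simp: s)
    have sx: "s a * x a = y a" for a
      using x(2)[of a] y0[of a] by (cases "a \<in># \<mu>") (auto simp: s)
    have sub: "mfin (set_mset \<mu>) \<subseteq> mfin F" using x(3) by (auto simp: mfin_def)
    have "((\<lambda>\<nu>. A \<nu> * mpow (\<lambda>a. t a * s a) \<nu>) has_sum \<phi> (\<lambda>a. t a * s a * x a) b) (mfin F)"
      using s1 t by (intro A(2)) (auto intro: mult_le_one)
    then have h: "((\<lambda>\<nu>. A \<nu> * mpow (\<lambda>a. t a * s a) \<nu>) has_sum \<phi> (\<lambda>a. t a * y a) b) (mfin F)"
      by (simp add: mult.assoc sx)
    have m0: "mpow s \<nu> = 0" if \<nu>: "\<nu> \<notin> mfin (set_mset \<mu>)" for \<nu>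
    proof -
      obtain a where a: "a \<in># \<nu>" "a \<notin># \<mu>" using \<nu> by (auto simp: mfin_def)
      then have "s a = 0" using y0 by (simp add: s)
      then show ?thesis unfolding mpow_def using a by (intro prod_zero) (auto intro!: bexI[of _ a])
    qed
    have "((\<lambda>\<nu>. A \<nu> * mpow s \<nu> * mpow t \<nu>) has_sum z) (mfin (set_mset \<mu>)) \<longleftrightarrow>
        ((\<lambda>\<nu>. A \<nu> * mpow (\<lambda>a. t a * s a) \<nu>) has_sum z) (mfin F)" for z
      by (rule has_sum_cong_neutral) (use sub in \<open>auto simp: mpow_mult m0\<close>)
    then show "((\<lambda>\<nu>. A \<nu> * mpow s \<nu> * mpow t \<nu>) has_sum \<phi> (\<lambda>a. t a * y a) b) (mfin (set_mset \<mu>))" using h by simp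
    show "mpow s \<mu> * mpow x \<mu> = mpow y \<mu>" unfolding mpow_mult[symmetric] sx ..
    show "0 \<le> A \<nu> * mpow s \<nu>" if "\<nu> \<in> mfin (set_mset \<mu>)" for \<nu>
      using A(1) sub that s1 by (intro mult_nonneg_nonneg mpow_nonneg) auto
  qed
  have yx: "0 < y a \<and> y a \<le> x a" "0 < y a \<and> y a \<le> x' a" if "a \<in># \<mu>" for a
    using that x(4) x'(4) by (auto simp: y_def)
  note r = restr[OF x(1,4,5) yx(1) A refl] and r' = restr[OF x'(1,4,5) yx(2) A' refl]
  let ?s = "\<lambda>a. y a / x a" and ?s' = "\<lambda>a. y a / x' a"
  have eq: "A \<mu> * mpow ?s \<mu> = A' \<mu> * mpow ?s' \<mu>"
  proof (rule coefficient_unique[of "set_mset \<mu>", where c = "\<lambda>\<nu>. A \<nu> * mpow ?s \<nu>" and d = "\<lambda>\<nu>. A' \<nu> * mpow ?s' \<nu>"])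
    show "((\<lambda>\<nu>. A \<nu> * mpow ?s \<nu> * mpow t \<nu>) has_sum \<phi> (\<lambda>a. t a * y a) b) (mfin (set_mset \<mu>))"
      "((\<lambda>\<nu>. A' \<nu> * mpow ?s' \<nu> * mpow t \<nu>) has_sum \<phi> (\<lambda>a. t a * y a) b) (mfin (set_mset \<mu>))"
      if "\<And>a. 0 \<le> t a \<and> t a \<le> 1" for t using r[of t] r'[of t] that by auto
    show "0 \<le> A \<nu> * mpow ?s \<nu>" "0 \<le> A' \<nu> * mpow ?s' \<nu>" if "\<nu> \<in> mfin (set_mset \<mu>)" for \<nu>
      using r[of "\<lambda>_. 0"] r'[of "\<lambda>_. 0"] that by auto
  qed (auto simp: mfin_def)
  have m: "mpow ?s \<mu> * mpow x \<mu> = mpow y \<mu>" "mpow ?s' \<mu> * mpow x' \<mu> = mpow y \<mu>"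
    using r[of "\<lambda>_. 0"] r'[of "\<lambda>_. 0"] by auto
  have pos: "0 < mpow x \<mu>" "0 < mpow x' \<mu>" "0 < mpow y \<mu>"
    using x(4) x'(4) yx by (auto simp: mpow_def intro!: prod_pos)
  have "mpow ?s \<mu> = mpow y \<mu> / mpow x \<mu>" "mpow ?s' \<mu> = mpow y \<mu> / mpow x' \<mu>" using m pos by (auto simp: field_simps)
  then have "A \<mu> / mpow x \<mu> * mpow y \<mu> = A' \<mu> / mpow x' \<mu> * mpow y \<mu>" using eq by simp
  then show ?thesis using pos(3) by (simp only: mult_right_cancel[OF less_imp_neq[OF pos(3), symmetric]])
qed

text \<open>The coefficient at \<open>\<mu>\<close> is taken from one fixed box with positive sides
  exactly along \<open>\<mu>\<close>. Box uniqueness makes it valid for every clique of finite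
  support, and truncations of the argument carry the formula to all cliques.\<close>

lemma stable_coordinate_power_series:
  "\<exists>c. (\<forall>\<mu>\<in>mfin (web X). 0 \<le> c \<mu>) \<and>
     (\<forall>x\<in>cliques X. ((\<lambda>\<mu>. c \<mu> * mpow x \<mu>) has_sum \<phi> x b) (mfin (web X)))"
proof -
  define P where "P x F A \<longleftrightarrow> (\<forall>\<mu>\<in>mfin F. 0 \<le> A \<mu>) \<and> (\<forall>t. (\<forall>a. 0 \<le> t a \<and> t a \<le> 1) \<longrightarrow>
     ((\<lambda>\<mu>. A \<mu> * mpow t \<mu>) has_sum \<phi> (\<lambda>a. t a * x a) b) (mfin F))" for x F A
  have PD: "P x F A \<Longrightarrow> \<mu> \<in> mfin F \<Longrightarrow> 0 \<le> A \<mu>"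
    "P x F A \<Longrightarrow> (\<And>a. 0 \<le> t a \<and> t a \<le> 1) \<Longrightarrow> ((\<lambda>\<mu>. A \<mu> * mpow t \<mu>) has_sum \<phi> (\<lambda>a. t a * x a) b) (mfin F)"
    for x F A \<mu> t unfolding P_def by blast+
  have ex: "\<exists>A. P x F A" if "x \<in> cliques X" "finite F" "\<And>a. a \<notin> F \<Longrightarrow> x a = 0" for x F
    using stable_box[OF that] unfolding P_def by blast
  have "\<exists>x. x \<in> cliques X \<and> (\<forall>a\<in>set_mset \<mu>. 0 < x a) \<and> (\<forall>a. a \<notin># \<mu> \<longrightarrow> x a = 0)" if "\<mu> \<in> mfin (web X)" for \<mu>
    using clique_positive[OF X, of "set_mset \<mu>"] that by (auto simp: mfin_def)
  then obtain w where w: "\<And>\<mu>. \<mu> \<in> mfin (web X) \<Longrightarrow> w \<mu> \<in> cliques X"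
    "\<And>\<mu> a. \<mu> \<in> mfin (web X) \<Longrightarrow> a \<in># \<mu> \<Longrightarrow> 0 < w \<mu> a"
    "\<And>\<mu> a. \<mu> \<in> mfin (web X) \<Longrightarrow> a \<notin># \<mu> \<Longrightarrow> w \<mu> a = 0" by metis
  have "\<exists>A. P (w \<mu>) (set_mset \<mu>) A" if "\<mu> \<in> mfin (web X)" for \<mu>
    using w[OF that] by (intro ex) auto
  then obtain V where V: "\<And>\<mu>. \<mu> \<in> mfin (web X) \<Longrightarrow> P (w \<mu>) (set_mset \<mu>) (V \<mu>)" by metis
  \<comment> \<open>Dividing by \<open>mpow (w \<mu>) \<mu>\<close> undoes the scaling from the box
    to the cube.\<close>
  define c where "c \<mu> = V \<mu> \<mu> / mpow (w \<mu>) \<mu>" for \<mu>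
  have c0: "0 \<le> c \<mu>" if "\<mu> \<in> mfin (web X)" for \<mu>
  proof -
    have "0 \<le> V \<mu> \<mu>" by (rule PD(1)[OF V[OF that]]) (simp add: mfin_def)
    then show ?thesis using mpow_clique_nonneg[OF X w(1)[OF that]] by (simp add: c_def)
  qed
  have fin: "((\<lambda>\<mu>. c \<mu> * mpow x \<mu>) has_sum \<phi> x b) (mfin (web X))"
    if x: "x \<in> cliques X" "finite {a. x a \<noteq> 0}" for x
  proof -
    let ?F = "{a. x a \<noteq> 0}"
    have Fw: "?F \<subseteq> web X" using clique_outside[OF X x(1)] by auto
    obtain A where A: "P x ?F A" using ex[OF x] by auto
    have Ac: "A \<mu> = c \<mu> * mpow x \<mu>" if \<mu>: "\<mu> \<in> mfin ?F" for \<mu>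
    proof -
      have \<mu>X: "\<mu> \<in> mfin (web X)" using \<mu> Fw by (auto simp: mfin_def)
      have xpos: "0 < x a" if "a \<in># \<mu>" for a
        using \<mu> that clique_nonneg[OF X x(1), of a] by (auto simp: mfin_def less_le)
      have "A \<mu> / mpow x \<mu> = V \<mu> \<mu> / mpow (w \<mu>) \<mu>"
        by (rule stable_box_unique[OF x _ xpos \<mu> w(1)[OF \<mu>X] _ w(3)[OF \<mu>X] w(2)[OF \<mu>X] _ PD(1)[OF A] PD(2)[OF A] PD(1)[OF V[OF \<mu>X]] PD(2)[OF V[OF \<mu>X]]])
          (auto simp: mfin_def)
      moreover have "0 < mpow x \<mu>" using xpos by (auto simp: mpow_def intro!: prod_pos)
      ultimately show ?thesis by (simp add: c_def field_simps)
    qed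
    \<comment> \<open>The corner \<open>t = 1\<close> of the cube corresponds to \<open>x\<close>
      itself.\<close>
    have "((\<lambda>\<mu>. A \<mu> * mpow (\<lambda>_. 1) \<mu>) has_sum \<phi> (\<lambda>a. 1 * x a) b) (mfin ?F)"
      by (rule PD(2)[OF A]) simp
    then have "(A has_sum \<phi> x b) (mfin ?F)" by (simp add: mpow_def)
    moreover have "mpow x \<mu> = 0" if \<mu>: "\<mu> \<notin> mfin ?F" for \<mu>
    proof -
      obtain a where "a \<in># \<mu>" "x a = 0" using \<mu> by (auto simp: mfin_def)
      then show ?thesis unfolding mpow_def by (intro prod_zero) (auto intro!: bexI[of _ a])
    qed
    moreover from this have "((\<lambda>\<mu>. c \<mu> * mpow x \<mu>) has_sum z) (mfin (web X)) \<longleftrightarrow> (A has_sum z) (mfin ?F)" for z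
      by (intro has_sum_cong_neutral) (use Fw in \<open>auto simp: Ac mfin_def\<close>)
    ultimately show ?thesis by simp
  qed
  have "((\<lambda>\<mu>. c \<mu> * mpow x \<mu>) has_sum \<phi> x b) (mfin (web X))" if x: "x \<in> cliques X" for x
  proof -
    \<comment> \<open>An enumeration of the countable web has finite initial segments; restricting
      \<open>x\<close> to them gives cliques increasing to \<open>x\<close>.\<close>
    define F where "F n = {a \<in> web X. to_nat_on (web X) a < n}" for n
    have finF: "finite (F n)" for n
    proof (rule finite_imageD)
      show "finite (to_nat_on (web X) ` F n)" by (rule finite_subset[of _ "{..<n}"]) (auto simp: F_def)
      show "inj_on (to_nat_on (web X)) (F n)"
        using inj_on_to_nat_on[OF countable_web[OF X]] by (rule inj_on_subset) (auto simp: F_def)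
    qed
    define y where "y n a = (if a \<in> F n then 1 else 0) * x a" for n a
    have yc: "y n \<in> cliques X" for n unfolding y_def by (intro clique_box[OF X x]) auto
    have yinc: "y n a \<le> y (Suc n) a" for n a using clique_nonneg[OF X x] by (auto simp: y_def F_def)
    have ylim: "(\<lambda>n. y n a) \<longlonglongrightarrow> x a" for a
    proof (rule tendsto_eventually)
      show "\<forall>\<^sub>F n in sequentially. y n a = x a"
        using eventually_gt_at_top[of "to_nat_on (web X) a"]
        by eventually_elim (use clique_outside[OF X x] in \<open>auto simp: y_def F_def\<close>)
    qed
    have yfin: "finite {a. y n a \<noteq> 0}" for n
      by (rule finite_subset[OF _ finF[of n]]) (auto simp: y_def)
    have p0: "0 \<le> \<phi> z b" if "z \<in> cliques X" for z using Fm_elem_nonneg[OF Y stable_elem[OF that]] .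
    have t0: "0 \<le> c \<mu> * mpow z \<mu>" if "z \<in> cliques X" "\<mu> \<in> mfin (web X)" for z \<mu>
      using c0[OF that(2)] mpow_clique_nonneg[OF X that(1)] by simp
    have "esum (mfin (web X)) (\<lambda>\<mu>. c \<mu> * mpow (y n) \<mu>) = ennreal (\<phi> (y n) b)" for n
      using fin[OF yc yfin] t0[OF yc] p0[OF yc] by (subst (asm) has_sum_iff_esum) auto
    moreover have "(\<lambda>n. ennreal (\<phi> (y n) b)) \<longlonglongrightarrow> ennreal (\<phi> x b)"
      by (intro tendsto_ennrealI stable_tendsto yc yinc ylim)
    moreover have "(\<lambda>n. esum (mfin (web X)) (\<lambda>\<mu>. c \<mu> * mpow (y n) \<mu>)) \<longlonglongrightarrow> esum (mfin (web X)) (\<lambda>\<mu>. c \<mu> * mpow x \<mu>)"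
    proof (rule esum_monotone_tendsto(1))
      fix \<mu> assume \<mu>: "\<mu> \<in> mfin (web X)"
      show "0 \<le> c \<mu> * mpow (y n) \<mu>" for n by (rule t0[OF yc \<mu>])
      show "c \<mu> * mpow (y n) \<mu> \<le> c \<mu> * mpow (y (Suc n)) \<mu>" for n
        using c0[OF \<mu>] yinc clique_nonneg[OF X yc] by (intro mult_left_mono mpow_mono) auto
      show "(\<lambda>n. c \<mu> * mpow (y n) \<mu>) \<longlonglongrightarrow> c \<mu> * mpow x \<mu>" by (intro tendsto_mult tendsto_const tendsto_mpow ylim)
    qed
    ultimately have "esum (mfin (web X)) (\<lambda>\<mu>. c \<mu> * mpow x \<mu>) = ennreal (\<phi> x b)"
      using LIMSEQ_unique by fastforce
    then show ?thesis using t0[OF x] p0[OF x] by (subst has_sum_iff_esum) auto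
  qed
  then show ?thesis using c0 by blast
qed

text \<open>The coordinate series are assembled into a matrix; boundedness of \<open>\<phi>\<close>
  puts a positive multiple of it among the morphisms.\<close>

lemma stable_power_series:
  shows "\<exists>f\<in>elems (Fm (pcs_exp X Y)). Fm_map X f = \<phi>"
    and "(\<And>x. x \<in> cliques X \<Longrightarrow> \<phi> x \<in> cliques Y) \<Longrightarrow> \<exists>f\<in>pcoh_hom X Y. Fm_map X f = \<phi>"
proof -
  obtain c where c0: "\<And>b \<mu>. \<mu> \<in> mfin (web X) \<Longrightarrow> 0 \<le> c b \<mu>"
    and c: "\<And>b x. x \<in> cliques X \<Longrightarrow> ((\<lambda>\<mu>. c b \<mu> * mpow x \<mu>) has_sum \<phi> x b) (mfin (web X))"
    using stable_coordinate_power_series by metis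
  define f where "f = (\<lambda>(\<mu>, b). if \<mu> \<in> mfin (web X) \<and> b \<in> web Y then c b \<mu> else 0)"
  have hs: "((\<lambda>\<mu>. f (\<mu>, b) * mpow x \<mu>) has_sum \<phi> x b) (mfin (web X))" if x: "x \<in> cliques X" for x b
  proof (cases "b \<in> web Y")
    case True
    then have "((\<lambda>\<mu>. f (\<mu>, b) * mpow x \<mu>) has_sum \<phi> x b) (mfin (web X)) \<longleftrightarrow> ((\<lambda>\<mu>. c b \<mu> * mpow x \<mu>) has_sum \<phi> x b) (mfin (web X))"
      by (intro has_sum_cong) (simp add: f_def)
    then show ?thesis using c[OF x] by simp
  next
    case False
    then show ?thesis using Fm_elem_outside[OF Y stable_elem[OF x] False] by (simp add: f_def)
  qed
  then have hat: "hat X f x = \<phi> x" if "x \<in> cliques X" for x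
    using that by (auto simp: hat_def fun_eq_iff intro!: infsumI)
  have fn: "f \<in> nnvecs (mfin (web X) \<times> web Y)" using c0 by (auto simp: nnvecs_def f_def)
  have Fm: "Fm_map X f = \<phi>"
  proof
    fix x
    show "Fm_map X f x = \<phi> x"
    proof (cases "x \<in> cliques X")
      case False
      then show ?thesis using \<phi> by (auto simp: Fm_map_def unit_ball_Fm[OF X] stable_def PiE_def extensional_def)
    qed (simp add: Fm_map_def unit_ball_Fm[OF X] hat)
  qed
  obtain B where B: "\<And>x. x \<in> cliques X \<Longrightarrow> cnorm (Fm Y) (\<phi> x) \<le> B"
    using \<phi> unfolding stable_def unit_ball_Fm[OF X] by blast
  define K where "K = max B 1"
  have K: "K > 0" "\<And>x. x \<in> cliques X \<Longrightarrow> cnorm (Fm Y) (\<phi> x) \<le> K"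
    using B by (auto simp: K_def intro: max.coboundedI1)
  \<comment> \<open>Used twice: with \<open>d = K\<close> for a bounded \<open>\<phi>\<close>, and
    with \<open>d = 1\<close> when \<open>\<phi>\<close> maps cliques to cliques.\<close>
  have hom: "(\<lambda>p. f p / d) \<in> pcoh_hom X Y" if d: "d > 0" "\<And>x. x \<in> cliques X \<Longrightarrow> (\<lambda>b. \<phi> x b / d) \<in> cliques Y" for d
    unfolding pcoh_hom_def
  proof (intro CollectI conjI ballI)
    show "(\<lambda>p. f p / d) \<in> nnvecs (mfin (web X) \<times> web Y)" using fn d(1) by (auto simp: nnvecs_def)
    fix x assume x: "x \<in> cliques X"
    have h: "((\<lambda>\<mu>. f (\<mu>, b) / d * mpow x \<mu>) has_sum \<phi> x b / d) (mfin (web X))" for b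
      using has_sum_cmult_right[OF hs[OF x, of b], of "1 / d"] by simp
    then show "(\<lambda>\<mu>. f (\<mu>, b) / d * mpow x \<mu>) summable_on mfin (web X)" for b by (rule has_sum_imp_summable)
    have "hat X (\<lambda>p. f p / d) x = (\<lambda>b. \<phi> x b / d)" using h by (auto simp: hat_def fun_eq_iff intro!: infsumI)
    then show "hat X (\<lambda>p. f p / d) x \<in> cliques Y" using d(2)[OF x] by simp
  qed
  have "(\<lambda>p. f p / K) \<in> pcoh_hom X Y"
    using K Fm_norm_le_iff[OF Y stable_elem K(1)] by (intro hom) auto
  then show "\<exists>f\<in>elems (Fm (pcs_exp X Y)). Fm_map X f = \<phi>"
    using Fm K(1) by (intro bexI[of _ f]) (auto simp: exp_elem_iff[OF X Y])
  assume "\<And>x. x \<in> cliques X \<Longrightarrow> \<phi> x \<in> cliques Y"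
  then show "\<exists>f\<in>pcoh_hom X Y. Fm_map X f = \<phi>"
    using hom[of 1] Fm by (intro bexI[of _ f]) auto
qed

end

section \<open>Composition\<close>

definition mlists :: "'a set \<Rightarrow> nat \<Rightarrow> 'a multiset list set" where
  "mlists A n = {ms. length ms = n \<and> set ms \<subseteq> mfin A}"

lemma bij_betw_mlists_Suc: "bij_betw (\<lambda>(m, ms). m # ms) (mfin A \<times> mlists A n) (mlists A (Suc n))"
  by (rule bij_betw_byWitness[where f' = "\<lambda>ms. (hd ms, tl ms)"])
    (auto simp: mlists_def length_Suc_conv)

lemma mem_le_sum_list: "m \<in> set ms \<Longrightarrow> m \<subseteq># sum_list ms"
  by (induction ms) (auto intro: subset_mset.order_trans)

lemma finite_lists_sum_list: "finite {ms. length ms = n \<and> sum_list ms = (\<mu>::'a multiset)}"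
proof (rule finite_subset)
  show "{ms. length ms = n \<and> sum_list ms = \<mu>} \<subseteq> {ms. set ms \<subseteq> {m. m \<subseteq># \<mu>} \<and> length ms = n}"
    using mem_le_sum_list by auto
qed (simp add: finite_lists_length_eq finite_submultisets)

lemma set_mset_sum_list: "set_mset (sum_list ms) = (\<Union>m\<in>set ms. set_mset m)"
  by (induction ms) auto

lemma mlists_sum_list: "ms \<in> mlists A n \<longleftrightarrow> length ms = n \<and> sum_list ms \<in> mfin A"
  by (auto simp: mlists_def mfin_def set_mset_sum_list)

text \<open>\<open>promotion\<close> for a given enumeration \<open>bs\<close> instead of the one
  picked by \<open>SOME\<close>, so that induction over the list is possible.\<close>

definition list_promotion :: "('a multiset \<times> 'b \<Rightarrow> real) \<Rightarrow> 'b list \<Rightarrow> 'a multiset \<Rightarrow> real" where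
  "list_promotion f bs \<mu> =
     (\<Sum>ms | length ms = length bs \<and> sum_list ms = \<mu>. \<Prod>i<length bs. f (ms ! i, bs ! i))"

lemma promotion_eq: "\<exists>bs. mset bs = \<nu> \<and> (\<forall>f :: 'a multiset \<times> 'b \<Rightarrow> real. \<forall>\<mu>. promotion f \<mu> \<nu> = list_promotion f bs \<mu>)"
  using someI_ex[OF ex_mset[of \<nu>]] by (auto simp: promotion_def list_promotion_def Let_def)

text \<open>Multiplying out a product of power series, one factor for each entry of
  \<open>bs\<close>: the head is split off and Tonelli's theorem separates it from the rest.\<close>

lemma esum_mlists_prod:
  assumes f: "\<And>p. 0 \<le> f p" and x: "\<And>a. 0 \<le> x a"
  shows "esum (mlists A (length bs)) (\<lambda>ms. (\<Prod>i<length bs. f (ms ! i, bs ! i)) * mpow x (sum_list ms))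
       = (\<Prod>b\<leftarrow>bs. esum (mfin A) (\<lambda>m. f (m, b) * mpow x m))"
proof (induction bs)
  case Nil
  have "mlists A 0 = {[]}" by (auto simp: mlists_def)
  then show ?case by (simp add: nn_integral_count_space_finite)
next
  case (Cons b bs)
  let ?g = "\<lambda>bs ms. (\<Prod>i<length bs. f (ms ! i, bs ! i)) * mpow x (sum_list ms)"
  have g0: "0 \<le> ?g bs ms" "0 \<le> f (m, b) * mpow x m" for ms m
    using f x by (auto intro!: mult_nonneg_nonneg prod_nonneg mpow_nonneg)
  have "esum (mlists A (length (b # bs))) (?g (b # bs))
     = (\<integral>\<^sup>+p. ennreal (?g (b # bs) ((\<lambda>(m, ms). m # ms) p)) \<partial>count_space (mfin A \<times> mlists A (length bs)))"
    using nn_integral_bij_count_space[OF bij_betw_mlists_Suc[of A "length bs"], of "\<lambda>ms. ennreal (?g (b # bs) ms)"] by simp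
  also have "\<dots> = (\<integral>\<^sup>+m. \<integral>\<^sup>+ms. ennreal (f (m, b) * mpow x m) * ennreal (?g bs ms) \<partial>count_space (mlists A (length bs)) \<partial>count_space (mfin A))"
  proof -
    have e: "?g (b # bs) (m # ms) = (f (m, b) * mpow x m) * ?g bs ms" for m ms
      by (simp add: prod.lessThan_Suc_shift del: prod.lessThan_Suc)
    have "ennreal (?g (b # bs) (m # ms)) = ennreal (f (m, b) * mpow x m) * ennreal (?g bs ms)" for m ms
      unfolding e by (rule ennreal_mult[OF g0(2) g0(1)])
    then show ?thesis unfolding nn_integral_count_space_Times prod.case by (simp only:)
  qed
  also have "\<dots> = esum (mfin A) (\<lambda>m. f (m, b) * mpow x m) * esum (mlists A (length bs)) (?g bs)"
    by (simp add: nn_integral_cmult nn_integral_multc)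
  finally show ?case by (simp add: Cons)
qed

text \<open>The expanded product is regrouped by the total multiset \<open>sum_list ms\<close>. The
  indicator of \<open>\<mu> = sum_list ms\<close> turns regrouping into an exchange of two sums; for
  fixed \<open>\<mu>\<close> only finitely many lists remain.\<close>

lemma esum_list_promotion:
  assumes f: "\<And>p. 0 \<le> f p" and x: "\<And>a. 0 \<le> x a" and A: "countable A"
  shows "esum (mfin A) (\<lambda>\<mu>. list_promotion f bs \<mu> * mpow x \<mu>) = (\<Prod>b\<leftarrow>bs. esum (mfin A) (\<lambda>m. f (m, b) * mpow x m))"
proof -
  let ?n = "length bs"
  let ?g = "\<lambda>ms. (\<Prod>i<?n. f (ms ! i, bs ! i)) * mpow x (sum_list ms)"
  have g0: "0 \<le> ?g ms" for ms
    using f x by (auto intro!: mult_nonneg_nonneg prod_nonneg mpow_nonneg)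
  have in1: "(\<integral>\<^sup>+\<mu>. ennreal (?g ms) * indicator {sum_list ms} \<mu> \<partial>count_space (mfin A)) = ennreal (?g ms)"
    if "ms \<in> mlists A ?n" for ms
    using that by (subst nn_integral_count_space'[of "{sum_list ms}"]) (auto simp: mlists_sum_list)
  have in2: "(\<integral>\<^sup>+ms. ennreal (?g ms) * indicator {sum_list ms} \<mu> \<partial>count_space (mlists A ?n)) = ennreal (list_promotion f bs \<mu> * mpow x \<mu>)"
    if \<mu>: "\<mu> \<in> mfin A" for \<mu>
  proof -
    let ?S = "{ms. length ms = ?n \<and> sum_list ms = \<mu>}"
    have "(\<integral>\<^sup>+ms. ennreal (?g ms) * indicator {sum_list ms} \<mu> \<partial>count_space (mlists A ?n)) = (\<Sum>ms\<in>?S. ennreal (?g ms) * indicator {sum_list ms} \<mu>)"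
      using \<mu> by (intro nn_integral_count_space' finite_lists_sum_list) (auto simp: mlists_sum_list indicator_def)
    also have "\<dots> = (\<Sum>ms\<in>?S. ennreal (?g ms))" by (intro sum.cong) auto
    also have "\<dots> = ennreal (\<Sum>ms\<in>?S. ?g ms)" by (rule sum_ennreal) (rule g0)
    also have "(\<Sum>ms\<in>?S. ?g ms) = list_promotion f bs \<mu> * mpow x \<mu>"
      by (simp add: list_promotion_def sum_distrib_right)
    finally show ?thesis .
  qed
  have "(\<Prod>b\<leftarrow>bs. esum (mfin A) (\<lambda>m. f (m, b) * mpow x m)) = esum (mlists A ?n) ?g"
    by (rule esum_mlists_prod[OF f x, symmetric])
  also have "\<dots> = (\<integral>\<^sup>+ms. \<integral>\<^sup>+\<mu>. ennreal (?g ms) * indicator {sum_list ms} \<mu> \<partial>count_space (mfin A) \<partial>count_space (mlists A ?n))"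
    by (rule nn_integral_cong) (simp only: space_count_space in1)
  also have "\<dots> = (\<integral>\<^sup>+\<mu>. \<integral>\<^sup>+ms. ennreal (?g ms) * indicator {sum_list ms} \<mu> \<partial>count_space (mlists A ?n) \<partial>count_space (mfin A))"
    by (rule nn_integral_count_space_nn_integral[OF countable_mfin[OF A]]) simp
  also have "\<dots> = esum (mfin A) (\<lambda>\<mu>. list_promotion f bs \<mu> * mpow x \<mu>)"
    by (rule nn_integral_cong) (simp only: space_count_space in2)
  finally show ?thesis by simp
qed

lemma prod_list_ennreal: "(\<And>b. 0 \<le> y b) \<Longrightarrow> (\<Prod>b\<leftarrow>bs. ennreal (y b)) = ennreal (mpow y (mset bs))"
  by (induction bs) (simp_all add: ennreal_mult' mult.commute)

lemma promotion_nonneg: "(\<And>p. 0 \<le> f p) \<Longrightarrow> 0 \<le> promotion f \<mu> \<nu>"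
  by (auto simp: promotion_def Let_def intro!: sum_nonneg prod_nonneg)

lemma promotion_outside:
  assumes "\<And>m b. m \<notin> mfin A \<Longrightarrow> f (m, b) = 0" "\<mu> \<notin> mfin A"
  shows "promotion f \<mu> \<nu> = 0"
  unfolding promotion_def Let_def
proof (rule sum.neutral, rule ballI)
  let ?bs = "SOME bs. mset bs = \<nu>"
  fix ms assume "ms \<in> {ms. length ms = length ?bs \<and> sum_list ms = \<mu>}"
  then have ms: "length ms = length ?bs" "sum_list ms = \<mu>" by auto
  then have "\<not> set ms \<subseteq> mfin A" using assms(2) mlists_sum_list[of ms A "length ms"] by (simp add: mlists_def)
  then obtain m where "m \<in> set ms" "m \<notin> mfin A" by blast
  then obtain i where i: "i < length ms" "ms ! i \<notin> mfin A" by (auto simp: in_set_conv_nth)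
  then show "(\<Prod>i<length ?bs. f (ms ! i, ?bs ! i)) = 0"
    using assms(1) ms(1) by (intro prod_zero) auto
qed

text \<open>Substituting the values \<open>hat X f x\<close> into the series of \<open>g\<close> and
  expanding gives a double sum of nonnegative terms; exchanging the summations collects the
  coefficients of \<open>pcoh_comp\<close>.\<close>

lemma pcoh_comp_hom:
  assumes X: "is_pcs X" and Y: "is_pcs Y" and Z: "is_pcs Z"
    and f: "f \<in> pcoh_hom X Y" and g: "g \<in> pcoh_hom Y Z"
  shows "pcoh_comp Y g f \<in> pcoh_hom X Z"
    and "x \<in> cliques X \<Longrightarrow> hat X (pcoh_comp Y g f) x = hat Y g (hat X f x)"
proof -
  note fe = hom_exp_elem[OF X Y f] and ge = hom_exp_elem[OF Y Z g]
  have f0: "0 \<le> f p" and g0: "0 \<le> g q" for p q using exp_elem_nonneg[OF X Y fe] exp_elem_nonneg[OF Y Z ge] by auto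
  have fx: "hat X f x \<in> cliques Y" if "x \<in> cliques X" for x using f that by (simp add: pcoh_hom_def)
  have cX: "countable (mfin (web X))" and cY: "countable (mfin (web Y))"
    using countable_mfin countable_web[OF X] countable_web[OF Y] by auto
  have gp0: "0 \<le> g (\<nu>, c) * promotion f \<mu> \<nu>" for \<nu> c \<mu> by (intro mult_nonneg_nonneg g0 promotion_nonneg f0)
  have promo: "esum (mfin (web X)) (\<lambda>\<mu>. promotion f \<mu> \<nu> * mpow x \<mu>) = ennreal (mpow (hat X f x) \<nu>)"
    if x: "x \<in> cliques X" for x \<nu>
  proof -
    obtain bs where bs: "mset bs = \<nu>" "\<And>\<mu>. promotion f \<mu> \<nu> = list_promotion f bs \<mu>" using promotion_eq[of \<nu>] by blast
    have "esum (mfin (web X)) (\<lambda>\<mu>. promotion f \<mu> \<nu> * mpow x \<mu>) = (\<Prod>b\<leftarrow>bs. ennreal (hat X f x b))"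
      unfolding bs(2) using esum_list_promotion[where f = f and x = x and bs = bs, OF f0 clique_nonneg[OF X x] countable_web[OF X]]
      by (simp add: esum_hat[OF X Y fe x])
    also have "\<dots> = ennreal (mpow (hat X f x) \<nu>)"
      using prod_list_ennreal[of "hat X f x" bs] clique_nonneg[OF Y fx[OF x]] bs(1) by simp
    finally show ?thesis .
  qed
  have main: "(\<integral>\<^sup>+\<mu>. esum (mfin (web Y)) (\<lambda>\<nu>. g (\<nu>, c) * promotion f \<mu> \<nu>) * ennreal (mpow x \<mu>) \<partial>count_space (mfin (web X)))
      = ennreal (hat Y g (hat X f x) c)" if x: "x \<in> cliques X" for x c
  proof -
    have x0: "0 \<le> mpow x \<mu>" for \<mu> by (rule mpow_clique_nonneg[OF X x])
    have "(\<integral>\<^sup>+\<mu>. esum (mfin (web Y)) (\<lambda>\<nu>. g (\<nu>, c) * promotion f \<mu> \<nu>) * ennreal (mpow x \<mu>) \<partial>count_space (mfin (web X)))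
      = (\<integral>\<^sup>+\<mu>. \<integral>\<^sup>+\<nu>. ennreal (g (\<nu>, c)) * ennreal (promotion f \<mu> \<nu> * mpow x \<mu>) \<partial>count_space (mfin (web Y)) \<partial>count_space (mfin (web X)))"
      using f0 g0 x0 promotion_nonneg[of f]
      by (intro nn_integral_cong) (simp add: nn_integral_multc[symmetric] mult.assoc flip: ennreal_mult)
    also have "\<dots> = (\<integral>\<^sup>+\<nu>. \<integral>\<^sup>+\<mu>. ennreal (g (\<nu>, c)) * ennreal (promotion f \<mu> \<nu> * mpow x \<mu>) \<partial>count_space (mfin (web X)) \<partial>count_space (mfin (web Y)))"
      by (rule nn_integral_count_space_nn_integral[OF cY]) simp
    also have "\<dots> = (\<integral>\<^sup>+\<nu>. ennreal (g (\<nu>, c)) * ennreal (mpow (hat X f x) \<nu>) \<partial>count_space (mfin (web Y)))"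
      by (simp add: nn_integral_cmult promo[OF x])
    also have "\<dots> = esum (mfin (web Y)) (\<lambda>\<nu>. g (\<nu>, c) * mpow (hat X f x) \<nu>)"
      using g0 mpow_clique_nonneg[OF Y fx[OF x]] by (intro nn_integral_cong) (simp add: ennreal_mult)
    also have "\<dots> = ennreal (hat Y g (hat X f x) c)" by (rule esum_hat[OF Y Z ge fx[OF x]])
    finally show ?thesis .
  qed
  \<comment> \<open>A coefficient of the composite is an infinite sum; it is finite because the
    total at a clique positive on \<open>\<mu>\<close> is finite and dominates it times a positive
    monomial.\<close>
  have fin: "(\<lambda>\<nu>. g (\<nu>, c) * promotion f \<mu> \<nu>) summable_on mfin (web Y)" if \<mu>: "\<mu> \<in> mfin (web X)" for \<mu> c
  proof -
    obtain x where x: "x \<in> cliques X" "\<forall>a\<in>set_mset \<mu>. 0 < x a"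
      using clique_positive[OF X, of "set_mset \<mu>"] \<mu> by (auto simp: mfin_def)
    have pos: "0 < mpow x \<mu>" using x(2) by (auto simp: mpow_def intro!: prod_pos)
    let ?h = "\<lambda>\<mu>. esum (mfin (web Y)) (\<lambda>\<nu>. g (\<nu>, c) * promotion f \<mu> \<nu>) * ennreal (mpow x \<mu>)"
    have "?h \<mu> = (\<integral>\<^sup>+\<mu>'. ?h \<mu>' * indicator {\<mu>} \<mu>' \<partial>count_space (mfin (web X)))"
      using \<mu> by (subst nn_integral_count_space'[of "{\<mu>}"]) auto
    also have "\<dots> \<le> (\<integral>\<^sup>+\<mu>'. ?h \<mu>' \<partial>count_space (mfin (web X)))"
      by (intro nn_integral_mono) (auto split: split_indicator)
    also have "\<dots> < \<infinity>" unfolding main[OF x(1)] by simp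
    finally have "esum (mfin (web Y)) (\<lambda>\<nu>. g (\<nu>, c) * promotion f \<mu> \<nu>) < \<infinity>"
      using pos by (auto simp: ennreal_mult_less_top)
    then show ?thesis using gp0 by (subst summable_on_iff_esum) auto
  qed
  let ?k = "pcoh_comp Y g f"
  have k0: "0 \<le> ?k p" for p using gp0 by (cases p) (auto simp: pcoh_comp_def intro!: infsum_nonneg)
  have kx: "esum (mfin (web X)) (\<lambda>\<mu>. ?k (\<mu>, c) * mpow x \<mu>) = ennreal (hat Y g (hat X f x) c)" if x: "x \<in> cliques X" for x c
    unfolding main[OF x, symmetric]
  proof (rule nn_integral_cong)
    fix \<mu> assume "\<mu> \<in> space (count_space (mfin (web X)))"
    then have "esum (mfin (web Y)) (\<lambda>\<nu>. g (\<nu>, c) * promotion f \<mu> \<nu>) = ennreal (?k (\<mu>, c))"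
      using esum_eq_infsum[OF gp0 fin] by (simp add: pcoh_comp_def)
    then show "ennreal (?k (\<mu>, c) * mpow x \<mu>) = esum (mfin (web Y)) (\<lambda>\<nu>. g (\<nu>, c) * promotion f \<mu> \<nu>) * ennreal (mpow x \<mu>)"
      using mpow_clique_nonneg[OF X x] by (simp add: ennreal_mult'')
  qed
  have ks: "(\<lambda>\<mu>. ?k (\<mu>, c) * mpow x \<mu>) summable_on mfin (web X) \<and> infsum (\<lambda>\<mu>. ?k (\<mu>, c) * mpow x \<mu>) (mfin (web X)) = hat Y g (hat X f x) c"
    if x: "x \<in> cliques X" for x c
    using kx[OF x, of c] k0 mpow_clique_nonneg[OF X x] hat_nonneg[OF Y Z ge fx[OF x], of c]
    by (subst (asm) esum_eq_iff) auto
  show hat: "hat X ?k x = hat Y g (hat X f x)" if "x \<in> cliques X" for x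
    using ks[OF that] by (auto simp: hat_def[of X ?k] fun_eq_iff)
  have "?k (\<mu>, c) = 0" if "\<mu> \<notin> mfin (web X) \<or> c \<notin> web Z" for \<mu> c
  proof -
    have "g (\<nu>, c) * promotion f \<mu> \<nu> = 0" for \<nu>
      using that exp_elem_outside[OF Y Z ge, of \<nu> c] promotion_outside[of "web X" f \<mu> \<nu>] exp_elem_outside[OF X Y fe] by auto
    then have "(\<lambda>\<nu>. g (\<nu>, c) * promotion f \<mu> \<nu>) = (\<lambda>\<nu>. 0)" by (rule ext)
    then show ?thesis by (simp add: pcoh_comp_def del: mult_eq_0_iff)
  qed
  then have "?k \<in> nnvecs (mfin (web X) \<times> web Z)" using k0 by (auto simp: nnvecs_def)
  moreover have "hat Y g (hat X f x) \<in> cliques Z" if "x \<in> cliques X" for x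
    using g fx[OF that] by (simp add: pcoh_hom_def)
  ultimately show "?k \<in> pcoh_hom X Z" unfolding pcoh_hom_def using ks hat by simp
qed

lemma Fm_map_comp:
  assumes X: "is_pcs X" and Y: "is_pcs Y" and Z: "is_pcs Z"
    and f: "f \<in> pcoh_hom X Y" and g: "g \<in> pcoh_hom Y Z"
  shows "Fm_map X (pcoh_comp Y g f) = cstab_comp (Fm X) (Fm_map Y g) (Fm_map X f)"
  using f by (auto simp: Fm_map_def cstab_comp_def compose_def unit_ball_Fm[OF X] unit_ball_Fm[OF Y] fun_eq_iff
      pcoh_comp_hom(2)[OF assms] pcoh_hom_def)

section \<open>Transport along linear isometries\<close>

lemma csum_cong:
  assumes "comm_monoid (cone_monoid C)" "\<And>j. j \<in> S \<Longrightarrow> f j = g j" "\<And>j. j \<in> S \<Longrightarrow> g j \<in> elems C"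
  shows "csum C f S = csum C g S"
  unfolding csum_def using assms
  by (intro comm_monoid.finprod_cong'[OF assms(1)]) (auto simp: cone_monoid_def)

lemma csum_closed:
  assumes "comm_monoid (cone_monoid C)" "\<And>j. j \<in> S \<Longrightarrow> f j \<in> elems C"
  shows "csum C f S \<in> elems C"
proof -
  interpret comm_monoid "cone_monoid C" by fact
  have "finprod (cone_monoid C) f S \<in> carrier (cone_monoid C)"
    using assms(2) by (intro finprod_closed) (auto simp: cone_monoid_def)
  then show ?thesis by (simp add: csum_def cone_monoid_def)
qed

lemma csum_empty: "comm_monoid (cone_monoid C) \<Longrightarrow> csum C f {} = czero C"
  using comm_monoid.finprod_empty[of "cone_monoid C" f] by (simp add: csum_def) (simp add: cone_monoid_def)

lemma csum_insert:
  assumes "comm_monoid (cone_monoid C)" "finite S" "k \<notin> S" "\<And>j. j \<in> insert k S \<Longrightarrow> f j \<in> elems C"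
  shows "csum C f (insert k S) = cadd C (f k) (csum C f S)"
proof -
  interpret comm_monoid "cone_monoid C" by fact
  have "finprod (cone_monoid C) f (insert k S) = f k \<otimes>\<^bsub>cone_monoid C\<^esub> finprod (cone_monoid C) f S"
    using assms by (intro finprod_insert) (auto simp: cone_monoid_def)
  then show ?thesis by (simp add: csum_def) (simp add: cone_monoid_def)
qed

lemma meas_path_cong:
  assumes "\<And>s. s \<in> space (Rn n) \<Longrightarrow> \<gamma> s = \<gamma>' s"
  shows "meas_path C n \<gamma> \<longleftrightarrow> meas_path C n \<gamma>'"
proof -
  have *: "(\<lambda>(r, s). l r (\<gamma> s)) \<in> borel_measurable (Rn k \<Otimes>\<^sub>M Rn n) \<longleftrightarrow>
      (\<lambda>(r, s). l r (\<gamma>' s)) \<in> borel_measurable (Rn k \<Otimes>\<^sub>M Rn n)" for k l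
    using assms by (intro measurable_cong) (auto simp: space_pair_measure)
  show ?thesis
    unfolding meas_path_def by (intro conj_cong ex_cong1 ball_cong all_cong1 refl *) (simp_all add: assms)
qed

text \<open>Nothing presupposes that the record \<open>D\<close> is a cone: its cone laws, order and
  completeness are obtained from those of \<open>Fm Z\<close> through \<open>\<theta>\<close>. The
  tests of \<open>D\<close> are not linked to \<open>\<theta>\<close> here; they enter in
  \<open>cstab_iso_D\<close>.\<close>

locale cone_isometry =
  fixes Z :: "'z pcs" and D :: "'d mcone" and \<theta> :: "('z \<Rightarrow> real) \<Rightarrow> 'd" and \<theta>' :: "'d \<Rightarrow> 'z \<Rightarrow> real"
  assumes Z: "is_pcs Z"
    and \<theta>_elem: "x \<in> elems (Fm Z) \<Longrightarrow> \<theta> x \<in> elems D"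
    and \<theta>'_elem: "y \<in> elems D \<Longrightarrow> \<theta>' y \<in> elems (Fm Z)"
    and \<theta>'_\<theta>: "x \<in> elems (Fm Z) \<Longrightarrow> \<theta>' (\<theta> x) = x"
    and \<theta>_\<theta>': "y \<in> elems D \<Longrightarrow> \<theta> (\<theta>' y) = y"
    and \<theta>_zero: "\<theta> (\<lambda>a. 0) = czero D"
    and \<theta>_add: "x \<in> elems (Fm Z) \<Longrightarrow> x' \<in> elems (Fm Z) \<Longrightarrow> \<theta> (\<lambda>a. x a + x' a) = cadd D (\<theta> x) (\<theta> x')"
    and \<theta>_scale: "0 \<le> \<alpha> \<Longrightarrow> x \<in> elems (Fm Z) \<Longrightarrow> \<theta> (\<lambda>a. \<alpha> * x a) = cscale D \<alpha> (\<theta> x)"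
    and \<theta>_norm: "x \<in> elems (Fm Z) \<Longrightarrow> cnorm D (\<theta> x) = cnorm (Fm Z) x"
begin

lemma D_cases: "y \<in> elems D \<Longrightarrow> \<exists>x\<in>elems (Fm Z). y = \<theta> x"
  using \<theta>_\<theta>' \<theta>'_elem by metis

lemma \<theta>_inj: "x \<in> elems (Fm Z) \<Longrightarrow> y \<in> elems (Fm Z) \<Longrightarrow> \<theta> x = \<theta> y \<longleftrightarrow> x = y"
  using \<theta>'_\<theta> by metis

lemma zero_D: "czero D \<in> elems D"
  using \<theta>_elem[OF Fm_zero(1)[OF Z]] by (simp add: \<theta>_zero)

lemma add_D: "x \<in> elems D \<Longrightarrow> y \<in> elems D \<Longrightarrow> cadd D x y \<in> elems D"
  using \<theta>_add[OF \<theta>'_elem \<theta>'_elem] \<theta>_elem[OF Fm_add(1)[OF Z \<theta>'_elem \<theta>'_elem]] \<theta>_\<theta>' by metis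

lemma comm_monoid_D: "comm_monoid (cone_monoid D)"
proof (rule comm_monoidI)
  note Zadd = Fm_add(1)[OF Z] and Z0 = Fm_zero(1)[OF Z]
  fix x y assume "x \<in> carrier (cone_monoid D)" "y \<in> carrier (cone_monoid D)"
  then have x: "x \<in> elems D" and y: "y \<in> elems D" by (simp_all add: cone_monoid_def)
  then obtain u v where u: "u \<in> elems (Fm Z)" "x = \<theta> u" and v: "v \<in> elems (Fm Z)" "y = \<theta> v" by (metis D_cases)
  show "x \<otimes>\<^bsub>cone_monoid D\<^esub> y \<in> carrier (cone_monoid D)" using add_D[OF x y] by (simp add: cone_monoid_def)
  show "x \<otimes>\<^bsub>cone_monoid D\<^esub> y = y \<otimes>\<^bsub>cone_monoid D\<^esub> x"
    using \<theta>_add[OF u(1) v(1)] \<theta>_add[OF v(1) u(1)] by (simp add: cone_monoid_def u v add.commute)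
  fix z assume "z \<in> carrier (cone_monoid D)"
  then obtain w where w: "w \<in> elems (Fm Z)" "z = \<theta> w" by (metis D_cases cone_monoid_def partial_object.select_convs(1))
  show "x \<otimes>\<^bsub>cone_monoid D\<^esub> y \<otimes>\<^bsub>cone_monoid D\<^esub> z = x \<otimes>\<^bsub>cone_monoid D\<^esub> (y \<otimes>\<^bsub>cone_monoid D\<^esub> z)"
    using \<theta>_add[OF Zadd[OF u(1) v(1)] w(1)] \<theta>_add[OF u(1) Zadd[OF v(1) w(1)]] \<theta>_add[OF u(1) v(1)] \<theta>_add[OF v(1) w(1)]
    by (simp add: cone_monoid_def u v w add.assoc)
next
  show "\<one>\<^bsub>cone_monoid D\<^esub> \<in> carrier (cone_monoid D)" using zero_D by (simp add: cone_monoid_def)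
  fix x assume "x \<in> carrier (cone_monoid D)"
  then obtain u where u: "u \<in> elems (Fm Z)" "x = \<theta> u" by (metis D_cases cone_monoid_def partial_object.select_convs(1))
  have "cadd D (czero D) (\<theta> u) = \<theta> (\<lambda>a. 0 + u a)"
    unfolding \<theta>_zero[symmetric] by (rule \<theta>_add[OF Fm_zero(1)[OF Z] u(1), symmetric])
  then show "\<one>\<^bsub>cone_monoid D\<^esub> \<otimes>\<^bsub>cone_monoid D\<^esub> x = x" by (simp add: cone_monoid_def u(2))
qed

lemma is_cone_D: "is_cone D"
  unfolding is_cone_def
proof (intro conjI allI ballI impI comm_monoid_D)
  note Zadd = Fm_add(1)[OF Z] and Zsc = Fm_scale(1)[OF Z]
  fix x assume "x \<in> elems D"
  then obtain u where u: "u \<in> elems (Fm Z)" "x = \<theta> u" by (metis D_cases)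
  note simps = u \<theta>_norm \<theta>_elem \<theta>_inj Zadd Zsc
  show "cscale D 1 x = x" using \<theta>_scale[OF _ u(1), of 1] u by simp
  show "cscale D 0 x = czero D" using \<theta>_scale[OF _ u(1), of 0] u \<theta>_zero by simp
  show "0 \<le> cnorm D x" by (simp add: simps Fm_norm_nonneg[OF Z])
  show "x = czero D" if "cnorm D x = 0" using that Fm_norm_eq_0[OF Z u(1)] by (simp add: simps \<theta>_zero[symmetric])
  fix \<alpha> :: real assume \<alpha>: "0 \<le> \<alpha>"
  have sx: "cscale D \<alpha> x = \<theta> (\<lambda>a. \<alpha> * u a)" using \<theta>_scale[OF \<alpha> u(1)] u by simp
  show "cscale D \<alpha> x \<in> elems D" unfolding sx using Zsc[OF u(1) \<alpha>] by (rule \<theta>_elem)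
  show "cnorm D (cscale D \<alpha> x) = \<alpha> * cnorm D x"
    unfolding sx using Zsc[OF u(1) \<alpha>] Fm_scale(2)[OF Z u(1) \<alpha>] by (simp add: simps)
  fix \<beta> :: real assume \<beta>: "0 \<le> \<beta>"
  have sx': "cscale D \<beta> x = \<theta> (\<lambda>a. \<beta> * u a)" using \<theta>_scale[OF \<beta> u(1)] u by simp
  show "cscale D (\<alpha> + \<beta>) x = cadd D (cscale D \<alpha> x) (cscale D \<beta> x)"
    unfolding sx sx' \<theta>_add[OF Zsc[OF u(1) \<alpha>] Zsc[OF u(1) \<beta>], symmetric]
    using \<theta>_scale[OF _ u(1), of "\<alpha> + \<beta>"] u \<alpha> \<beta> by (simp add: distrib_right)
  show "cscale D (\<alpha> * \<beta>) x = cscale D \<alpha> (cscale D \<beta> x)"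
    unfolding sx' using \<theta>_scale[OF \<alpha> Zsc[OF u(1) \<beta>]] \<theta>_scale[OF _ u(1), of "\<alpha> * \<beta>"] u \<alpha> \<beta> by (simp add: mult.assoc)
next
  fix \<alpha> :: real assume "0 \<le> \<alpha>"
  then show "cscale D \<alpha> (czero D) = czero D" using \<theta>_scale[OF _ Fm_zero(1)[OF Z], of \<alpha>] by (simp add: \<theta>_zero)
next
  note Zadd = Fm_add(1)[OF Z] and Zsc = Fm_scale(1)[OF Z]
  fix x y assume "x \<in> elems D" "y \<in> elems D"
  then obtain u v where u: "u \<in> elems (Fm Z)" "x = \<theta> u" and v: "v \<in> elems (Fm Z)" "y = \<theta> v" by (metis D_cases)
  have xy: "cadd D x y = \<theta> (\<lambda>a. u a + v a)" using \<theta>_add[OF u(1) v(1)] u v by simp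
  show "cnorm D (cadd D x y) \<le> cnorm D x + cnorm D y"
    unfolding xy using Fm_add(2)[OF Z u(1) v(1)] by (simp add: \<theta>_norm u v Zadd)
  show "cnorm D x \<le> cnorm D (cadd D x y)"
    unfolding xy using u v Fm_elem_nonneg[OF Z v(1)] Zadd[OF u(1) v(1)]
    by (auto simp: \<theta>_norm intro!: Fm_elem_down(2)[OF Z] Fm_elem_nnvecs[OF Z])
  show "cscale D \<alpha> (cadd D x y) = cadd D (cscale D \<alpha> x) (cscale D \<alpha> y)" if \<alpha>: "0 \<le> \<alpha>" for \<alpha>
  proof -
    have "cscale D \<alpha> (cadd D x y) = \<theta> (\<lambda>a. \<alpha> * u a + \<alpha> * v a)"
      unfolding xy using \<theta>_scale[OF \<alpha> Zadd[OF u(1) v(1)]] by (simp add: distrib_left)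
    then show ?thesis
      using \<theta>_add[OF Zsc[OF u(1) \<alpha>] Zsc[OF v(1) \<alpha>]] \<theta>_scale[OF \<alpha> u(1)] \<theta>_scale[OF \<alpha> v(1)] by (simp add: u v)
  qed
  fix z assume "z \<in> elems D" and eq: "cadd D x y = cadd D x z"
  then obtain w where w: "w \<in> elems (Fm Z)" "z = \<theta> w" by (metis D_cases)
  have "(\<lambda>a. u a + v a) = (\<lambda>a. u a + w a)"
    using eq \<theta>_add[OF u(1) v(1)] \<theta>_add[OF u(1) w(1)] \<theta>_inj[OF Zadd[OF u(1) v(1)] Zadd[OF u(1) w(1)]] u v w by simp
  then have "v = w" by (simp add: fun_eq_iff)
  then show "y = z" by (simp add: v w)
qed

lemma \<theta>'_add: "x \<in> elems D \<Longrightarrow> y \<in> elems D \<Longrightarrow> \<theta>' (cadd D x y) = (\<lambda>a. \<theta>' x a + \<theta>' y a)"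
  using \<theta>_add[OF \<theta>'_elem \<theta>'_elem] \<theta>_\<theta>' \<theta>'_\<theta>[OF Fm_add(1)[OF Z \<theta>'_elem \<theta>'_elem]] by metis

lemma csum_\<theta>:
  assumes "finite S" "\<And>j. j \<in> S \<Longrightarrow> w j \<in> elems (Fm Z)"
  shows "csum D (\<lambda>j. \<theta> (w j)) S = \<theta> (csum (Fm Z) w S)"
  using assms
proof (induction S)
  case empty
  show ?case by (simp add: csum_empty[OF comm_monoid_D] csum_empty[OF comm_monoid_Fm[OF Z]] Fm_simps[OF Z] \<theta>_zero)
next
  case (insert k S)
  have "csum D (\<lambda>j. \<theta> (w j)) (insert k S) = cadd D (\<theta> (w k)) (csum D (\<lambda>j. \<theta> (w j)) S)"
    using insert by (intro csum_insert[OF comm_monoid_D]) (auto intro: \<theta>_elem)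
  moreover have "csum (Fm Z) w (insert k S) = cadd (Fm Z) (w k) (csum (Fm Z) w S)"
    using insert by (intro csum_insert[OF comm_monoid_Fm[OF Z]]) auto
  moreover have "csum (Fm Z) w S \<in> elems (Fm Z)"
    using insert by (intro csum_closed[OF comm_monoid_Fm[OF Z]]) auto
  ultimately show ?case using insert by (simp add: Fm_simps[OF Z] \<theta>_add)
qed

text \<open>The order is defined from addition alone, so an additive bijection preserves it in both
  directions.\<close>

lemma cle_D_iff: "x \<in> elems D \<Longrightarrow> y \<in> elems D \<Longrightarrow> cle D x y \<longleftrightarrow> cle (Fm Z) (\<theta>' x) (\<theta>' y)"
proof
  assume x: "x \<in> elems D" and y: "y \<in> elems D"
  show "cle (Fm Z) (\<theta>' x) (\<theta>' y)" if "cle D x y"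
  proof -
    from that obtain z where "z \<in> elems D" "y = cadd D x z" unfolding cle_def by blast
    then show ?thesis unfolding cle_def using x by (intro bexI[of _ "\<theta>' z"]) (auto simp: \<theta>'_add \<theta>'_elem Fm_simps[OF Z])
  qed
  show "cle D x y" if "cle (Fm Z) (\<theta>' x) (\<theta>' y)"
  proof -
    from that obtain w where w: "w \<in> elems (Fm Z)" "\<theta>' y = (\<lambda>a. \<theta>' x a + w a)" unfolding cle_def Fm_simps[OF Z] by blast
    have "y = cadd D x (\<theta> w)" using \<theta>_add[OF \<theta>'_elem[OF x] w(1)] \<theta>_\<theta>'[OF x] \<theta>_\<theta>'[OF y] w(2) by simp
    then show ?thesis unfolding cle_def using \<theta>_elem[OF w(1)] by blast
  qed
qed

lemma nondecreasing_D_iff: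
  assumes "\<And>n. x n \<in> elems D"
  shows "nondecreasing D x \<longleftrightarrow> nondecreasing (Fm Z) (\<lambda>n. \<theta>' (x n))"
  using assms by (simp add: nondecreasing_def cle_D_iff \<theta>'_elem)

lemma is_seq_lub_D_iff:
  assumes x: "\<And>n. x n \<in> elems D" and s: "s \<in> elems D"
  shows "is_seq_lub D x s \<longleftrightarrow> is_seq_lub (Fm Z) (\<lambda>n. \<theta>' (x n)) (\<theta>' s)"
proof
  assume L: "is_seq_lub D x s"
  have "cle (Fm Z) (\<theta>' s) t" if t: "t \<in> elems (Fm Z)" "\<forall>n. cle (Fm Z) (\<theta>' (x n)) t" for t
  proof -
    have "\<forall>n. cle D (x n) (\<theta> t)" using t x by (simp add: cle_D_iff \<theta>_elem \<theta>'_\<theta>)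
    then have "cle D s (\<theta> t)" using L \<theta>_elem[OF t(1)] unfolding is_seq_lub_def by blast
    then show ?thesis using s t by (simp add: cle_D_iff \<theta>_elem \<theta>'_\<theta>)
  qed
  then show "is_seq_lub (Fm Z) (\<lambda>n. \<theta>' (x n)) (\<theta>' s)"
    using L s x by (simp add: is_seq_lub_def cle_D_iff \<theta>'_elem)
next
  assume "is_seq_lub (Fm Z) (\<lambda>n. \<theta>' (x n)) (\<theta>' s)"
  then show "is_seq_lub D x s" using s x by (simp add: is_seq_lub_def cle_D_iff \<theta>'_elem)
qed

lemma unit_ball_D_iff: "y \<in> elems D \<Longrightarrow> y \<in> unit_ball D \<longleftrightarrow> \<theta>' y \<in> cliques Z"
  using \<theta>_norm[OF \<theta>'_elem, of y] \<theta>_\<theta>'[of y] \<theta>'_elem[of y] unit_ball_Fm[OF Z] by (auto simp: unit_ball_def)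

lemma \<theta>_ball: "x \<in> cliques Z \<Longrightarrow> \<theta> x \<in> unit_ball D"
  using unit_ball_D_iff[OF \<theta>_elem] \<theta>'_\<theta> clique_elem[OF Z] by simp

lemma ball_D_elem: "y \<in> unit_ball D \<Longrightarrow> y \<in> elems D"
  by (simp add: unit_ball_def)

lemma \<theta>'_ball: "y \<in> unit_ball D \<Longrightarrow> \<theta>' y \<in> cliques Z"
  using unit_ball_D_iff ball_D_elem by blast

lemma seq_complete_D: "seq_complete D"
  unfolding seq_complete_def
proof (intro allI impI, elim conjE)
  fix x assume nd: "nondecreasing D x" and r: "range x \<subseteq> unit_ball D"
  have x: "x n \<in> elems D" for n using r ball_D_elem by blast
  have "nondecreasing (Fm Z) (\<lambda>n. \<theta>' (x n))" using nd nondecreasing_D_iff[of x] x by simp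
  moreover have "range (\<lambda>n. \<theta>' (x n)) \<subseteq> unit_ball (Fm Z)" using r \<theta>'_ball by (auto simp: unit_ball_Fm[OF Z])
  ultimately obtain s where s: "s \<in> unit_ball (Fm Z)" "is_seq_lub (Fm Z) (\<lambda>n. \<theta>' (x n)) s"
    using seq_complete_Fm[OF Z] unfolding seq_complete_def by blast
  then have sZ: "s \<in> cliques Z" by (simp add: unit_ball_Fm[OF Z])
  have "is_seq_lub D x (\<theta> s)"
    using s(2) clique_elem[OF Z sZ] by (subst is_seq_lub_D_iff[OF x]) (auto simp: \<theta>_elem \<theta>'_\<theta>)
  then show "\<exists>s\<in>unit_ball D. is_seq_lub D x s" using \<theta>_ball[OF sZ] by blast
qed

lemma linear_scott_D:
  assumes l: "linear_scott (Fm Z) (\<lambda>x. l (\<theta> x))"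
  shows "linear_scott D l"
  unfolding linear_scott_def
proof (intro conjI ballI allI impI; (elim conjE)?)
  fix x assume "x \<in> elems D"
  then obtain u where u: "u \<in> elems (Fm Z)" "x = \<theta> u" by (metis D_cases)
  show "0 \<le> l x" using l u unfolding linear_scott_def by blast
  show "l (cscale D \<alpha> x) = \<alpha> * l x" if "0 \<le> \<alpha>" for \<alpha>
    using l u that \<theta>_scale[OF that u(1)] unfolding linear_scott_def Fm_simps[OF Z] by metis
  fix y assume "y \<in> elems D"
  then obtain v where v: "v \<in> elems (Fm Z)" "y = \<theta> v" by (metis D_cases)
  show "l (cadd D x y) = l x + l y"
    using l u v \<theta>_add[OF u(1) v(1)] unfolding linear_scott_def Fm_simps[OF Z] by metis
next
  fix x s assume nd: "nondecreasing D x" and lub: "is_seq_lub D x s"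
  have x: "x n \<in> elems D" for n using nd by (simp add: nondecreasing_def)
  have s: "s \<in> elems D" using lub by (simp add: is_seq_lub_def)
  have "nondecreasing (Fm Z) (\<lambda>n. \<theta>' (x n))" "is_seq_lub (Fm Z) (\<lambda>n. \<theta>' (x n)) (\<theta>' s)"
    using nd lub nondecreasing_D_iff[of x] is_seq_lub_D_iff[of x s] x s by auto
  then have "bdd_above (range (\<lambda>n. l (\<theta> (\<theta>' (x n))))) \<and> l (\<theta> (\<theta>' s)) = (SUP n. l (\<theta> (\<theta>' (x n))))"
    using l[unfolded linear_scott_def, THEN conjunct2, THEN conjunct2, THEN conjunct2, rule_format,
        where x = "\<lambda>n. \<theta>' (x n)" and s = "\<theta>' s"] by simp
  then show "bdd_above (range (\<lambda>n. l (x n)))" "l s = (SUP n. l (x n))" by (simp_all add: \<theta>_\<theta>' x s)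
qed

text \<open>The identity is the power series \<open>pcoh_id\<close>, so its pre-stability is already
  available. A linear order isomorphism carries this inequality over to itself and to its inverse,
  with no further combinatorics of alternating sums.\<close>

lemma identity_pre_stable: "pre_stable (Fm Z) (Fm Z) (cstab_id (Fm Z))"
  using Fm_map_in_cstab_hom[OF Z Z pcoh_id_hom(1)[OF Z]] pcoh_id_hom(2)[OF Z]
  by (simp add: cstab_hom_def meas_stable_def stable_def)

lemma pre_stable_\<theta>: "pre_stable (Fm Z) D (\<lambda>x\<in>cliques Z. \<theta> x)"
  unfolding pre_stable_def
proof (intro allI impI, elim conjE)
  fix n :: nat and x and u :: "nat \<Rightarrow> 'z \<Rightarrow> real"
  assume x: "x \<in> elems (Fm Z)" and u: "\<forall>i\<in>{1..n}. u i \<in> elems (Fm Z)"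
    and c: "cadd (Fm Z) x (csum (Fm Z) u {1..n}) \<in> unit_ball (Fm Z)"
  let ?z = "\<lambda>J. cadd (Fm Z) x (csum (Fm Z) u J)"
  let ?O = "{J. J \<subseteq> {1..n} \<and> odd (n - card J)}" and ?E = "{J. J \<subseteq> {1..n} \<and> even (n - card J)}"
  have fin: "finite ?O" "finite ?E" by (auto intro: finite_subset[of _ "Pow {1..n}"])
  have z: "?z J \<in> cliques Z" if J: "J \<subseteq> {1..n}" for J
  proof -
    have fJ: "finite J" "\<And>j. j \<in> J \<Longrightarrow> u j \<in> elems (Fm Z)" using J u by (auto intro: finite_subset)
    have "(\<lambda>a. x a + (\<Sum>i\<in>{1..n}. u i a)) \<in> cliques Z"
      using c csum_Fm(1)[OF Z, of "{1..n}" u] u by (simp add: Fm_simps[OF Z] unit_ball_Fm[OF Z])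
    from partial_sum_clique[OF Z x u this J] show ?thesis
      using csum_Fm(1)[OF Z fJ] by (simp add: Fm_simps[OF Z])
  qed
  have id: "cstab_id (Fm Z) (?z J) = ?z J" if "J \<subseteq> {1..n}" for J
    using z[OF that] by (simp add: cstab_id_def unit_ball_Fm[OF Z])
  have \<theta>z: "(\<lambda>x\<in>cliques Z. \<theta> x) (?z J) = \<theta> (?z J)" if "J \<subseteq> {1..n}" for J
    using z[OF that] by simp
  \<comment> \<open>Linearity moves \<open>\<theta>\<close> out of the sums, so that both sides of
    the inequality are images of the sums for the identity.\<close>
  have eq: "csum D (\<lambda>J. (\<lambda>x\<in>cliques Z. \<theta> x) (?z J)) S = \<theta> (csum (Fm Z) (\<lambda>J. cstab_id (Fm Z) (?z J)) S)"
    "csum (Fm Z) (\<lambda>J. cstab_id (Fm Z) (?z J)) S \<in> elems (Fm Z)" if S: "finite S" "S \<subseteq> Pow {1..n}" for S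
  proof -
    have zS: "?z J \<in> elems (Fm Z)" if "J \<in> S" for J using S that clique_elem[OF Z z] by blast
    have "csum D (\<lambda>J. (\<lambda>x\<in>cliques Z. \<theta> x) (?z J)) S = csum D (\<lambda>J. \<theta> (?z J)) S"
      using S zS by (intro csum_cong[OF comm_monoid_D] \<theta>z) (auto intro: \<theta>_elem)
    also have "\<dots> = \<theta> (csum (Fm Z) ?z S)" using S(1) zS by (rule csum_\<theta>)
    also have "csum (Fm Z) ?z S = csum (Fm Z) (\<lambda>J. cstab_id (Fm Z) (?z J)) S"
      using S zS id by (intro csum_cong[OF comm_monoid_Fm[OF Z]]) (simp_all add: subset_iff)
    finally show "csum D (\<lambda>J. (\<lambda>x\<in>cliques Z. \<theta> x) (?z J)) S = \<theta> (csum (Fm Z) (\<lambda>J. cstab_id (Fm Z) (?z J)) S)" .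
    show "csum (Fm Z) (\<lambda>J. cstab_id (Fm Z) (?z J)) S \<in> elems (Fm Z)"
      using S zS id by (intro csum_closed[OF comm_monoid_Fm[OF Z]]) (simp_all add: subset_iff)
  qed
  have sub: "?O \<subseteq> Pow {1..n}" "?E \<subseteq> Pow {1..n}" by auto
  have "cle (Fm Z) (csum (Fm Z) (\<lambda>J. cstab_id (Fm Z) (?z J)) ?O) (csum (Fm Z) (\<lambda>J. cstab_id (Fm Z) (?z J)) ?E)"
    using x u c by (intro identity_pre_stable[unfolded pre_stable_def, rule_format]) simp
  then show "cle D (csum D (\<lambda>J. (\<lambda>x\<in>cliques Z. \<theta> x) (?z J)) ?O) (csum D (\<lambda>J. (\<lambda>x\<in>cliques Z. \<theta> x) (?z J)) ?E)"
    unfolding eq(1)[OF fin(1) sub(1)] eq(1)[OF fin(2) sub(2)]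
      cle_D_iff[OF \<theta>_elem[OF eq(2)[OF fin(1) sub(1)]] \<theta>_elem[OF eq(2)[OF fin(2) sub(2)]]]
      \<theta>'_\<theta>[OF eq(2)[OF fin(1) sub(1)]] \<theta>'_\<theta>[OF eq(2)[OF fin(2) sub(2)]] .
qed

lemma pre_stable_\<theta>': "pre_stable D (Fm Z) (\<lambda>y\<in>unit_ball D. \<theta>' y)"
  unfolding pre_stable_def
proof (intro allI impI, elim conjE)
  fix n :: nat and y and v :: "nat \<Rightarrow> 'd"
  assume y: "y \<in> elems D" and v: "\<forall>i\<in>{1..n}. v i \<in> elems D"
    and c: "cadd D y (csum D v {1..n}) \<in> unit_ball D"
  let ?u = "\<lambda>i. \<theta>' (v i)"
  let ?z = "\<lambda>J. cadd (Fm Z) (\<theta>' y) (csum (Fm Z) ?u J)"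
  let ?O = "{J. J \<subseteq> {1..n} \<and> odd (n - card J)}" and ?E = "{J. J \<subseteq> {1..n} \<and> even (n - card J)}"
  have x: "\<theta>' y \<in> elems (Fm Z)" and u: "\<forall>i\<in>{1..n}. ?u i \<in> elems (Fm Z)" using y v \<theta>'_elem by auto
  have zD: "cadd D y (csum D v J) = \<theta> (?z J)" "?z J \<in> elems (Fm Z)" if J: "J \<subseteq> {1..n}" for J
  proof -
    have fJ: "finite J" "\<And>j. j \<in> J \<Longrightarrow> ?u j \<in> elems (Fm Z)" "\<And>j. j \<in> J \<Longrightarrow> v j \<in> elems D" using J u v by (auto intro: finite_subset)
    have "csum D v J = csum D (\<lambda>j. \<theta> (?u j)) J"
      using fJ by (intro csum_cong[OF comm_monoid_D]) (auto simp: \<theta>_\<theta>')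
    also have "\<dots> = \<theta> (csum (Fm Z) ?u J)" using fJ(1,2) by (rule csum_\<theta>)
    finally have s: "csum D v J = \<theta> (csum (Fm Z) ?u J)" .
    have cJ: "csum (Fm Z) ?u J \<in> elems (Fm Z)" using fJ by (intro csum_closed[OF comm_monoid_Fm[OF Z]]) auto
    show "cadd D y (csum D v J) = \<theta> (?z J)"
      using \<theta>_add[OF x cJ] \<theta>_\<theta>'[OF y] s by (simp add: Fm_simps[OF Z])
    show "?z J \<in> elems (Fm Z)" using Fm_add(1)[OF Z x cJ] by (simp add: Fm_simps[OF Z])
  qed
  have cz: "?z {1..n} \<in> unit_ball (Fm Z)"
    using c zD[of "{1..n}"] unit_ball_D_iff[OF \<theta>_elem, of "?z {1..n}"] \<theta>'_\<theta> by (simp add: unit_ball_Fm[OF Z])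
  have z: "?z J \<in> cliques Z" if J: "J \<subseteq> {1..n}" for J
  proof -
    have fJ: "finite J" "\<And>j. j \<in> J \<Longrightarrow> ?u j \<in> elems (Fm Z)" using J u by (auto intro: finite_subset)
    have "(\<lambda>a. \<theta>' y a + (\<Sum>i\<in>{1..n}. ?u i a)) \<in> cliques Z"
      using cz csum_Fm(1)[OF Z, of "{1..n}" ?u] u by (simp add: Fm_simps[OF Z] unit_ball_Fm[OF Z])
    from partial_sum_clique[OF Z x u this J] show ?thesis
      using csum_Fm(1)[OF Z fJ] by (simp add: Fm_simps[OF Z])
  qed
  have eq: "csum (Fm Z) (\<lambda>J. (\<lambda>y\<in>unit_ball D. \<theta>' y) (cadd D y (csum D v J))) S = csum (Fm Z) (\<lambda>J. cstab_id (Fm Z) (?z J)) S"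
    if S: "S \<subseteq> Pow {1..n}" for S
  proof (rule csum_cong[OF comm_monoid_Fm[OF Z]])
    fix J assume "J \<in> S"
    then have J: "J \<subseteq> {1..n}" using S by blast
    have id: "cstab_id (Fm Z) (?z J) = ?z J" using z[OF J] by (simp add: cstab_id_def unit_ball_Fm[OF Z])
    show "(\<lambda>y\<in>unit_ball D. \<theta>' y) (cadd D y (csum D v J)) = cstab_id (Fm Z) (?z J)"
      unfolding id zD(1)[OF J] using \<theta>_ball[OF z[OF J]] \<theta>'_\<theta>[OF zD(2)[OF J]] by simp
    show "cstab_id (Fm Z) (?z J) \<in> elems (Fm Z)" unfolding id by (rule zD(2)[OF J])
  qed
  have sub: "?O \<subseteq> Pow {1..n}" "?E \<subseteq> Pow {1..n}" by auto
  show "cle (Fm Z) (csum (Fm Z) (\<lambda>J. (\<lambda>y\<in>unit_ball D. \<theta>' y) (cadd D y (csum D v J))) ?O)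
      (csum (Fm Z) (\<lambda>J. (\<lambda>y\<in>unit_ball D. \<theta>' y) (cadd D y (csum D v J))) ?E)"
    unfolding eq[OF sub(1)] eq[OF sub(2)]
    using x u cz by (intro identity_pre_stable[unfolded pre_stable_def, rule_format]) simp
qed

lemma stable_\<theta>: "stable (Fm Z) D (\<lambda>x\<in>cliques Z. \<theta> x)"
  unfolding stable_def unit_ball_Fm[OF Z]
proof (intro conjI allI impI; (elim conjE)?)
  show "(\<lambda>x\<in>cliques Z. \<theta> x) \<in> cliques Z \<rightarrow>\<^sub>E elems D" using \<theta>_elem clique_elem[OF Z] by auto
  show "\<exists>B. \<forall>x\<in>cliques Z. cnorm D ((\<lambda>x\<in>cliques Z. \<theta> x) x) \<le> B"
    using \<theta>_ball by (intro exI[of _ 1]) (auto simp: unit_ball_def)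
next
  fix x s assume nd: "nondecreasing (Fm Z) x" and r: "range x \<subseteq> cliques Z" and l: "is_seq_lub (Fm Z) x s"
  have x: "x n \<in> cliques Z" "x n \<in> elems (Fm Z)" for n using r clique_elem[OF Z] by auto
  have s: "s \<in> cliques Z" "s \<in> elems (Fm Z)"
  proof -
    show "s \<in> elems (Fm Z)" using l by (simp add: is_seq_lub_def)
    show "s \<in> cliques Z"
      using nd l is_seq_lub_Fm_iff[OF Z nd] x(1) by (intro clique_tendsto[OF Z, of x s]) (auto simp: nondecreasing_Fm_iff[OF Z])
  qed
  have "is_seq_lub D (\<lambda>n. \<theta> (x n)) (\<theta> s)"
    using l x s by (subst is_seq_lub_D_iff) (auto simp: \<theta>_elem \<theta>'_\<theta>)
  then show "is_seq_lub D (\<lambda>n. (\<lambda>x\<in>cliques Z. \<theta> x) (x n)) ((\<lambda>x\<in>cliques Z. \<theta> x) s)" using x s by simp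
qed (rule pre_stable_\<theta>)

lemma stable_\<theta>': "stable D (Fm Z) (\<lambda>y\<in>unit_ball D. \<theta>' y)"
  unfolding stable_def
proof (intro conjI allI impI; (elim conjE)?)
  show "(\<lambda>y\<in>unit_ball D. \<theta>' y) \<in> unit_ball D \<rightarrow>\<^sub>E elems (Fm Z)" using \<theta>'_elem ball_D_elem by auto
  show "\<exists>B. \<forall>y\<in>unit_ball D. cnorm (Fm Z) ((\<lambda>y\<in>unit_ball D. \<theta>' y) y) \<le> B"
    using \<theta>'_ball unit_ball_Fm[OF Z] by (intro exI[of _ 1]) (auto simp: unit_ball_def)
next
  fix x s assume nd: "nondecreasing D x" and r: "range x \<subseteq> unit_ball D" and l: "is_seq_lub D x s"
  have x: "x n \<in> unit_ball D" "x n \<in> elems D" for n using r ball_D_elem by auto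
  have s: "s \<in> elems D" using l by (simp add: is_seq_lub_def)
  have lZ: "is_seq_lub (Fm Z) (\<lambda>n. \<theta>' (x n)) (\<theta>' s)" using l is_seq_lub_D_iff[OF x(2) s] by simp
  have nZ: "nondecreasing (Fm Z) (\<lambda>n. \<theta>' (x n))" using nd nondecreasing_D_iff[of x] x by simp
  have "\<theta>' s \<in> cliques Z"
  proof (rule clique_tendsto[OF Z, of "\<lambda>n. \<theta>' (x n)"])
    show "\<theta>' (x n) \<in> cliques Z" for n by (rule \<theta>'_ball[OF x(1)])
    show "\<theta>' (x n) a \<le> \<theta>' (x (Suc n)) a" for n a using nZ unfolding nondecreasing_Fm_iff[OF Z] by blast
    show "(\<lambda>n. \<theta>' (x n) a) \<longlonglongrightarrow> \<theta>' s a" for a using lZ unfolding is_seq_lub_Fm_iff[OF Z nZ] by blast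
  qed
  then have "s \<in> unit_ball D" using unit_ball_D_iff[OF s] by simp
  then show "is_seq_lub (Fm Z) (\<lambda>n. (\<lambda>y\<in>unit_ball D. \<theta>' y) (x n)) ((\<lambda>y\<in>unit_ball D. \<theta>' y) s)" using x lZ by simp
qed (rule pre_stable_\<theta>')

text \<open>What a linear isometry cannot provide is assumed: the axioms on the tests of
  \<open>D\<close>, with linearity and Scott continuity pulled back to \<open>Fm Z\<close>, and
  preservation of measurable paths in both directions.\<close>

theorem cstab_iso_D:
  assumes scott: "\<forall>n. \<forall>l\<in>tests D n. \<forall>r\<in>space (Rn n). linear_scott (Fm Z) (\<lambda>x. l r (\<theta> x))"
    and zero: "\<forall>n. \<exists>l\<in>tests D n. \<forall>r\<in>space (Rn n). \<forall>x\<in>elems D. l r x = 0"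
    and precomp: "\<forall>m n. \<forall>l\<in>tests D n. \<forall>h\<in>measurable (Rn m) (Rn n).
        \<exists>l'\<in>tests D m. \<forall>r\<in>space (Rn m). \<forall>x\<in>elems D. l' r x = l (h r) x"
    and meas: "\<forall>n. \<forall>l\<in>tests D n. \<forall>x\<in>elems D. (\<lambda>r. l r x) \<in> borel_measurable (Rn n)"
    and path: "\<And>n \<gamma>. unitary_path (Fm Z) n \<gamma> \<Longrightarrow> meas_path D n (\<lambda>s. \<theta> (\<gamma> s))"
    and path': "\<And>n \<gamma>. unitary_path D n \<gamma> \<Longrightarrow> meas_path (Fm Z) n (\<lambda>s. \<theta>' (\<gamma> s))"
  shows "cstab_iso (Fm Z) D (\<lambda>x\<in>cliques Z. \<theta> x)"
proof -
  have D: "measurable_cone D"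
    unfolding measurable_cone_def
  proof (intro conjI is_cone_D seq_complete_D zero precomp meas)
    show "\<forall>n. \<forall>l\<in>tests D n. \<forall>r\<in>space (Rn n). linear_scott D (l r)" using scott by (auto intro!: linear_scott_D)
  qed
  have "meas_path D n (\<lambda>s. (\<lambda>x\<in>cliques Z. \<theta> x) (\<gamma> s))" if \<gamma>: "unitary_path (Fm Z) n \<gamma>" for n \<gamma>
    using path[OF \<gamma>] \<gamma> by (subst meas_path_cong[where \<gamma>' = "\<lambda>s. \<theta> (\<gamma> s)"]) (auto simp: unitary_path_def unit_ball_Fm[OF Z])
  then have f: "(\<lambda>x\<in>cliques Z. \<theta> x) \<in> cstab_hom (Fm Z) D"
    using stable_\<theta> \<theta>_ball by (simp add: cstab_hom_def meas_stable_def unit_ball_Fm[OF Z])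
  have "meas_path (Fm Z) n (\<lambda>s. (\<lambda>y\<in>unit_ball D. \<theta>' y) (\<gamma> s))" if \<gamma>: "unitary_path D n \<gamma>" for n \<gamma>
    using path'[OF \<gamma>] \<gamma> by (subst meas_path_cong[where \<gamma>' = "\<lambda>s. \<theta>' (\<gamma> s)"]) (auto simp: unitary_path_def)
  then have g: "(\<lambda>y\<in>unit_ball D. \<theta>' y) \<in> cstab_hom D (Fm Z)"
    using stable_\<theta>' \<theta>'_ball by (simp add: cstab_hom_def meas_stable_def unit_ball_Fm[OF Z])
  have "cstab_comp (Fm Z) (\<lambda>y\<in>unit_ball D. \<theta>' y) (\<lambda>x\<in>cliques Z. \<theta> x) = cstab_id (Fm Z)"
    using \<theta>_ball \<theta>'_\<theta>[OF clique_elem[OF Z]] by (auto simp: cstab_comp_def compose_def cstab_id_def unit_ball_Fm[OF Z] fun_eq_iff)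
  moreover have "cstab_comp D (\<lambda>x\<in>cliques Z. \<theta> x) (\<lambda>y\<in>unit_ball D. \<theta>' y) = cstab_id D"
    using \<theta>'_ball \<theta>_\<theta>'[OF ball_D_elem] by (auto simp: cstab_comp_def compose_def cstab_id_def fun_eq_iff)
  ultimately show ?thesis using D f g measurable_cone_Fm[OF Z] unfolding cstab_iso_def by blast
qed

end

text \<open>\<open>Fm_norm_le_iff\<close> gives access to norms only through their positive upper
  bounds; these determine a nonnegative number.\<close>

lemma eq_if_same_upper_bounds:
  fixes a b :: real
  assumes "0 \<le> a" "0 \<le> b" "\<And>c. 0 < c \<Longrightarrow> a \<le> c \<longleftrightarrow> b \<le> c"
  shows "a = b"
proof (rule antisym)
  show "a \<le> b"
  proof (rule field_le_epsilon)
    fix e :: real assume "0 < e"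
    then show "a \<le> b + e" using assms(2) assms(3)[of "b + e"] by simp
  qed
  show "b \<le> a"
  proof (rule field_le_epsilon)
    fix e :: real assume "0 < e"
    then show "b \<le> a + e" using assms(1) assms(3)[of "a + e"] by simp
  qed
qed

section \<open>Finite products\<close>

context
  fixes I :: "'i set" and Xs :: "'i \<Rightarrow> 'd pcs"
  assumes I: "finite I" and Xs: "\<And>i. i \<in> I \<Longrightarrow> is_pcs (Xs i)"
begin

text \<open>Dual vectors of a single component, extended by 0, so that each one tests that component
  alone.\<close>

definition prod_tests :: "('i \<times> 'd \<Rightarrow> real) set" where
  "prod_tests = {\<lambda>(j, a). if j = i then v a else 0 | i v. i \<in> I \<and> v \<in> pdual (web (Xs i)) (cliques (Xs i))}"

lemma prod_tests_nnvecs: "prod_tests \<subseteq> nnvecs (SIGMA i:I. web (Xs i))"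
  by (auto simp: prod_tests_def nnvecs_def dest: dual_nonneg dual_outside)

lemma esum_component:
  assumes i: "i \<in> I"
  shows "esum (SIGMA i:I. web (Xs i)) (\<lambda>p. x p * (case p of (j, a) \<Rightarrow> if j = i then v a else 0))
    = esum (web (Xs i)) (\<lambda>a. x (i, a) * v a)"
proof -
  have "esum (SIGMA i:I. web (Xs i)) (\<lambda>p. x p * (case p of (j, a) \<Rightarrow> if j = i then v a else 0))
     = esum (Pair i ` web (Xs i)) (\<lambda>p. x p * (case p of (j, a) \<Rightarrow> if j = i then v a else 0))"
    using i by (intro nn_integral_count_space_eq) (auto split: if_splits)
  also have "\<dots> = (\<integral>\<^sup>+a. ennreal ((\<lambda>p. x p * (case p of (j, a) \<Rightarrow> if j = i then v a else 0)) (Pair i a)) \<partial>count_space (web (Xs i)))"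
    by (rule nn_integral_bij_count_space[symmetric]) (auto simp: bij_betw_def inj_on_def)
  finally show ?thesis by simp
qed

lemma prod_cliques_eq_pdual: "cliques (pcs_prod I Xs) = pdual (SIGMA i:I. web (Xs i)) prod_tests"
proof (intro equalityI subsetI)
  fix x assume x: "x \<in> cliques (pcs_prod I Xs)"
  then have xn: "x \<in> nnvecs (SIGMA i:I. web (Xs i))" and xi: "\<And>i. i \<in> I \<Longrightarrow> (\<lambda>a. x (i, a)) \<in> cliques (Xs i)"
    by (auto simp: pcs_prod_def)
  show "x \<in> pdual (SIGMA i:I. web (Xs i)) prod_tests"
    unfolding pdual_iff[OF prod_tests_nnvecs]
  proof (intro conjI ballI xn)
    fix t assume "t \<in> prod_tests"
    then obtain i v where i: "i \<in> I" and v: "v \<in> pdual (web (Xs i)) (cliques (Xs i))"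
      and t: "t = (\<lambda>(j, a). if j = i then v a else 0)" unfolding prod_tests_def by blast
    show "esum (SIGMA i:I. web (Xs i)) (\<lambda>p. x p * t p) \<le> 1"
      unfolding t esum_component[OF i] using xi[OF i] v unfolding clique_iff[OF Xs[OF i]] by blast
  qed
next
  fix x assume "x \<in> pdual (SIGMA i:I. web (Xs i)) prod_tests"
  then have xn: "x \<in> nnvecs (SIGMA i:I. web (Xs i))"
    and xt: "\<And>t. t \<in> prod_tests \<Longrightarrow> esum (SIGMA i:I. web (Xs i)) (\<lambda>p. x p * t p) \<le> 1"
    unfolding pdual_iff[OF prod_tests_nnvecs] by auto
  have "(\<lambda>a. x (i, a)) \<in> cliques (Xs i)" if i: "i \<in> I" for i
    unfolding clique_iff[OF Xs[OF i]]
  proof (intro conjI ballI)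
    show "(\<lambda>a. x (i, a)) \<in> nnvecs (web (Xs i))" using xn i by (auto simp: nnvecs_def)
    fix v assume v: "v \<in> pdual (web (Xs i)) (cliques (Xs i))"
    have "(\<lambda>(j, a). if j = i then v a else 0) \<in> prod_tests" unfolding prod_tests_def using i v by blast
    from xt[OF this] show "esum (web (Xs i)) (\<lambda>a. x (i, a) * v a) \<le> 1" unfolding esum_component[OF i] .
  qed
  then show "x \<in> cliques (pcs_prod I Xs)" using xn by (simp add: pcs_prod_def)
qed

lemma is_pcs_prod: "is_pcs (pcs_prod I Xs)"
  unfolding is_pcs_def
proof (intro conjI ballI)
  show "countable (web (pcs_prod I Xs))"
    using I countable_web[OF Xs] by (simp add: pcs_prod_def countable_finite)
  show "cliques (pcs_prod I Xs) \<subseteq> nnvecs (web (pcs_prod I Xs))" by (auto simp: pcs_prod_def)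
  have w: "web (pcs_prod I Xs) = (SIGMA i:I. web (Xs i))" by (simp add: pcs_prod_def)
  show "pdual (web (pcs_prod I Xs)) (pdual (web (pcs_prod I Xs)) (cliques (pcs_prod I Xs))) = cliques (pcs_prod I Xs)"
    unfolding w prod_cliques_eq_pdual by (rule pdual_pdual_pdual[OF prod_tests_nnvecs])
next
  fix p assume "p \<in> web (pcs_prod I Xs)"
  then obtain i a where p: "p = (i, a)" "i \<in> I" "a \<in> web (Xs i)" by (auto simp: pcs_prod_def)
  obtain d where d: "d > 0" "(\<lambda>b. if b = a then d else 0) \<in> cliques (Xs i)" using Xs[OF p(2)] p(3) by (auto simp: is_pcs_def)
  have "(\<lambda>b. if (j, b) = p then d else 0) \<in> cliques (Xs j)" if "j \<in> I" for j
    using d clique_zero[OF Xs[OF that]] by (cases "j = i") (auto simp: p)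
  then have "(\<lambda>q. if q = p then d else 0) \<in> cliques (pcs_prod I Xs)"
    using d p by (auto simp: pcs_prod_def nnvecs_def)
  then show "\<exists>c>0. (\<lambda>q. if q = p then c else 0) \<in> cliques (pcs_prod I Xs)" using d by blast
  obtain B where "\<And>u. u \<in> cliques (Xs i) \<Longrightarrow> u a \<le> B" using clique_bound[OF Xs[OF p(2)] p(3)] by blast
  then have "x p \<le> B" if "x \<in> cliques (pcs_prod I Xs)" for x
  proof -
    have "(\<lambda>a. x (i, a)) \<in> cliques (Xs i)" using that p(2) by (simp add: pcs_prod_def)
    then show ?thesis using \<open>\<And>u. u \<in> cliques (Xs i) \<Longrightarrow> u a \<le> B\<close> p(1) by force
  qed
  then show "\<exists>B. \<forall>x\<in>cliques (pcs_prod I Xs). x p \<le> B" by blast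
qed

definition untuple :: "('i \<Rightarrow> 'd \<Rightarrow> real) \<Rightarrow> 'i \<times> 'd \<Rightarrow> real" where
  "untuple y = (\<lambda>(i, a). if i \<in> I then y i a else 0)"

lemma prod_clique_iff:
  "x \<in> cliques (pcs_prod I Xs) \<longleftrightarrow> (\<forall>i\<in>I. (\<lambda>a. x (i, a)) \<in> cliques (Xs i)) \<and> (\<forall>i a. i \<notin> I \<longrightarrow> x (i, a) = 0)"
proof
  assume "x \<in> cliques (pcs_prod I Xs)"
  then show "(\<forall>i\<in>I. (\<lambda>a. x (i, a)) \<in> cliques (Xs i)) \<and> (\<forall>i a. i \<notin> I \<longrightarrow> x (i, a) = 0)"
    by (auto simp: pcs_prod_def nnvecs_def)
next
  assume r: "(\<forall>i\<in>I. (\<lambda>a. x (i, a)) \<in> cliques (Xs i)) \<and> (\<forall>i a. i \<notin> I \<longrightarrow> x (i, a) = 0)"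
  have "0 \<le> x (i, a)" if "i \<in> I" for i a using clique_nonneg[OF Xs[OF that]] r that by force
  moreover have "x (i, a) = 0" if "i \<in> I \<longrightarrow> a \<notin> web (Xs i)" for i a
  proof (cases "i \<in> I")
    case True
    then have "(\<lambda>a. x (i, a)) \<in> cliques (Xs i)" using r by blast
    from clique_outside[OF Xs[OF True] this] show ?thesis using that True by simp
  qed (use r in blast)
  ultimately have "x \<in> nnvecs (SIGMA i:I. web (Xs i))" by (auto simp: nnvecs_def)
  then show "x \<in> cliques (pcs_prod I Xs)" using r by (simp add: pcs_prod_def)
qed

lemma prod_elem_iff:
  "x \<in> elems (Fm (pcs_prod I Xs)) \<longleftrightarrow> (\<forall>i\<in>I. (\<lambda>a. x (i, a)) \<in> elems (Fm (Xs i))) \<and> (\<forall>i a. i \<notin> I \<longrightarrow> x (i, a) = 0)"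
proof
  assume "x \<in> elems (Fm (pcs_prod I Xs))"
  then obtain c where c: "c > 0" "\<forall>i\<in>I. (\<lambda>a. x (i, a) / c) \<in> cliques (Xs i)" "\<forall>i a. i \<notin> I \<longrightarrow> x (i, a) / c = 0"
    unfolding Fm_elem_iff[OF is_pcs_prod] prod_clique_iff by blast
  have "(\<lambda>a. x (i, a)) \<in> elems (Fm (Xs i))" if "i \<in> I" for i
    unfolding Fm_elem_iff[OF Xs[OF that]] using c that by blast
  then show "(\<forall>i\<in>I. (\<lambda>a. x (i, a)) \<in> elems (Fm (Xs i))) \<and> (\<forall>i a. i \<notin> I \<longrightarrow> x (i, a) = 0)"
    using c by auto
next
  assume r: "(\<forall>i\<in>I. (\<lambda>a. x (i, a)) \<in> elems (Fm (Xs i))) \<and> (\<forall>i a. i \<notin> I \<longrightarrow> x (i, a) = 0)"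
  have "\<exists>c>0. (\<lambda>a. x (i, a) / c) \<in> cliques (Xs i)" if "i \<in> I" for i
    using r that Fm_elem_iff[OF Xs[OF that], of "\<lambda>a. x (i, a)"] by blast
  then obtain c where c: "\<And>i. i \<in> I \<Longrightarrow> c i > 0" "\<And>i. i \<in> I \<Longrightarrow> (\<lambda>a. x (i, a) / c i) \<in> cliques (Xs i)" by metis
  \<comment> \<open>A common divisor for the finitely many components: it dominates every
    \<open>c i\<close>, and the 1 keeps it positive when \<open>I\<close> is empty.\<close>
  define d where "d = 1 + (\<Sum>i\<in>I. c i)"
  have "0 \<le> (\<Sum>i\<in>I. c i)" using c(1) by (intro sum_nonneg) (simp add: less_imp_le)
  then have d: "d > 0" by (simp add: d_def)
  have cd: "c i \<le> d" if "i \<in> I" for i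
    using member_le_sum[OF that, of c] c(1) I by (simp add: d_def less_imp_le)
  have "(\<lambda>p. x p / d) \<in> cliques (pcs_prod I Xs)"
    unfolding prod_clique_iff
  proof (intro conjI ballI allI impI)
    show "(\<lambda>a. x (i, a) / d) \<in> cliques (Xs i)" if i: "i \<in> I" for i
      by (rule clique_div_mono[OF Xs[OF i] c(2)[OF i] c(1)[OF i] cd[OF i]])
  qed (use r in simp)
  then show "x \<in> elems (Fm (pcs_prod I Xs))" unfolding Fm_elem_iff[OF is_pcs_prod] using d by blast
qed

abbreviation (input) "ptuple \<equiv> (\<lambda>x. \<lambda>i\<in>I. \<lambda>a. x (i, a))"
abbreviation (input) "prod_cone \<equiv> cone_prod I (\<lambda>i. Fm (Xs i))"

lemma untuple_elem: "y \<in> elems prod_cone \<Longrightarrow> untuple y \<in> elems (Fm (pcs_prod I Xs))"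
  by (auto simp: prod_elem_iff untuple_def cone_prod_def)

lemma ptuple_elem: "x \<in> elems (Fm (pcs_prod I Xs)) \<Longrightarrow> ptuple x \<in> elems prod_cone"
  by (auto simp: prod_elem_iff cone_prod_def)

lemma ptuple_norm:
  assumes x: "x \<in> elems (Fm (pcs_prod I Xs))"
  shows "cnorm prod_cone (ptuple x) = cnorm (Fm (pcs_prod I Xs)) x"
proof (rule eq_if_same_upper_bounds)
  show "0 \<le> cnorm prod_cone (ptuple x)" using I by (simp add: cone_prod_def Max_ge_iff)
  show "0 \<le> cnorm (Fm (pcs_prod I Xs)) x" by (rule Fm_norm_nonneg[OF is_pcs_prod x])
  fix c :: real assume c: "0 < c"
  have xi: "(\<lambda>a. x (i, a)) \<in> elems (Fm (Xs i))" if "i \<in> I" for i using x that prod_elem_iff by blast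
  have x0: "\<forall>i a. i \<notin> I \<longrightarrow> x (i, a) = 0" using x prod_elem_iff by blast
  have "cnorm prod_cone (ptuple x) \<le> c \<longleftrightarrow> (\<forall>i\<in>I. cnorm (Fm (Xs i)) (\<lambda>a. x (i, a)) \<le> c)"
    using I c by (auto simp: cone_prod_def)
  also have "\<dots> \<longleftrightarrow> (\<forall>i\<in>I. (\<lambda>a. x (i, a) / c) \<in> cliques (Xs i))"
    using Fm_norm_le_iff[OF Xs xi c] by simp
  also have "\<dots> \<longleftrightarrow> (\<lambda>p. x p / c) \<in> cliques (pcs_prod I Xs)"
    unfolding prod_clique_iff using x0 by simp
  also have "\<dots> \<longleftrightarrow> cnorm (Fm (pcs_prod I Xs)) x \<le> c" using Fm_norm_le_iff[OF is_pcs_prod x c] by simp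
  finally show "cnorm prod_cone (ptuple x) \<le> c \<longleftrightarrow> cnorm (Fm (pcs_prod I Xs)) x \<le> c" .
qed

lemma cone_isometry_prod: "cone_isometry (pcs_prod I Xs) prod_cone ptuple untuple"
proof
  show "is_pcs (pcs_prod I Xs)" by (rule is_pcs_prod)
  show "ptuple x \<in> elems prod_cone" if "x \<in> elems (Fm (pcs_prod I Xs))" for x using that by (rule ptuple_elem)
  show "untuple y \<in> elems (Fm (pcs_prod I Xs))" if "y \<in> elems prod_cone" for y using that by (rule untuple_elem)
  show "cnorm prod_cone (ptuple x) = cnorm (Fm (pcs_prod I Xs)) x" if "x \<in> elems (Fm (pcs_prod I Xs))" for x
    using that by (rule ptuple_norm)
  show "untuple (ptuple x) = x" if "x \<in> elems (Fm (pcs_prod I Xs))" for x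
    using that by (auto simp: prod_elem_iff untuple_def fun_eq_iff)
  show "ptuple (untuple y) = y" if "y \<in> elems prod_cone" for y
    using that by (auto simp: cone_prod_def untuple_def fun_eq_iff PiE_def extensional_def)
qed (auto simp: cone_prod_def Fm_def fun_eq_iff)

lemma linear_scott_sum:
  assumes "is_pcs Z" "finite J" "\<And>j. j \<in> J \<Longrightarrow> l j = (\<lambda>x. 0) \<or> (\<exists>a. l j = (\<lambda>x. x a))"
  shows "linear_scott (Fm Z) (\<lambda>x. \<Sum>j\<in>J. l j x)"
  unfolding linear_scott_def Fm_simps[OF assms(1)]
proof (intro conjI ballI allI impI; (elim conjE)?)
  fix x assume x: "x \<in> elems (Fm Z)"
  show "0 \<le> (\<Sum>j\<in>J. l j x)" using assms(3) Fm_elem_nonneg[OF assms(1) x] by (intro sum_nonneg) force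
  show "(\<Sum>j\<in>J. l j (\<lambda>a. \<alpha> * x a)) = \<alpha> * (\<Sum>j\<in>J. l j x)" for \<alpha>
    unfolding sum_distrib_left using assms(3) by (intro sum.cong) force+
  show "(\<Sum>j\<in>J. l j (\<lambda>a. x a + y a)) = (\<Sum>j\<in>J. l j x) + (\<Sum>j\<in>J. l j y)" for y
    unfolding sum.distrib[symmetric] using assms(3) by (intro sum.cong) force+
next
  fix x s assume nd: "nondecreasing (Fm Z) x" and L: "is_seq_lub (Fm Z) x s"
  have inc: "incseq (\<lambda>n. \<Sum>j\<in>J. l j (x n))"
  proof (intro incseq_SucI sum_mono)
    fix n j assume "j \<in> J"
    then show "l j (x n) \<le> l j (x (Suc n))" using assms(3)[of j] nd by (auto simp: nondecreasing_Fm_iff[OF assms(1)])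
  qed
  have lim: "(\<lambda>n. \<Sum>j\<in>J. l j (x n)) \<longlonglongrightarrow> (\<Sum>j\<in>J. l j s)"
  proof (rule tendsto_sum)
    fix j assume "j \<in> J"
    then show "(\<lambda>n. l j (x n)) \<longlonglongrightarrow> l j s"
      using assms(3)[of j] L is_seq_lub_Fm_iff[OF assms(1) nd] by auto
  qed
  show b: "bdd_above (range (\<lambda>n. \<Sum>j\<in>J. l j (x n)))"
    using incseq_le[OF inc lim] by (auto intro!: bdd_aboveI[of _ "\<Sum>j\<in>J. l j s"])
  show "(\<Sum>j\<in>J. l j s) = (SUP n. \<Sum>j\<in>J. l j (x n))"
    using LIMSEQ_incseq_SUP[OF b inc] lim LIMSEQ_unique by blast
qed

text \<open>Tests of \<open>Fm\<close> do not depend on the real parameters, so a test of the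
  product is a fixed finite sum of coordinates and zeros; precomposition and measurability then
  become immediate.\<close>

lemma tests_prod_cone:
  assumes "l \<in> tests prod_cone n"
  shows "\<exists>m. l = (\<lambda>r x. \<Sum>i\<in>I. m i (x i)) \<and> (\<forall>i\<in>I. m i = (\<lambda>x. 0) \<or> (\<exists>a\<in>web (Xs i). m i = (\<lambda>x. x a)))"
proof -
  obtain l' where l: "l = (\<lambda>r x. \<Sum>i\<in>I. l' i r (x i))" "\<And>i. i \<in> I \<Longrightarrow> l' i \<in> tests (Fm (Xs i)) n"
    using assms by (auto simp: cone_prod_def)
  have "\<exists>m. l' i = (\<lambda>r. m) \<and> (m = (\<lambda>x. 0) \<or> (\<exists>a\<in>web (Xs i). m = (\<lambda>x. x a)))" if "i \<in> I" for i
    using l(2)[OF that] by (auto simp: Fm_simps[OF Xs[OF that]])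
  then obtain m where m: "\<And>i. i \<in> I \<Longrightarrow> l' i = (\<lambda>r. m i)" "\<And>i. i \<in> I \<Longrightarrow> m i = (\<lambda>x. 0) \<or> (\<exists>a\<in>web (Xs i). m i = (\<lambda>x. x a))"
    by metis
  have "l = (\<lambda>r x. \<Sum>i\<in>I. m i (x i))" unfolding l(1) by (intro ext sum.cong) (auto simp: m(1))
  then show ?thesis using m(2) by blast
qed

lemma tests_prod_coneI:
  assumes "\<And>i. i \<in> I \<Longrightarrow> m i = (\<lambda>x. 0) \<or> (\<exists>a\<in>web (Xs i). m i = (\<lambda>x. x a))"
  shows "(\<lambda>r x. \<Sum>i\<in>I. m i (x i)) \<in> tests prod_cone n"
proof -
  have "\<forall>i\<in>I. (\<lambda>r. m i) \<in> tests (Fm (Xs i)) n" using assms by (fastforce simp: Fm_simps[OF Xs])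
  then show ?thesis unfolding cone_prod_def by (auto intro!: exI[of _ "\<lambda>i r. m i"])
qed

lemma cstab_iso_prod: "cstab_iso (Fm (pcs_prod I Xs)) prod_cone (prod_map I Xs)"
proof -
  interpret cone_isometry "pcs_prod I Xs" prod_cone ptuple untuple by (rule cone_isometry_prod)
  have "cstab_iso (Fm (pcs_prod I Xs)) prod_cone (\<lambda>x\<in>cliques (pcs_prod I Xs). ptuple x)"
  proof (rule cstab_iso_D)
    show "\<forall>n. \<forall>l\<in>tests prod_cone n. \<forall>r\<in>space (Rn n). linear_scott (Fm (pcs_prod I Xs)) (\<lambda>x. l r (ptuple x))"
    proof (intro allI ballI)
      fix n l r assume "l \<in> tests prod_cone n"
      then obtain m where m: "l = (\<lambda>r x. \<Sum>i\<in>I. m i (x i))" "\<forall>i\<in>I. m i = (\<lambda>x. 0) \<or> (\<exists>a\<in>web (Xs i). m i = (\<lambda>x. x a))"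
        using tests_prod_cone by blast
      have "(\<lambda>x. l r (ptuple x)) = (\<lambda>x. \<Sum>i\<in>I. m i (\<lambda>a. x (i, a)))" unfolding m(1) by (intro ext sum.cong) auto
      moreover have "linear_scott (Fm (pcs_prod I Xs)) (\<lambda>x. \<Sum>i\<in>I. m i (\<lambda>a. x (i, a)))"
        using m(2) by (intro linear_scott_sum[OF is_pcs_prod I, of "\<lambda>i x. m i (\<lambda>a. x (i, a))"]) fastforce
      ultimately show "linear_scott (Fm (pcs_prod I Xs)) (\<lambda>x. l r (ptuple x))" by simp
    qed
  next
    show "\<forall>n. \<forall>l\<in>tests prod_cone n. \<forall>x\<in>elems prod_cone. (\<lambda>r. l r x) \<in> borel_measurable (Rn n)"
      using tests_prod_cone by fastforce
  next
    show "\<forall>k n. \<forall>l\<in>tests prod_cone n. \<forall>h\<in>measurable (Rn k) (Rn n).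
        \<exists>l'\<in>tests prod_cone k. \<forall>r\<in>space (Rn k). \<forall>x\<in>elems prod_cone. l' r x = l (h r) x"
    proof (intro allI ballI)
      fix k n l and h :: "(nat \<Rightarrow> real) \<Rightarrow> nat \<Rightarrow> real" assume "l \<in> tests prod_cone n"
      then obtain m where m: "l = (\<lambda>r x. \<Sum>i\<in>I. m i (x i))" "\<forall>i\<in>I. m i = (\<lambda>x. 0) \<or> (\<exists>a\<in>web (Xs i). m i = (\<lambda>x. x a))"
        using tests_prod_cone by blast
      show "\<exists>l'\<in>tests prod_cone k. \<forall>r\<in>space (Rn k). \<forall>x\<in>elems prod_cone. l' r x = l (h r) x"
        using tests_prod_coneI[of m] m by (intro bexI[of _ "\<lambda>r x. \<Sum>i\<in>I. m i (x i)"]) auto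
    qed
  next
    show "\<forall>n. \<exists>l\<in>tests prod_cone n. \<forall>r\<in>space (Rn n). \<forall>x\<in>elems prod_cone. l r x = 0"
      using tests_prod_coneI[of "\<lambda>i x. 0"] by (intro allI bexI[of _ "\<lambda>r x. \<Sum>i\<in>I. (\<lambda>i x. 0) i (x i)"]) auto
  next
    fix n \<gamma> assume \<gamma>: "unitary_path (Fm (pcs_prod I Xs)) n \<gamma>"
    then have g: "\<And>s. s \<in> space (Rn n) \<Longrightarrow> \<gamma> s \<in> cliques (pcs_prod I Xs)" and gm: "\<And>p. (\<lambda>s. \<gamma> s p) \<in> borel_measurable (Rn n)"
      unfolding unitary_path_Fm_iff[OF is_pcs_prod] by auto
    show "meas_path prod_cone n (\<lambda>s. ptuple (\<gamma> s))"
      unfolding meas_path_def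
    proof (intro conjI ballI allI)
      show "ptuple (\<gamma> s) \<in> elems prod_cone" if "s \<in> space (Rn n)" for s
        by (rule ptuple_elem[OF clique_elem[OF is_pcs_prod g[OF that]]])
      show "\<exists>B. \<forall>s\<in>space (Rn n). cnorm prod_cone (ptuple (\<gamma> s)) \<le> B"
        using \<theta>_ball[OF g] by (intro exI[of _ 1]) (auto simp: unit_ball_def)
      fix k l assume "l \<in> tests prod_cone k"
      then obtain m where m: "l = (\<lambda>r x. \<Sum>i\<in>I. m i (x i))" "\<forall>i\<in>I. m i = (\<lambda>x. 0) \<or> (\<exists>a\<in>web (Xs i). m i = (\<lambda>x. x a))"
        using tests_prod_cone by blast
      have "(\<lambda>p. \<Sum>i\<in>I. m i (ptuple (\<gamma> (snd p)) i)) \<in> borel_measurable (Rn k \<Otimes>\<^sub>M Rn n)"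
      proof (rule borel_measurable_sum)
        fix i assume i: "i \<in> I"
        have "(\<lambda>p. \<gamma> (snd p) (i, a)) \<in> borel_measurable (Rn k \<Otimes>\<^sub>M Rn n)" for a
          by (rule measurable_compose[OF measurable_snd gm])
        then show "(\<lambda>p. m i (ptuple (\<gamma> (snd p)) i)) \<in> borel_measurable (Rn k \<Otimes>\<^sub>M Rn n)" using m(2) i by auto
      qed
      then show "(\<lambda>(r, s). l r (ptuple (\<gamma> s))) \<in> borel_measurable (Rn k \<Otimes>\<^sub>M Rn n)"
        by (simp add: m(1) case_prod_beta)
    qed
  next
    fix n \<gamma> assume \<gamma>: "unitary_path prod_cone n \<gamma>"
    then have g: "\<And>s. s \<in> space (Rn n) \<Longrightarrow> \<gamma> s \<in> unit_ball prod_cone" and mp: "meas_path prod_cone n \<gamma>"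
      by (auto simp: unitary_path_def)
    have un: "untuple (\<gamma> s) \<in> cliques (pcs_prod I Xs)" if "s \<in> space (Rn n)" for s by (rule \<theta>'_ball[OF g[OF that]])
    have "(\<lambda>s. untuple (\<gamma> s) (i, a)) \<in> borel_measurable (Rn n)" for i a
    proof (cases "i \<in> I \<and> a \<in> web (Xs i)")
      case True
      \<comment> \<open>The test that is zero on all components but \<open>i\<close> isolates the
        coordinate \<open>(i, a)\<close>.\<close>
      let ?m = "\<lambda>j x. if j = i then x a else (0::real)"
      have "(\<lambda>r x. \<Sum>j\<in>I. ?m j (x j)) \<in> tests prod_cone 0"
      proof (rule tests_prod_coneI)
        show "?m j = (\<lambda>x. 0) \<or> (\<exists>a\<in>web (Xs j). ?m j = (\<lambda>x. x a))" for j
          using True by (cases "j = i") (auto intro!: bexI[of _ a])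
      qed
      then have m: "(\<lambda>(r, s). \<Sum>j\<in>I. ?m j (\<gamma> s j)) \<in> borel_measurable (Rn 0 \<Otimes>\<^sub>M Rn n)"
        using mp unfolding meas_path_def by fast
      have "(\<lambda>s. (\<lambda>_. undefined, s)) \<in> measurable (Rn n) (Rn 0 \<Otimes>\<^sub>M Rn n)"
        by (intro measurable_Pair measurable_ident_sets measurable_const) (auto simp: space_PiM)
      from measurable_compose[OF this m] show ?thesis using True I by (simp add: untuple_def)
    next
      case False
      then have "untuple (\<gamma> s) (i, a) = 0" if "s \<in> space (Rn n)" for s
        using clique_outside[OF is_pcs_prod un[OF that], of "(i, a)"] by (auto simp: pcs_prod_def)
      then show ?thesis by (subst measurable_cong[where g = "\<lambda>_. 0"]) auto
    qed
    then have "(\<lambda>s. untuple (\<gamma> s) p) \<in> borel_measurable (Rn n)" for p by (cases p) simp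
    then have "unitary_path (Fm (pcs_prod I Xs)) n (\<lambda>s. untuple (\<gamma> s))"
      using un by (simp add: unitary_path_Fm_iff[OF is_pcs_prod])
    then show "meas_path (Fm (pcs_prod I Xs)) n (\<lambda>s. untuple (\<gamma> s))" by (simp add: unitary_path_def)
  qed
  then show ?thesis by (simp add: prod_map_def unit_ball_Fm[OF is_pcs_prod])
qed

end

section \<open>Exponentials\<close>

context
  fixes X :: "'a pcs" and Y :: "'b pcs"
  assumes X: "is_pcs X" and Y: "is_pcs Y"
begin

abbreviation (input) "XY \<equiv> pcs_exp X Y"
abbreviation (input) "exp_cone \<equiv> cone_exp (Fm X) (Fm Y)"

lemma is_pcs_XY: "is_pcs XY"
  by (rule is_pcs_exp[OF X Y])

lemma Fm_map_apply: "x \<in> cliques X \<Longrightarrow> Fm_map X f x = hat X f x"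
  by (simp add: Fm_map_def unit_ball_Fm[OF X])

lemma Fm_map_inj_on: "inj_on (Fm_map X) (elems (Fm XY))"
proof (rule inj_onI)
  fix f g assume f: "f \<in> elems (Fm XY)" and g: "g \<in> elems (Fm XY)" and eq: "Fm_map X f = Fm_map X g"
  have "hat X f x = hat X g x" if "x \<in> cliques X" for x
    using fun_cong[OF eq, of x] by (simp add: Fm_map_apply[OF that])
  then show "f = g" by (rule hat_inject[OF X Y f g])
qed

text \<open>One inclusion is stability and measurability of power series, the other the
  representation of stable functions. It concerns whole cones and not just unit balls, as the
  transport of the linear structure requires.\<close>

lemma Fm_map_image: "Fm_map X ` elems (Fm XY) = meas_stable (Fm X) (Fm Y)"
proof (intro equalityI subsetI)
  show "\<phi> \<in> meas_stable (Fm X) (Fm Y)" if "\<phi> \<in> Fm_map X ` elems (Fm XY)" for \<phi>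
    using that Fm_map_in_meas_stable[OF X Y] by blast
  show "\<phi> \<in> Fm_map X ` elems (Fm XY)" if "\<phi> \<in> meas_stable (Fm X) (Fm Y)" for \<phi>
    using that stable_power_series(1)[OF X Y, of \<phi>] unfolding meas_stable_def by blast
qed

text \<open>All values of \<open>hat X f\<close> have norm at most \<open>c\<close> exactly when
  \<open>f / c\<close> is a morphism, that is, a clique of the exponential.\<close>

lemma exp_norm:
  assumes f: "f \<in> elems (Fm XY)"
  shows "cnorm exp_cone (Fm_map X f) = cnorm (Fm XY) f"
proof (rule eq_if_same_upper_bounds)
  have h: "hat X f x \<in> elems (Fm Y)" if "x \<in> cliques X" for x by (rule hat_elem[OF X Y f that])
  have n: "cnorm exp_cone (Fm_map X f) = (SUP x\<in>cliques X. cnorm (Fm Y) (hat X f x))"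
    by (simp add: cone_exp_def unit_ball_Fm[OF X] Fm_map_apply)
  have ne: "cliques X \<noteq> {}" using clique_zero[OF X] by blast
  obtain B where B: "B > 0" "(\<lambda>p. f p / B) \<in> pcoh_hom X Y" using f unfolding exp_elem_iff[OF X Y] by blast
  \<comment> \<open>A real supremum is meaningful only for a bounded set; the bound comes from a
    multiple of \<open>f\<close> being a morphism.\<close>
  have bdd: "bdd_above ((\<lambda>x. cnorm (Fm Y) (hat X f x)) ` cliques X)"
  proof (rule bdd_aboveI2)
    show "cnorm (Fm Y) (hat X f x) \<le> B" if "x \<in> cliques X" for x
      using hat_div_clique[OF X Y B(2) that] Fm_norm_le_iff[OF Y h[OF that] B(1)] by simp
  qed
  show "0 \<le> cnorm exp_cone (Fm_map X f)"
    unfolding n using Fm_norm_nonneg[OF Y h[OF clique_zero[OF X]]] cSUP_upper[OF clique_zero[OF X] bdd] by linarith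
  show "0 \<le> cnorm (Fm XY) f" by (rule Fm_norm_nonneg[OF is_pcs_XY f])
  fix c :: real assume c: "0 < c"
  have sc: "hat X (\<lambda>p. f p / c) x = (\<lambda>b. hat X f x b / c)" for x
    using hat_scale[of X "1 / c" f x] by simp
  have "cnorm exp_cone (Fm_map X f) \<le> c \<longleftrightarrow> (\<forall>x\<in>cliques X. cnorm (Fm Y) (hat X f x) \<le> c)"
    unfolding n by (rule cSUP_le_iff[OF ne bdd])
  also have "\<dots> \<longleftrightarrow> (\<forall>x\<in>cliques X. (\<lambda>b. hat X f x b / c) \<in> cliques Y)"
    using Fm_norm_le_iff[OF Y h c] by simp
  also have "\<dots> \<longleftrightarrow> (\<lambda>p. f p / c) \<in> pcoh_hom X Y"
  proof
    assume r: "\<forall>x\<in>cliques X. (\<lambda>b. hat X f x b / c) \<in> cliques Y"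
    have "(\<lambda>p. f p / c) \<in> elems (Fm XY)" using Fm_scale(1)[OF is_pcs_XY f, of "1 / c"] c by simp
    from hat_summable[OF X Y this] Fm_elem_nnvecs[OF is_pcs_XY this] show "(\<lambda>p. f p / c) \<in> pcoh_hom X Y"
      using r by (simp add: pcoh_hom_def sc pcs_exp_def)
  qed (use hat_div_clique[OF X Y] in blast)
  also have "\<dots> \<longleftrightarrow> cnorm (Fm XY) f \<le> c" using Fm_norm_le_iff[OF is_pcs_XY f c] by (simp add: pcs_exp_def)
  finally show "cnorm exp_cone (Fm_map X f) \<le> c \<longleftrightarrow> cnorm (Fm XY) f \<le> c" .
qed

abbreviation (input) "series_coeffs \<equiv> inv_into (elems (Fm XY)) (Fm_map X)"

lemma elems_exp_cone: "elems exp_cone = meas_stable (Fm X) (Fm Y)"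
  by (simp add: cone_exp_def)

lemma cone_isometry_exp: "cone_isometry XY exp_cone (Fm_map X) series_coeffs"
proof
  show "is_pcs XY" by (rule is_pcs_XY)
  show "Fm_map X f \<in> elems exp_cone" if "f \<in> elems (Fm XY)" for f
    unfolding elems_exp_cone using that Fm_map_image by blast
  show "series_coeffs \<phi> \<in> elems (Fm XY)" if "\<phi> \<in> elems exp_cone" for \<phi>
    using that unfolding elems_exp_cone Fm_map_image[symmetric] by (rule inv_into_into)
  show "series_coeffs (Fm_map X f) = f" if "f \<in> elems (Fm XY)" for f
    by (rule inv_into_f_f[OF Fm_map_inj_on that])
  show "Fm_map X (series_coeffs \<phi>) = \<phi>" if "\<phi> \<in> elems exp_cone" for \<phi>
    using that unfolding elems_exp_cone Fm_map_image[symmetric] by (rule f_inv_into_f)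
  show "Fm_map X (\<lambda>a. 0) = czero exp_cone"
    by (simp add: Fm_map_def cone_exp_def hat_def Fm_def fun_eq_iff)
  show "Fm_map X (\<lambda>p. f p + g p) = cadd exp_cone (Fm_map X f) (Fm_map X g)"
    if "f \<in> elems (Fm XY)" "g \<in> elems (Fm XY)" for f g
    using that by (auto simp: Fm_map_def cone_exp_def unit_ball_Fm[OF X] hat_add[OF X Y] Fm_simps[OF Y] fun_eq_iff)
  show "Fm_map X (\<lambda>p. \<alpha> * f p) = cscale exp_cone \<alpha> (Fm_map X f)" for \<alpha> f
    by (auto simp: Fm_map_def cone_exp_def unit_ball_Fm[OF X] hat_scale Fm_simps[OF Y] fun_eq_iff)
  show "cnorm exp_cone (Fm_map X f) = cnorm (Fm XY) f" if "f \<in> elems (Fm XY)" for f using that by (rule exp_norm)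
qed

lemma tests_exp_cone:
  assumes "l \<in> tests exp_cone n"
  shows "\<exists>\<gamma> m. unitary_path (Fm X) n \<gamma> \<and> (m = (\<lambda>y. 0) \<or> (\<exists>b\<in>web Y. m = (\<lambda>y. y b))) \<and> l = (\<lambda>r \<phi>. m (\<phi> (\<gamma> r)))"
  using assms by (auto simp: cone_exp_def Fm_simps[OF Y])

lemma tests_exp_coneI:
  assumes "unitary_path (Fm X) n \<gamma>" "m = (\<lambda>y. 0) \<or> (\<exists>b\<in>web Y. m = (\<lambda>y. y b))"
  shows "(\<lambda>r \<phi>. m (\<phi> (\<gamma> r))) \<in> tests exp_cone n"
proof -
  have "(\<lambda>r. m) \<in> tests (Fm Y) n" using assms(2) by (auto simp: Fm_simps[OF Y])
  then show ?thesis
    unfolding cone_exp_def using assms(1) by (auto intro!: exI[of _ \<gamma>] exI[of _ "\<lambda>r. m"])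
qed

lemma unitary_path_const: "x \<in> cliques X \<Longrightarrow> unitary_path (Fm X) n (\<lambda>r. x)"
  by (simp add: unitary_path_Fm_iff[OF X])

text \<open>At fixed real parameters, a test on the exponential cone pulled back to
  \<open>Fm XY\<close> has this form or is zero.\<close>

lemma linear_scott_hat:
  assumes x: "x \<in> cliques X"
  shows "linear_scott (Fm XY) (\<lambda>f. hat X f x b)"
  unfolding linear_scott_def Fm_simps[OF is_pcs_XY]
proof (intro conjI ballI allI impI; (elim conjE)?)
  fix f s assume nd: "nondecreasing (Fm XY) f" and L: "is_seq_lub (Fm XY) f s"
  have f: "f n \<in> elems (Fm XY)" for n using nd by (simp add: nondecreasing_def)
  have s: "s \<in> elems (Fm XY)" using L by (simp add: is_seq_lub_def)
  have finc: "f n p \<le> f (Suc n) p" for n p using nd unfolding nondecreasing_Fm_iff[OF is_pcs_XY] by blast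
  have flim: "(\<lambda>n. f n p) \<longlonglongrightarrow> s p" for p using L unfolding is_seq_lub_Fm_iff[OF is_pcs_XY nd] by blast
  have lim: "(\<lambda>n. hat X (f n) x b) \<longlonglongrightarrow> hat X s x b"
    by (rule hat_tendsto[OF X Y f s finc flim x x]) auto
  have inc: "incseq (\<lambda>n. hat X (f n) x b)"
    unfolding hat_def using finc mpow_clique_nonneg[OF X x]
    by (intro incseq_SucI infsum_mono hat_summable[OF X Y f x] mult_right_mono)
  show bdd: "bdd_above (range (\<lambda>n. hat X (f n) x b))"
    using incseq_le[OF inc lim] by (auto intro!: bdd_aboveI[of _ "hat X s x b"])
  show "hat X s x b = (SUP n. hat X (f n) x b)"
    using LIMSEQ_incseq_SUP[OF bdd inc] lim LIMSEQ_unique by blast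
qed (auto simp: hat_nonneg[OF X Y _ x] hat_add[OF X Y _ _ x] hat_scale)

lemma cstab_iso_exp: "cstab_iso (Fm XY) exp_cone (exp_map X Y)"
proof -
  interpret cone_isometry XY exp_cone "Fm_map X" series_coeffs by (rule cone_isometry_exp)
  have unit: "\<gamma> r \<in> cliques X" "(\<lambda>r. \<gamma> r a) \<in> borel_measurable (Rn n)"
    if "unitary_path (Fm X) n \<gamma>" "r \<in> space (Rn n)" for n \<gamma> r a
    using that by (simp_all add: unitary_path_Fm_iff[OF X])
  have scott: "\<forall>n. \<forall>l\<in>tests exp_cone n. \<forall>r\<in>space (Rn n). linear_scott (Fm XY) (\<lambda>f. l r (Fm_map X f))"
  proof (intro allI ballI)
    fix n l r assume l: "l \<in> tests exp_cone n" and r: "r \<in> space (Rn n)"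
    obtain \<gamma> m where \<gamma>: "unitary_path (Fm X) n \<gamma>" and m: "m = (\<lambda>y. 0) \<or> (\<exists>b\<in>web Y. m = (\<lambda>y. y b))"
      and l: "l = (\<lambda>r \<phi>. m (\<phi> (\<gamma> r)))" using tests_exp_cone[OF l] by blast
    show "linear_scott (Fm XY) (\<lambda>f. l r (Fm_map X f))"
      using m linear_scott_hat[OF unit(1)[OF \<gamma> r]] linear_scott_zero[OF is_pcs_XY]
      by (auto simp: l Fm_map_apply[OF unit(1)[OF \<gamma> r]])
  qed
  have zero: "\<forall>n. \<exists>l\<in>tests exp_cone n. \<forall>r\<in>space (Rn n). \<forall>\<phi>\<in>elems exp_cone. l r \<phi> = 0"
  proof (rule allI, rule bexI[of _ "\<lambda>r \<phi>. 0"])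
    fix n show "(\<lambda>r \<phi>. 0) \<in> tests exp_cone n"
      using tests_exp_coneI[OF unitary_path_const[OF clique_zero[OF X]], of "\<lambda>y. 0"] by simp
  qed simp
  have precomp: "\<forall>k n. \<forall>l\<in>tests exp_cone n. \<forall>h\<in>measurable (Rn k) (Rn n).
      \<exists>l'\<in>tests exp_cone k. \<forall>r\<in>space (Rn k). \<forall>\<phi>\<in>elems exp_cone. l' r \<phi> = l (h r) \<phi>"
  proof (intro allI ballI)
    fix k n l h assume l: "l \<in> tests exp_cone n" and h: "h \<in> measurable (Rn k) (Rn n)"
    obtain \<gamma> m where \<gamma>: "unitary_path (Fm X) n \<gamma>" and m: "m = (\<lambda>y. 0) \<or> (\<exists>b\<in>web Y. m = (\<lambda>y. y b))"
      and l: "l = (\<lambda>r \<phi>. m (\<phi> (\<gamma> r)))" using tests_exp_cone[OF l] by blast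
    have "\<gamma> (h r) \<in> cliques X" if "r \<in> space (Rn k)" for r
      by (rule unit(1)[OF \<gamma> measurable_space[OF h that]])
    moreover have "(\<lambda>r. \<gamma> (h r) a) \<in> borel_measurable (Rn k)" for a
      using \<gamma> measurable_compose[OF h, of "\<lambda>r. \<gamma> r a"] by (simp add: unitary_path_Fm_iff[OF X])
    ultimately have "unitary_path (Fm X) k (\<lambda>r. \<gamma> (h r))" by (simp add: unitary_path_Fm_iff[OF X])
    from tests_exp_coneI[OF this m] show "\<exists>l'\<in>tests exp_cone k. \<forall>r\<in>space (Rn k). \<forall>\<phi>\<in>elems exp_cone. l' r \<phi> = l (h r) \<phi>"
      unfolding l by (rule bexI[rotated]) simp
  qed
  define Q where "Q n l \<longleftrightarrow> (\<forall>\<phi>\<in>elems exp_cone. (\<lambda>r. l r \<phi> :: real) \<in> borel_measurable (Rn n))" for n l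
  have "Q n l" if l: "l \<in> tests exp_cone n" for n l
  proof -
    obtain \<gamma> m where \<gamma>: "unitary_path (Fm X) n \<gamma>" and m: "m = (\<lambda>y. 0) \<or> (\<exists>b\<in>web Y. m = (\<lambda>y. y b))"
      and l: "l = (\<lambda>r \<phi>. m (\<phi> (\<gamma> r)))" using tests_exp_cone[OF l] by blast
    have "\<forall>\<phi>\<in>elems exp_cone. \<forall>b. (\<lambda>r. \<phi> (\<gamma> r) b) \<in> borel_measurable (Rn n)"
      using \<gamma> by (simp add: elems_exp_cone meas_stable_def meas_path_Fm_iff[OF Y])
    then show ?thesis using m by (auto simp: l Q_def)
  qed
  then have "\<forall>n. \<forall>l\<in>tests exp_cone n. Q n l" by blast
  note meas = this[unfolded Q_def]
  have path: "meas_path exp_cone n (\<lambda>s. Fm_map X (\<gamma> s))" if \<gamma>: "unitary_path (Fm XY) n \<gamma>" for n \<gamma>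
  proof -
    have g: "\<gamma> s \<in> cliques XY" if "s \<in> space (Rn n)" for s
      by (rule bspec[OF conjunct1[OF \<gamma>[unfolded unitary_path_Fm_iff[OF is_pcs_XY]]] that])
    have gm: "(\<lambda>s. \<gamma> s p) \<in> borel_measurable (Rn n)" for p
      by (rule spec[OF conjunct2[OF \<gamma>[unfolded unitary_path_Fm_iff[OF is_pcs_XY]]]])
    show "meas_path exp_cone n (\<lambda>s. Fm_map X (\<gamma> s))"
      unfolding meas_path_def
    proof (intro conjI ballI allI)
      show "Fm_map X (\<gamma> s) \<in> elems exp_cone" if "s \<in> space (Rn n)" for s by (rule \<theta>_elem[OF clique_elem[OF is_pcs_XY g[OF that]]])
      show "\<exists>B. \<forall>s\<in>space (Rn n). cnorm exp_cone (Fm_map X (\<gamma> s)) \<le> B"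
        using \<theta>_ball[OF g] by (intro exI[of _ 1]) (auto simp: unit_ball_def)
      fix k l assume "l \<in> tests exp_cone k"
      then obtain \<delta> m where \<delta>: "unitary_path (Fm X) k \<delta>" and m: "m = (\<lambda>y. 0) \<or> (\<exists>b\<in>web Y. m = (\<lambda>y. y b))"
        and l: "l = (\<lambda>r \<phi>. m (\<phi> (\<delta> r)))" using tests_exp_cone by blast
      have d: "\<And>r. r \<in> space (Rn k) \<Longrightarrow> \<delta> r \<in> cliques X" and dm: "\<And>a. (\<lambda>r. \<delta> r a) \<in> borel_measurable (Rn k)"
        using \<delta> unfolding unitary_path_Fm_iff[OF X] by auto
      \<comment> \<open>The path of matrices is taken at \<open>s\<close> and the path of arguments
        at \<open>r\<close>, hence joint measurability in both.\<close>
      have "(\<lambda>p. hat X (\<gamma> (snd p)) (\<delta> (fst p)) b) \<in> borel_measurable (Rn k \<Otimes>\<^sub>M Rn n)" for b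
      proof (rule borel_measurable_hat[OF X Y])
        show "\<gamma> (snd p) \<in> elems (Fm XY)" "\<delta> (fst p) \<in> cliques X" if "p \<in> space (Rn k \<Otimes>\<^sub>M Rn n)" for p
          using that clique_elem[OF is_pcs_XY g] d by (auto simp: space_pair_measure)
        show "(\<lambda>p. \<gamma> (snd p) q) \<in> borel_measurable (Rn k \<Otimes>\<^sub>M Rn n)" for q by (rule measurable_compose[OF measurable_snd gm])
        show "(\<lambda>p. \<delta> (fst p) a) \<in> borel_measurable (Rn k \<Otimes>\<^sub>M Rn n)" for a by (rule measurable_compose[OF measurable_fst dm])
      qed
      moreover have "(\<lambda>(r, s). Fm_map X (\<gamma> s) (\<delta> r) b) \<in> borel_measurable (Rn k \<Otimes>\<^sub>M Rn n) \<longleftrightarrow>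
          (\<lambda>p. hat X (\<gamma> (snd p)) (\<delta> (fst p)) b) \<in> borel_measurable (Rn k \<Otimes>\<^sub>M Rn n)" for b
        by (rule measurable_cong) (auto simp: space_pair_measure Fm_map_apply[OF d])
      ultimately show "(\<lambda>(r, s). l r (Fm_map X (\<gamma> s))) \<in> borel_measurable (Rn k \<Otimes>\<^sub>M Rn n)"
        using m by (auto simp: l)
    qed
  qed
  have path': "meas_path (Fm XY) n (\<lambda>s. series_coeffs (\<Gamma> s))" if \<Gamma>: "unitary_path exp_cone n \<Gamma>" for n \<Gamma>
  proof -
    have g: "\<And>s. s \<in> space (Rn n) \<Longrightarrow> \<Gamma> s \<in> unit_ball exp_cone" and mp: "meas_path exp_cone n \<Gamma>"
      using \<Gamma> by (simp_all add: unitary_path_def)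
    have c: "series_coeffs (\<Gamma> s) \<in> cliques XY" if "s \<in> space (Rn n)" for s by (rule \<theta>'_ball[OF g[OF that]])
    have hc: "hat X (series_coeffs (\<Gamma> s)) x = \<Gamma> s x" if "s \<in> space (Rn n)" "x \<in> cliques X" for s x
      using \<theta>_\<theta>'[OF ball_D_elem[OF g[OF that(1)]]] Fm_map_apply[OF that(2)] by metis
    have "(\<lambda>s. series_coeffs (\<Gamma> s) (\<mu>, b)) \<in> borel_measurable (Rn n)" for \<mu> b
    proof (cases "b \<in> web Y")
      case True
      show ?thesis
      proof (rule coefficient_borel_measurable[OF X Y])
        show "series_coeffs (\<Gamma> s) \<in> elems (Fm XY)" if "s \<in> space (Rn n)" for s by (rule clique_elem[OF is_pcs_XY c[OF that]])
        fix x assume x: "x \<in> cliques X"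
        \<comment> \<open>Testing with the constant path at \<open>x\<close> shows that evaluation
          at \<open>x\<close> is measurable along \<open>\<Gamma>\<close>; the coefficients inherit
          this as limits.\<close>
        have "(\<lambda>r \<phi>. (\<lambda>y. y b) (\<phi> ((\<lambda>r. x) r))) \<in> tests exp_cone 0"
          using True by (intro tests_exp_coneI[OF unitary_path_const[OF x]]) auto
        then have m: "(\<lambda>(r, s). (\<lambda>r \<phi>. (\<lambda>y. y b) (\<phi> ((\<lambda>r. x) r))) r (\<Gamma> s)) \<in> borel_measurable (Rn 0 \<Otimes>\<^sub>M Rn n)"
          using mp unfolding meas_path_def by fast
        have "(\<lambda>s. (\<lambda>_. undefined, s)) \<in> measurable (Rn n) (Rn 0 \<Otimes>\<^sub>M Rn n)"
          by (intro measurable_Pair measurable_ident_sets measurable_const) (auto simp: space_PiM)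
        from measurable_compose[OF this m] have "(\<lambda>s. \<Gamma> s x b) \<in> borel_measurable (Rn n)" by simp
        then show "(\<lambda>s. hat X (series_coeffs (\<Gamma> s)) x b) \<in> borel_measurable (Rn n)"
          using hc[OF _ x] by (subst measurable_cong[where g = "\<lambda>s. \<Gamma> s x b"]) auto
      qed
    next
      case False
      then have "series_coeffs (\<Gamma> s) (\<mu>, b) = 0" if "s \<in> space (Rn n)" for s
        using exp_elem_outside[OF X Y clique_elem[OF is_pcs_XY c[OF that]]] by simp
      then show ?thesis by (subst measurable_cong[where g = "\<lambda>_. 0"]) auto
    qed
    then have "(\<lambda>s. series_coeffs (\<Gamma> s) p) \<in> borel_measurable (Rn n)" for p by (cases p) simp
    then have "unitary_path (Fm XY) n (\<lambda>s. series_coeffs (\<Gamma> s))" using c by (simp add: unitary_path_Fm_iff[OF is_pcs_XY])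
    then show "meas_path (Fm XY) n (\<lambda>s. series_coeffs (\<Gamma> s))" by (simp add: unitary_path_def)
  qed
  from cstab_iso_D[OF scott zero precomp meas path path'] show ?thesis
    by (simp add: exp_map_def unit_ball_Fm[OF is_pcs_XY])
qed

end

section \<open>Fullness on morphisms and assembly of the statement\<close>

lemma Fm_map_full:
  assumes X: "is_pcs X" and Y: "is_pcs Y" and \<phi>: "\<phi> \<in> cstab_hom (Fm X) (Fm Y)"
  shows "\<exists>f\<in>pcoh_hom X Y. Fm_map X f = \<phi>"
proof (rule stable_power_series(2)[OF X Y])
  show "stable (Fm X) (Fm Y) \<phi>" using \<phi> by (simp add: cstab_hom_def meas_stable_def)
  show "\<phi> x \<in> cliques Y" if "x \<in> cliques X" for x
    using \<phi> that by (simp add: cstab_hom_def unit_ball_Fm[OF X] unit_ball_Fm[OF Y])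
qed

theorem theorem5p15:
  fixes X :: "'a pcs" and Y :: "'b pcs" and Z :: "'c pcs"
    and I :: "'i set" and Xs :: "'i \<Rightarrow> 'd pcs"
  assumes "is_pcs X" and "is_pcs Y" and "is_pcs Z"
    and "finite I" and "\<forall>i\<in>I. is_pcs (Xs i)"
  shows
    "\<comment> \<open>functor\<close>
     measurable_cone (Fm X) \<and>
     (\<forall>f\<in>pcoh_hom X Y. Fm_map X f \<in> cstab_hom (Fm X) (Fm Y)) \<and>
     pcoh_id X \<in> pcoh_hom X X \<and> Fm_map X (pcoh_id X) = cstab_id (Fm X) \<and>
     (\<forall>f\<in>pcoh_hom X Y. \<forall>g\<in>pcoh_hom Y Z.
        pcoh_comp Y g f \<in> pcoh_hom X Z \<and>
        Fm_map X (pcoh_comp Y g f) = cstab_comp (Fm X) (Fm_map Y g) (Fm_map X f)) \<and>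
     \<comment> \<open>full\<close>
     (\<forall>\<phi>\<in>cstab_hom (Fm X) (Fm Y). \<exists>f\<in>pcoh_hom X Y. Fm_map X f = \<phi>) \<and>
     \<comment> \<open>faithful\<close>
     inj_on (Fm_map X) (pcoh_hom X Y) \<and>
     \<comment> \<open>finite products\<close>
     is_pcs (pcs_prod I Xs) \<and>
     cstab_iso (Fm (pcs_prod I Xs)) (cone_prod I (\<lambda>i. Fm (Xs i))) (prod_map I Xs) \<and>
     \<comment> \<open>exponentials\<close>
     is_pcs (pcs_exp X Y) \<and>
     cstab_iso (Fm (pcs_exp X Y)) (cone_exp (Fm X) (Fm Y)) (exp_map X Y)"
proof (intro conjI ballI)
  note X = assms(1) and Y = assms(2) and Z = assms(3)
  have Xs: "\<And>i. i \<in> I \<Longrightarrow> is_pcs (Xs i)" using assms(5) by blast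
  show "measurable_cone (Fm X)" by (rule measurable_cone_Fm[OF X])
  show "Fm_map X f \<in> cstab_hom (Fm X) (Fm Y)" if "f \<in> pcoh_hom X Y" for f
    by (rule Fm_map_in_cstab_hom[OF X Y that])
  show "pcoh_id X \<in> pcoh_hom X X" "Fm_map X (pcoh_id X) = cstab_id (Fm X)"
    by (rule pcoh_id_hom[OF X])+
  show "pcoh_comp Y g f \<in> pcoh_hom X Z"
    "Fm_map X (pcoh_comp Y g f) = cstab_comp (Fm X) (Fm_map Y g) (Fm_map X f)"
    if "f \<in> pcoh_hom X Y" "g \<in> pcoh_hom Y Z" for f g
    by (rule pcoh_comp_hom(1)[OF X Y Z that] Fm_map_comp[OF X Y Z that])+
  show "\<exists>f\<in>pcoh_hom X Y. Fm_map X f = \<phi>" if "\<phi> \<in> cstab_hom (Fm X) (Fm Y)" for \<phi>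
    by (rule Fm_map_full[OF X Y that])
  show "inj_on (Fm_map X) (pcoh_hom X Y)"
    using Fm_map_inj_on[OF X Y] hom_exp_elem[OF X Y] by (rule inj_on_subset[OF _ subsetI])
  show "is_pcs (pcs_prod I Xs)" by (rule is_pcs_prod[OF assms(4) Xs])
  show "cstab_iso (Fm (pcs_prod I Xs)) (cone_prod I (\<lambda>i. Fm (Xs i))) (prod_map I Xs)"
    by (rule cstab_iso_prod[OF assms(4) Xs])
  show "is_pcs (pcs_exp X Y)" by (rule is_pcs_exp[OF X Y])
  show "cstab_iso (Fm (pcs_exp X Y)) (cone_exp (Fm X) (Fm Y)) (exp_map X Y)"
    by (rule cstab_iso_exp[OF X Y])
qed

end
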